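(* Assume (A1)--(A4), let $\widehat q\in L^2(\mathcal{D})$ and $\phi_0\in\mathbb{W}^+\oplus\mathbb{W}^-$. Let $\widehat\phi_h\in\mathbb{W}_h^+\oplus\mathbb{V}_h^-$ be the solution of the discrete stationary problem (SP$_h$) with source $\widehat q$, and let $\phi_h\in H^1(0,T;\mathbb{W}_h^+\oplus\mathbb{V}_h^-)$ be the solution of the semi-discrete problem (SD) with time-independent source $q=\widehat q$ and initial value $\phi_h(0)=\Pi_h\phi_0$. Then, for $0\le t\le T$, $$\|\phi_h(t)-\widehat\phi_h\|_{L^2(\mathcal{D})}^2\le e^{-\underline{\sigma}_a t}\|\phi_h(0)-\widehat\phi_h\|_{L^2(\mathcal{D})}^2.$$
   Context: Let $\mathcal{R}\subset\mathbb{R}^3$ be a bounded Lipschitz domain with outward unit normal $n=n(r)$, $\mathcal{S}^2$ the unit sphere in $\mathbb{R}^3$, $\mathcal{D}=\mathcal{R}\times\mathcal{S}^2$, $\partial\mathcal{D}=\partial\mathcal{R}\times\mathcal{S}^2$, and $T>0$. The gradient $\nabla$ acts on $r$; $(\cdot,\cdot)_M$ is the integral over $M$ of the product of two functions. Spaces: $\mathbb{V}=L^2(\mathcal{D})$; $\mathbb{W}=\{v\in L^2(\mathcal{D}): s\cdot\nabla v\in L^2(\mathcal{D}),\ |s\cdot n|^{1/2}v\in L^2(\partial\mathcal{D})\}$. Even and odd parts are $\phi^\pm(r,s)=\frac12(\phi(r,s)\pm\phi(r,-s))$; $\mathbb{V}^\pm,\mathbb{W}^\pm$ are the subspaces of functions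 even ($+$) or odd ($-$) in $s$. Coefficients: $k\in L^\infty(\mathcal{R}\times[-1,1])$, $\sigma_t\in L^\infty(\mathcal{R})$, $\sigma_s(r)=\int_{\mathcal{S}^2}k(r,s\cdot s')\,ds$, $\sigma_a=\sigma_t-\sigma_s$, and $\mathcal{C}\phi(r,s)=\sigma_t(r)\phi(r,s)-\int_{\mathcal{S}^2}k(r,s\cdot s')\phi(r,s')\,ds'$. (A1) $0\le k(r,s\cdot s')\le\overline{k}$ for all $r,s,s'$, with a constant $\overline k$. (A2) $0<\underline{\sigma}_a\le\sigma_a(r)\le\overline{\sigma}_a$ for all $r\in\mathcal{R}$, with constants $\underline{\sigma}_a,\overline{\sigma}_a$. (A3) $\mathbb{W}_h^+\subset\mathbb{W}^+$ and $\mathbb{V}_h^-\subset\mathbb{V}^-$ are finite dimensional subspaces. (A4) $s\cdot\nabla\mathbb{W}_h^+\subset\mathbb{V}_h^-$. Bilinear form: $B(\phi;\psi)=(|s\cdot n|\phi^+,\psi^+)_{\partial\mathcal{D}}+(\mathcal{C}\phi,\psi)_{\mathcal{D}}-(\phi^-,s\cdot\nabla\psi^+)_{\mathcal{D}}+(s\cdot\nabla\phi^+,\psi^-)_{\mathcal{D}}$ for $\phi,\psi\in\mathbb{W}^+\oplus\mathbb{V}^-$. The elliptic projection $\Pi_h:\mathbb{W}^+\oplus\mathbb{V}^-\to\mathbb{W}_h^+\oplus\mathbb{V}_h^-$ is defined by $B(\Pi_h\phi;\psi_h)=B(\phi;\psi_h)$ for all $\psi_h\in\mathbb{W}_h^+\oplus\mathbb{V}_h^-$.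 Problem (SP$_h$): find $\widehat\phi_h\in\mathbb{W}_h^+\oplus\mathbb{V}_h^-$ with $B(\widehat\phi_h;\widehat\psi_h)=(\widehat q,\widehat\psi_h)_{\mathcal{D}}$ for all $\widehat\psi_h\in\mathbb{W}_h^+\oplus\mathbb{V}_h^-$. Problem (SD): find $\phi_h\in H^1(0,T;\mathbb{W}_h^+\oplus\mathbb{V}_h^-)$ with $\phi_h(0)=\Pi_h\phi_0$ such that $(\partial_t\phi_h(t),\widehat\psi_h)_{\mathcal{D}}+B(\phi_h(t);\widehat\psi_h)=(q(t),\widehat\psi_h)_{\mathcal{D}}$ for all $\widehat\psi_h\in\mathbb{W}_h^+\oplus\mathbb{V}_h^-$ and almost every $t\in(0,T)$. Both discrete problems are uniquely solvable. *)

theory Defs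
  imports "HOL-Analysis.Analysis"
begin

section \<open>Geometry: Lipschitz domains, surface measure, unit normal\<close>

type_synonym vec3 = "real ^ 3"
type_synonym field = "vec3 \<times> vec3 \<Rightarrow> real"

text \<open>Near each boundary point, the set is the strict epigraph of a Lipschitz function over the
  plane orthogonal to some unit vector \<open>e\<close>; \<open>x - (x \<bullet> e) *\<^sub>R e\<close> is the projection
  of \<open>x\<close> to that plane.\<close>

definition lipschitz_domain :: "vec3 set \<Rightarrow> bool" where
  "lipschitz_domain R \<longleftrightarrow> open R \<and> connected R \<and> R \<noteq> {} \<and>
     (\<forall>p\<in>frontier R. \<exists>e (\<gamma> :: vec3 \<Rightarrow> real) L \<rho>. norm e = 1 \<and> L-lipschitz_on UNIV \<gamma> \<and> \<rho> > 0 \<and>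
        (\<forall>x\<in>ball p \<rho>. x \<in> R \<longleftrightarrow> \<gamma> (x - (x \<bullet> e) *\<^sub>R e) < x \<bullet> e))"

text \<open>The two-dimensional Hausdorff (outer) measure, normalised to agree with area on planes. It is
  a metric outer measure, hence countably additive on Borel sets, so that \<^const>\<open>measure_of\<close>
  yields it unchanged on the Borel sets.\<close>

definition hausdorff2_outer :: "vec3 set \<Rightarrow> ennreal" where
  "hausdorff2_outer A = (SUP \<delta>\<in>{0<..}.
     INF U\<in>{U :: nat \<Rightarrow> vec3 set. A \<subseteq> (\<Union>i. U i) \<and> (\<forall>i. bounded (U i) \<and> diameter (U i) \<le> \<delta>)}.
       (\<Sum>i. ennreal (pi / 4 * (diameter (U i))\<^sup>2)))"

definition surface_measure :: "vec3 set \<Rightarrow> vec3 measure" where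
  "surface_measure S = restrict_space (measure_of UNIV (sets borel) hausdorff2_outer) S"

abbreviation sphere_measure :: "vec3 measure" where
  "sphere_measure \<equiv> surface_measure (sphere 0 1)"

text \<open>\<open>\<nu>\<close> is the outward unit normal at \<open>p\<close> if \<open>R\<close> is, to first order at \<open>p\<close>, the
  half-space \<open>{y. (y - p) \<bullet> \<nu> < 0}\<close>. There is at most one such \<open>\<nu>\<close>; for a Lipschitz domain it
  exists wherever a local graph function is differentiable, hence at almost every boundary point.\<close>

definition is_outward_normal :: "vec3 set \<Rightarrow> vec3 \<Rightarrow> vec3 \<Rightarrow> bool" where
  "is_outward_normal R p \<nu> \<longleftrightarrow> norm \<nu> = 1 \<and>
     (\<forall>\<epsilon>>0. \<exists>\<delta>>0. \<forall>y\<in>ball p \<delta>.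
        ((y - p) \<bullet> \<nu> < - \<epsilon> * norm (y - p) \<longrightarrow> y \<in> R) \<and>
        ((y - p) \<bullet> \<nu> > \<epsilon> * norm (y - p) \<longrightarrow> y \<notin> R))"

definition outward_normal :: "vec3 set \<Rightarrow> vec3 \<Rightarrow> vec3" where
  "outward_normal R p =
     (if \<exists>\<nu>. is_outward_normal R p \<nu> then (SOME \<nu>. is_outward_normal R p \<nu>) else 0)"

definition phase_measure :: "vec3 set \<Rightarrow> (vec3 \<times> vec3) measure" where
  "phase_measure R = restrict_space lborel R \<Otimes>\<^sub>M sphere_measure"

definition bdry_measure :: "vec3 set \<Rightarrow> (vec3 \<times> vec3) measure" where
  "bdry_measure R = surface_measure (frontier R) \<Otimes>\<^sub>M sphere_measure"


section \<open>Lebesgue spaces and smooth functions\<close>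

text \<open>Elements of \<open>L\<^sup>2\<close> are represented by functions, and equality in \<open>L\<^sup>2\<close> by equality almost
  everywhere. A subspace of \<open>L\<^sup>2\<close> is represented by the set of all representatives of its
  elements; its dimension is that of the space of equivalence classes.\<close>

definition L2 :: "'a measure \<Rightarrow> ('a \<Rightarrow> real) set" where
  "L2 M = {f \<in> borel_measurable M. integrable M (\<lambda>x. (f x)\<^sup>2)}"

definition ip :: "'a measure \<Rightarrow> ('a \<Rightarrow> real) \<Rightarrow> ('a \<Rightarrow> real) \<Rightarrow> real" where
  "ip M f g = (LINT x|M. f x * g x)"

definition L2norm :: "'a measure \<Rightarrow> ('a \<Rightarrow> real) \<Rightarrow> real" where
  "L2norm M f = sqrt (LINT x|M. (f x)\<^sup>2)"

definition Linf :: "'a measure \<Rightarrow> ('a \<Rightarrow> real) set" where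
  "Linf M = {f \<in> borel_measurable M. \<exists>C. AE x in M. \<bar>f x\<bar> \<le> C}"

definition fin_dim_subspace :: "'a measure \<Rightarrow> ('a \<Rightarrow> real) set \<Rightarrow> bool" where
  "fin_dim_subspace M X \<longleftrightarrow> X \<subseteq> L2 M \<and> (\<lambda>_. 0) \<in> X \<and>
     (\<forall>f\<in>X. \<forall>g\<in>X. (\<lambda>x. f x + g x) \<in> X) \<and> (\<forall>c. \<forall>f\<in>X. (\<lambda>x. c * f x) \<in> X) \<and>
     (\<forall>f\<in>X. \<forall>g\<in>borel_measurable M. (AE x in M. f x = g x) \<longrightarrow> g \<in> X) \<and>
     (\<exists>E. finite E \<and> E \<subseteq> X \<and> (\<forall>f\<in>X. \<exists>c. AE x in M. f x = (\<Sum>b\<in>E. c b * b x)))"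

definition direct_sum :: "('a \<Rightarrow> real) set \<Rightarrow> ('a \<Rightarrow> real) set \<Rightarrow> ('a \<Rightarrow> real) set" where
  "direct_sum X Y = {\<lambda>x. f x + g x |f g. f \<in> X \<and> g \<in> Y}"

primrec Ck :: "nat \<Rightarrow> ('a :: real_normed_vector \<Rightarrow> real) \<Rightarrow> bool" where
  "Ck 0 f = continuous_on UNIV f"
| "Ck (Suc m) f = ((\<forall>x. f differentiable (at x)) \<and>
                   (\<forall>v. Ck m (\<lambda>x. frechet_derivative f (at x) v)))"

definition smooth :: "('a :: real_normed_vector \<Rightarrow> real) \<Rightarrow> bool" where
  "smooth f \<longleftrightarrow> (\<forall>m. Ck m f)"


section \<open>The spaces V and W\<close>

text \<open>\<open>s \<cdot> \<nabla>\<eta>\<close> for a classically differentiable \<open>\<eta>\<close>; the gradient acts on \<open>r\<close> only.\<close>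

definition sgrad :: "field \<Rightarrow> field" where
  "sgrad \<eta> = (\<lambda>(r, s). frechet_derivative (\<lambda>r'. \<eta> (r', s)) (at r) s)"

text \<open>Restrictions to \<open>R \<times> S\<^sup>2\<close> of these functions are exactly the smooth functions with compact
  support in \<open>R \<times> S\<^sup>2\<close>, \<open>R\<close> being open.\<close>

definition test_fun :: "vec3 set \<Rightarrow> field \<Rightarrow> bool" where
  "test_fun R \<eta> \<longleftrightarrow> smooth \<eta> \<and> (\<exists>K. compact K \<and> K \<subseteq> R \<and> (\<forall>r s. r \<notin> K \<longrightarrow> \<eta> (r, s) = 0))"

text \<open>\<open>g\<close> is the weak derivative \<open>s \<cdot> \<nabla>v\<close>, and it lies in \<open>L\<^sup>2\<close>.\<close>

definition has_stream :: "vec3 set \<Rightarrow> field \<Rightarrow> field \<Rightarrow> bool" where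
  "has_stream R v g \<longleftrightarrow> g \<in> L2 (phase_measure R) \<and>
     (\<forall>\<eta>. test_fun R \<eta> \<longrightarrow> ip (phase_measure R) v (sgrad \<eta>) = - ip (phase_measure R) g \<eta>)"

definition stream :: "vec3 set \<Rightarrow> field \<Rightarrow> field" where
  "stream R v = (SOME g. has_stream R v g)"

definition sn :: "vec3 set \<Rightarrow> field" where
  "sn R = (\<lambda>(r, s). s \<bullet> outward_normal R r)"

text \<open>\<open>\<gamma>\<close> is the trace of \<open>v\<close> on the boundary, with \<open>|s \<cdot> n|\<^bsup>1/2\<^esup> \<gamma>\<close> square integrable. The trace is
  characterised by Green's formula against functions smooth up to the boundary; it is determined
  almost everywhere where \<open>s \<cdot> n \<noteq> 0\<close>.\<close>

definition has_trace :: "vec3 set \<Rightarrow> field \<Rightarrow> field \<Rightarrow> bool" where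
  "has_trace R v \<gamma> \<longleftrightarrow> (\<lambda>x. sqrt \<bar>sn R x\<bar> * \<gamma> x) \<in> L2 (bdry_measure R) \<and>
     (\<forall>\<eta>. smooth \<eta> \<longrightarrow>
        ip (phase_measure R) v (sgrad \<eta>) + ip (phase_measure R) (stream R v) \<eta>
          = (LINT x|bdry_measure R. sn R x * \<gamma> x * \<eta> x))"

definition bdry_trace :: "vec3 set \<Rightarrow> field \<Rightarrow> field" where
  "bdry_trace R v = (SOME \<gamma>. has_trace R v \<gamma>)"

definition V_space :: "vec3 set \<Rightarrow> field set" where
  "V_space R = L2 (phase_measure R)"

definition W_space :: "vec3 set \<Rightarrow> field set" where
  "W_space R = {v \<in> L2 (phase_measure R). (\<exists>g. has_stream R v g) \<and> (\<exists>\<gamma>. has_trace R v \<gamma>)}"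

definition even_part :: "field \<Rightarrow> field" where
  "even_part \<phi> = (\<lambda>(r, s). (\<phi> (r, s) + \<phi> (r, - s)) / 2)"

definition odd_part :: "field \<Rightarrow> field" where
  "odd_part \<phi> = (\<lambda>(r, s). (\<phi> (r, s) - \<phi> (r, - s)) / 2)"

definition even_in :: "vec3 set \<Rightarrow> field set \<Rightarrow> field set" where
  "even_in R X = {v \<in> X. AE (r, s) in phase_measure R. v (r, - s) = v (r, s)}"

definition odd_in :: "vec3 set \<Rightarrow> field set \<Rightarrow> field set" where
  "odd_in R X = {v \<in> X. AE (r, s) in phase_measure R. v (r, - s) = - v (r, s)}"


section \<open>Coefficients, bilinear form and elliptic projection\<close>

text \<open>The integral of \<open>k r (s \<bullet> s')\<close> over \<open>s\<close> does not depend on the unit vector \<open>s'\<close>, by rotation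
  invariance of the surface measure; it is evaluated at the first coordinate vector.\<close>

definition sigma_s :: "(vec3 \<Rightarrow> real \<Rightarrow> real) \<Rightarrow> vec3 \<Rightarrow> real" where
  "sigma_s k r = (LINT s|sphere_measure. k r (s \<bullet> axis 1 1))"

definition sigma_a :: "(vec3 \<Rightarrow> real \<Rightarrow> real) \<Rightarrow> (vec3 \<Rightarrow> real) \<Rightarrow> vec3 \<Rightarrow> real" where
  "sigma_a k \<sigma>t r = \<sigma>t r - sigma_s k r"

definition coll :: "(vec3 \<Rightarrow> real \<Rightarrow> real) \<Rightarrow> (vec3 \<Rightarrow> real) \<Rightarrow> field \<Rightarrow> field" where
  "coll k \<sigma>t \<phi> = (\<lambda>(r, s). \<sigma>t r * \<phi> (r, s) - (LINT s'|sphere_measure. k r (s \<bullet> s') * \<phi> (r, s')))"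

definition Bform ::
  "vec3 set \<Rightarrow> (vec3 \<Rightarrow> real \<Rightarrow> real) \<Rightarrow> (vec3 \<Rightarrow> real) \<Rightarrow> field \<Rightarrow> field \<Rightarrow> real" where
  "Bform R k \<sigma>t \<phi> \<psi> =
     (LINT x|bdry_measure R. \<bar>sn R x\<bar> * bdry_trace R (even_part \<phi>) x * bdry_trace R (even_part \<psi>) x)
     + ip (phase_measure R) (coll k \<sigma>t \<phi>) \<psi>
     - ip (phase_measure R) (odd_part \<phi>) (stream R (even_part \<psi>))
     + ip (phase_measure R) (stream R (even_part \<phi>)) (odd_part \<psi>)"

definition elliptic_proj ::
  "vec3 set \<Rightarrow> (vec3 \<Rightarrow> real \<Rightarrow> real) \<Rightarrow> (vec3 \<Rightarrow> real) \<Rightarrow> field set \<Rightarrow> field \<Rightarrow> field" where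
  "elliptic_proj R k \<sigma>t Xh \<phi> =
     (SOME p. p \<in> Xh \<and> (\<forall>\<psi>\<in>Xh. Bform R k \<sigma>t p \<psi> = Bform R k \<sigma>t \<phi> \<psi>))"


section \<open>Functions of time with values in a subspace of \<open>L\<^sup>2\<close>\<close>

definition time_measure :: "real \<Rightarrow> real measure" where
  "time_measure T = lebesgue_on {0<..<T}"

text \<open>The Bochner space \<open>L\<^sup>2(0,T;X)\<close>, where \<open>X\<close> carries the norm of \<open>L\<^sup>2(M)\<close>: strongly measurable
  (an almost everywhere limit of simple functions) with square integrable norm.\<close>

definition bochner_L2 ::
  "'a measure \<Rightarrow> real \<Rightarrow> ('a \<Rightarrow> real) set \<Rightarrow> (real \<Rightarrow> 'a \<Rightarrow> real) \<Rightarrow> bool" where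
  "bochner_L2 M T X u \<longleftrightarrow>
     (AE t in time_measure T. u t \<in> X) \<and>
     (\<exists>S :: nat \<Rightarrow> real \<Rightarrow> 'a \<Rightarrow> real.
        (\<forall>n. simple_function (time_measure T) (S n) \<and> (\<forall>t\<in>{0<..<T}. S n t \<in> X)) \<and>
        (AE t in time_measure T. (\<lambda>n. L2norm M (\<lambda>x. S n t x - u t x)) \<longlonglongrightarrow> 0)) \<and>
     integrable (time_measure T) (\<lambda>t. (L2norm M (u t))\<^sup>2)"

text \<open>\<open>u\<close> belongs to \<open>H\<^sup>1(0,T;X)\<close> with weak derivative \<open>u'\<close>, and \<open>u\<close> is the representative that is
  continuous on \<open>{0..T}\<close>, so that point values \<open>u t\<close> make sense. The identity
  \<open>\<integral> \<eta>' u = - \<integral> \<eta> u'\<close> between elements of \<open>X\<close> is expressed by pairing with the elements of \<open>X\<close>.\<close>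

definition H1_time ::
  "'a measure \<Rightarrow> real \<Rightarrow> ('a \<Rightarrow> real) set \<Rightarrow> (real \<Rightarrow> 'a \<Rightarrow> real) \<Rightarrow> (real \<Rightarrow> 'a \<Rightarrow> real) \<Rightarrow> bool" where
  "H1_time M T X u u' \<longleftrightarrow> bochner_L2 M T X u \<and> bochner_L2 M T X u' \<and>
     (\<forall>\<eta> :: real \<Rightarrow> real. smooth \<eta> \<and> (\<exists>a b. 0 < a \<and> b < T \<and> (\<forall>t. t \<notin> {a..b} \<longrightarrow> \<eta> t = 0)) \<longrightarrow>
        (\<forall>v\<in>X. (LINT t|time_measure T. deriv \<eta> t * ip M (u t) v)
               = - (LINT t|time_measure T. \<eta> t * ip M (u' t) v))) \<and>
     (\<forall>t\<in>{0..T}. u t \<in> X \<and>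
        ((\<lambda>\<tau>. L2norm M (\<lambda>x. u \<tau> x - u t x)) \<longlongrightarrow> 0) (at t within {0..T}))"


section \<open>The discrete problems\<close>

definition solves_SPh ::
  "vec3 set \<Rightarrow> (vec3 \<Rightarrow> real \<Rightarrow> real) \<Rightarrow> (vec3 \<Rightarrow> real) \<Rightarrow> field set \<Rightarrow> field set \<Rightarrow>
   field \<Rightarrow> field \<Rightarrow> bool" where
  "solves_SPh R k \<sigma>t Wh Vh q \<phi> \<longleftrightarrow> \<phi> \<in> direct_sum Wh Vh \<and>
     (\<forall>\<psi>\<in>direct_sum Wh Vh. Bform R k \<sigma>t \<phi> \<psi> = ip (phase_measure R) q \<psi>)"

definition solves_SD ::
  "vec3 set \<Rightarrow> (vec3 \<Rightarrow> real \<Rightarrow> real) \<Rightarrow> (vec3 \<Rightarrow> real) \<Rightarrow> real \<Rightarrow> field set \<Rightarrow> field set \<Rightarrow>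
   (real \<Rightarrow> field) \<Rightarrow> field \<Rightarrow> (real \<Rightarrow> field) \<Rightarrow> bool" where
  "solves_SD R k \<sigma>t T Wh Vh q \<phi>0 \<phi> \<longleftrightarrow>
     (AE x in phase_measure R. \<phi> 0 x = elliptic_proj R k \<sigma>t (direct_sum Wh Vh) \<phi>0 x) \<and>
     (\<exists>\<phi>'. H1_time (phase_measure R) T (direct_sum Wh Vh) \<phi> \<phi>' \<and>
        (\<forall>\<psi>\<in>direct_sum Wh Vh. AE t in time_measure T.
           ip (phase_measure R) (\<phi>' t) \<psi> + Bform R k \<sigma>t (\<phi> t) \<psi> = ip (phase_measure R) (q t) \<psi>))"

end

theory Submission
  imports Defs
begin

text \<open>
  The error \<open>e(t) = \<phi>\<^sub>h(t) - \<phi>\<^sub>h\<^sub>a\<^sub>t\<close> of the evolution against the steady state lies in the finite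
  dimensional space \<open>X = W\<^sub>h \<oplus> V\<^sub>h\<close> and satisfies \<open>(e', \<psi>) + B(e; \<psi>) = 0\<close> for all \<open>\<psi> \<in> X\<close>. Testing with
  \<open>\<psi> = e\<close> gives \<open>(\<parallel>e\<parallel>\<^sup>2)' = - 2 B(e; e)\<close>. In \<open>B(e; e)\<close> the two streaming terms cancel, the boundary term is
  nonnegative, and the collision term is at least \<open>\<sigma>\<^sub>a \<parallel>e\<parallel>\<^sup>2\<close> with \<open>\<sigma>\<^sub>a\<close> the lower absorption bound. Hence
  \<open>exp (2 \<sigma>\<^sub>a t) \<parallel>e\<parallel>\<^sup>2\<close> does not increase, which is the assertion with the rate \<open>2 \<sigma>\<^sub>a\<close>, and the smaller
  rate \<open>\<sigma>\<^sub>a\<close> follows since \<open>t \<ge> 0\<close>.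

  Three points need an argument.

  \<^item> The energy identity for a weak time derivative. In an orthonormal basis of \<open>X\<close> the coefficients of \<open>e\<close>
    are continuous, and the equation says that their weak derivatives are linear combinations of the same
    coefficients, hence continuous. By the lemma of du Bois-Reymond
    (\<open>derivative_if_weak_derivative_continuous\<close>) the coefficients are then classically differentiable, and
    the energy estimate becomes calculus for a finite sum of squares (\<open>exponential_decay\<close>).

  \<^item> Bilinearity of \<open>B\<close>. The derivative \<open>s \<cdot> \<nabla>v\<close> and the boundary trace are chosen by the epsilon operator
    from those that satisfy an integral identity, so their linearity rests on uniqueness. The integral
    identity determines the product of the unknown with every polynomial (times a bump function inside the
    domain), and by Stone-Weierstrass an integrable function on a bounded set that is orthogonal to all
    polynomials vanishes almost everywhere (\<open>AE_zero_if_orthogonal_to_polynomials\<close>). For the trace this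
    needs a finite surface measure on the boundary, which the Lipschitz graphs provide
    (\<open>hausdorff2_frontier_finite\<close>), and measurability of the unit normal
    (\<open>borel_measurable_outward_normal\<close>).

  \<^item> Coercivity of the collision term (\<open>collision_coercive\<close>). The kernel \<open>k(r, s \<cdot> s')\<close> is symmetric in \<open>s\<close>
    and \<open>s'\<close>, and its integral over \<open>s'\<close> is \<open>\<sigma>\<^sub>s(r)\<close> for every \<open>s\<close> because Hausdorff measure is rotation
    invariant. By \<open>2ab \<le> a\<^sup>2 + b\<^sup>2\<close> the scattering operator has quadratic form at most \<open>\<sigma>\<^sub>s\<close>.
\<close>

section \<open>Smooth functions\<close>

lemma Ck_SucD: "Ck (Suc m) f \<Longrightarrow> Ck m f"
proof (induction m arbitrary: f)
  case 0
  then show ?case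
    by (simp add: continuous_on_eq_continuous_at differentiable_imp_continuous_within)
next
  case (Suc m)
  then show ?case by simp
qed

lemma Ck_SucI:
  assumes "\<And>x. (f has_derivative D x) (at x)" "\<And>v. Ck m (\<lambda>x. D x v)"
  shows "Ck (Suc m) f"
proof -
  have "frechet_derivative f (at x) = D x" for x
    using frechet_derivative_at[OF assms(1)] by simp
  then show ?thesis using assms by (auto simp: differentiable_def)
qed

lemma Ck_Suc_has_derivative:
  "Ck (Suc m) f \<Longrightarrow> (f has_derivative frechet_derivative f (at x)) (at x)"
  by (simp add: frechet_derivative_works[symmetric])

lemma Ck_const: "Ck m (\<lambda>_. c)"
proof (induction m arbitrary: c)
  case (Suc m)
  show ?case by (rule Ck_SucI[where D = "\<lambda>_ _. 0"]) (auto intro: Suc)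
qed simp

lemma Ck_add: "Ck m f \<Longrightarrow> Ck m g \<Longrightarrow> Ck m (\<lambda>x. f x + g x)"
proof (induction m arbitrary: f g)
  case (Suc m)
  show ?case
    by (rule Ck_SucI[OF has_derivative_add[OF Ck_Suc_has_derivative[OF Suc.prems(1)] Ck_Suc_has_derivative[OF Suc.prems(2)]]])
       (use Suc.IH Suc.prems in simp)
qed (simp add: continuous_on_add)

lemma Ck_mult: "Ck m f \<Longrightarrow> Ck m g \<Longrightarrow> Ck m (\<lambda>x. f x * g x)"
proof (induction m arbitrary: f g)
  case (Suc m)
  show ?case
    by (rule Ck_SucI[OF has_derivative_mult[OF Ck_Suc_has_derivative[OF Suc.prems(1)] Ck_Suc_has_derivative[OF Suc.prems(2)]]])
       (use Suc.IH Suc.prems Ck_SucD[OF Suc.prems(1)] Ck_SucD[OF Suc.prems(2)] in \<open>simp add: Ck_add\<close>)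
qed (simp add: continuous_on_mult)

text \<open>The derivative of \<open>g \<circ> f\<close> again contains a composition, with \<open>g'\<close> in place of \<open>g\<close>. Therefore the
  outer function is smooth and varies in the induction.\<close>

lemma Ck_compose:
  fixes g :: "real \<Rightarrow> real"
  shows "smooth g \<Longrightarrow> Ck m f \<Longrightarrow> Ck m (\<lambda>x. g (f x))"
proof (induction m arbitrary: g)
  case 0
  then have "Ck 0 g" unfolding smooth_def by blast
  with 0 show ?case using continuous_on_compose2[of UNIV g UNIV f] by simp
next
  case (Suc m)
  have g: "Ck (Suc n) g" for n using Suc.prems unfolding smooth_def by blast
  define g' where "g' = (\<lambda>x. frechet_derivative g (at x) 1)"
  have g': "smooth g'" using g unfolding smooth_def g'_def by simp
  have D: "(g has_derivative (\<lambda>v. v * g' x)) (at x)" for x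
  proof -
    have d: "(g has_derivative frechet_derivative g (at x)) (at x)" by (rule Ck_Suc_has_derivative[OF g])
    have "frechet_derivative g (at x) v = v * g' x" for v
      using linear_cmul[OF has_derivative_linear[OF d], of v 1] by (simp add: g'_def)
    then have "frechet_derivative g (at x) = (\<lambda>v. v * g' x)" by blast
    with d show ?thesis by simp
  qed
  show ?case
  proof (rule Ck_SucI)
    show "((\<lambda>x. g (f x)) has_derivative (\<lambda>v. frechet_derivative f (at x) v * g' (f x))) (at x)" for x
      using has_derivative_compose[OF Ck_Suc_has_derivative[OF Suc.prems(2)] D] by simp
    show "Ck m (\<lambda>x. frechet_derivative f (at x) v * g' (f x))" for v
      using Suc.prems(2) Suc.IH[OF g' Ck_SucD[OF Suc.prems(2)]] by (intro Ck_mult) simp_all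
  qed
qed

lemma smooth_const: "smooth (\<lambda>_. c)"
  and smooth_add: "smooth f \<Longrightarrow> smooth g \<Longrightarrow> smooth (\<lambda>x. f x + g x)"
  and smooth_mult: "smooth f \<Longrightarrow> smooth g \<Longrightarrow> smooth (\<lambda>x. f x * g x)"
  by (simp_all add: smooth_def Ck_const Ck_add Ck_mult)

lemma smooth_compose:
  fixes g :: "real \<Rightarrow> real"
  shows "smooth g \<Longrightarrow> smooth f \<Longrightarrow> smooth (\<lambda>x. g (f x))"
  using Ck_compose[of g _ f] unfolding smooth_def[of f] smooth_def[of "\<lambda>x. g (f x)"] by blast

lemma smooth_bounded_linear:
  assumes "bounded_linear f" shows "smooth f"
  unfolding smooth_def
proof
  fix m show "Ck m f"
  proof (cases m)
    case 0 then show ?thesis using assms by (simp add: linear_continuous_on)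
  next
    case (Suc n)
    then show ?thesis
      using Ck_SucI[OF bounded_linear_imp_has_derivative[OF assms]] Ck_const by blast
  qed
qed

lemma smooth_diff: "smooth f \<Longrightarrow> smooth g \<Longrightarrow> smooth (\<lambda>x. f x - g x)"
  using smooth_add[of f "\<lambda>x. (-1) * g x"] smooth_mult[OF smooth_const[of "-1"], of g] by simp

lemma smooth_sum: "(\<And>i. i \<in> I \<Longrightarrow> smooth (f i)) \<Longrightarrow> smooth (\<lambda>x. \<Sum>i\<in>I. f i x)"
  by (induction I rule: infinite_finite_induct) (auto intro: smooth_const smooth_add)

lemma smooth_polynomial: "real_polynomial_function p \<Longrightarrow> smooth p"
  by (induction rule: real_polynomial_function.induct)
     (auto intro: smooth_bounded_linear smooth_const smooth_add smooth_mult)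

lemma smooth_continuous_on: "smooth f \<Longrightarrow> continuous_on S f"
proof -
  assume "smooth f" then have "Ck 0 f" unfolding smooth_def by blast
  then show ?thesis using continuous_on_subset[of UNIV f S] by simp
qed

lemma smooth_has_derivative: "smooth f \<Longrightarrow> (f has_derivative frechet_derivative f (at x)) (at x)"
  unfolding smooth_def by (rule Ck_Suc_has_derivative[of 0]) (rule spec)

lemma smooth_directional_derivative:
  "smooth f \<Longrightarrow> smooth (\<lambda>x. frechet_derivative f (at x) v)"
  unfolding smooth_def using Ck.simps(2)[of _ f] by blast

lemma smooth_DERIV_deriv:
  fixes f :: "real \<Rightarrow> real"
  assumes "smooth f"
  shows "(f has_real_derivative deriv f x) (at x)"
  using smooth_has_derivative[OF assms, of x]
  by (simp add: DERIV_deriv_iff_real_differentiable differentiableI)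

lemma continuous_on_deriv_smooth:
  fixes f :: "real \<Rightarrow> real"
  assumes "smooth f"
  shows "continuous_on S (deriv f)"
proof -
  have "deriv f x = frechet_derivative f (at x) 1" for x
    using frechet_derivative_at[OF smooth_DERIV_deriv[OF assms, of x, unfolded has_field_derivative_def], symmetric]
    by simp
  then have "deriv f = (\<lambda>x. frechet_derivative f (at x) 1)" by blast
  then show ?thesis
    using smooth_continuous_on[OF smooth_directional_derivative[OF assms, of 1]] by simp
qed

lemma smooth_real_antiderivative:
  fixes f :: "real \<Rightarrow> real"
  assumes "smooth f" "\<And>x. (F has_real_derivative f x) (at x)"
  shows "smooth F"
  unfolding smooth_def
proof
  fix m
  have "(F has_derivative (\<lambda>v. f x * v)) (at x)" for x
    using assms(2) by (simp add: has_field_derivative_def)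
  moreover have "Ck n (\<lambda>x. f x * v)" for n v
    using smooth_mult[OF assms(1) smooth_const] by (simp add: smooth_def)
  ultimately have "Ck (Suc m) F" by (rule Ck_SucI)
  then show "Ck m F" by (rule Ck_SucD)
qed

text \<open>The functions \<open>exp (- 1/x) / x\<^sup>n\<close>, extended by zero. The derivative of each is a linear combination of
  two others, so that one induction over all \<open>n\<close> shows that \<open>exp (- 1/x)\<close> is smooth.\<close>

definition flat :: "nat \<Rightarrow> real \<Rightarrow> real" where
  "flat n x = (if x > 0 then exp (- (1 / x)) / x ^ n else 0)"

lemma flat_tendsto_0: "(flat n \<longlongrightarrow> 0) (at_right 0)"
proof -
  have "((\<lambda>y. y ^ n / exp y) \<longlongrightarrow> (0::real)) at_top" by (rule tendsto_power_div_exp_0)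
  then have "((\<lambda>x. inverse x ^ n / exp (inverse x)) \<longlongrightarrow> (0::real)) (at_right 0)"
    by (rule filterlim_compose[OF _ filterlim_inverse_at_top_right])
  then show ?thesis
    by (rule Lim_transform_eventually)
       (auto simp: flat_def eventually_at_filter exp_minus field_simps)
qed

lemma flat_has_derivative:
  "(flat n has_real_derivative flat (n + 2) x - real n * flat (n + 1) x) (at x)"
proof (cases x "0::real" rule: linorder_cases)
  case less
  then have ev: "\<forall>\<^sub>F y in nhds x. flat n y = 0"
    using eventually_nhds_in_open[of "{..<0}" x] by (auto simp: flat_def elim!: eventually_mono)
  have "(flat n has_real_derivative 0) (at x)"
    using DERIV_cong_ev[OF refl ev refl, of 0] by simp
  with less show ?thesis by (simp add: flat_def)
next
  case greater
  then have ev: "\<forall>\<^sub>F y in nhds x. flat n y = exp (- (1 / y)) / y ^ n"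
    using eventually_nhds_in_open[of "{0<..}" x] by (auto simp: flat_def elim!: eventually_mono)
  moreover have "((\<lambda>x. exp (- (1 / x)) / x ^ n) has_real_derivative flat (n + 2) x - real n * flat (n + 1) x) (at x)"
  proof -
    have "((\<lambda>x. exp (- (1 / x))) has_real_derivative exp (- (1 / x)) / x\<^sup>2) (at x)"
      using greater by (auto intro!: derivative_eq_intros simp: power2_eq_square)
    moreover have "((\<lambda>x. x ^ n) has_real_derivative real n * x ^ (n - 1)) (at x)"
      using DERIV_pow[of n x] by simp
    ultimately have "((\<lambda>x. exp (- (1 / x)) / x ^ n) has_real_derivative
        (exp (- (1 / x)) / x\<^sup>2 * x ^ n - exp (- (1 / x)) * (real n * x ^ (n - 1))) / (x ^ n * x ^ n)) (at x)"
      using greater by (intro DERIV_divide) auto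
    also have "(exp (- (1 / x)) / x\<^sup>2 * x ^ n - exp (- (1 / x)) * (real n * x ^ (n - 1))) / (x ^ n * x ^ n)
        = flat (n + 2) x - real n * flat (n + 1) x"
      using greater by (cases n) (auto simp: flat_def field_simps power2_eq_square)
    finally show ?thesis .
  qed
  ultimately show ?thesis using DERIV_cong_ev[OF refl ev refl, of "flat (n + 2) x - real n * flat (n + 1) x"] by simp
next
  case equal
  have "((\<lambda>y. flat n y / y) \<longlongrightarrow> 0) (at_right 0)"
    by (rule Lim_transform_eventually[OF flat_tendsto_0[of "n + 1"]])
       (auto simp: flat_def eventually_at_filter)
  moreover have "((\<lambda>y. flat n y / y) \<longlongrightarrow> 0) (at_left 0)"
    by (rule Lim_transform_eventually[OF tendsto_const])
       (auto simp: flat_def eventually_at_filter)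
  ultimately have "((\<lambda>y. flat n y / y) \<longlongrightarrow> 0) (at 0)"
    by (simp add: filterlim_split_at)
  then show ?thesis using equal by (simp add: has_field_derivative_iff flat_def)
qed

lemma smooth_flat: "smooth (flat n)"
  unfolding smooth_def
proof
  fix m show "Ck m (flat n)"
  proof (induction m arbitrary: n)
    case 0
    show ?case
      using DERIV_isCont[OF flat_has_derivative] by (simp add: continuous_on_eq_continuous_at)
  next
    case (Suc m)
    show ?case
    proof (rule Ck_SucI[OF flat_has_derivative[of n, unfolded has_field_derivative_def]])
      show "Ck m (\<lambda>x. (flat (n + 2) x - real n * flat (n + 1) x) * v)" for v
        using Ck_mult[OF Ck_add[OF Suc.IH[of "n + 2"] Ck_mult[OF Ck_const[of m "- real n"] Suc.IH[of "n + 1"]]] Ck_const[of m v]]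
        by simp
    qed
  qed
qed

section \<open>Weak derivatives in time\<close>

text \<open>Used with the square of a distance for \<open>y\<close>, which makes it a smooth function supported in a ball of
  radius \<open>sqrt \<epsilon>\<close>.\<close>

definition bump :: "real \<Rightarrow> real \<Rightarrow> real" where
  "bump \<epsilon> y = flat 0 (\<epsilon> - y)"

lemma smooth_bump: "smooth f \<Longrightarrow> smooth (\<lambda>x. bump \<epsilon> (f x))"
  unfolding bump_def by (rule smooth_compose[OF smooth_flat smooth_diff[OF smooth_const]])

lemma bump_nonneg: "bump \<epsilon> y \<ge> 0" and bump_pos_iff: "bump \<epsilon> y > 0 \<longleftrightarrow> y < \<epsilon>"
  by (simp_all add: bump_def flat_def)

lemma bump_eq_0: "y \<ge> \<epsilon> \<Longrightarrow> bump \<epsilon> y = 0"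
  by (simp add: bump_def flat_def)

definition time_test :: "real \<Rightarrow> (real \<Rightarrow> real) \<Rightarrow> bool" where
  "time_test T \<eta> \<longleftrightarrow> smooth \<eta> \<and> (\<exists>a b. 0 < a \<and> b < T \<and> (\<forall>t. t \<notin> {a..b} \<longrightarrow> \<eta> t = 0))"

text \<open>The derivative of a test function can be a bump around \<open>a\<close> minus a bump around \<open>b\<close>, provided that both
  have the same integral. If \<open>h a < h b\<close> and the bumps are narrow, the pairing with \<open>h\<close> is negative.\<close>

lemma not_increasing_if_weak_derivative_zero:
  fixes h :: "real \<Rightarrow> real"
  assumes cont: "continuous_on {0..T} h"
    and weak: "\<And>\<eta>. time_test T \<eta> \<Longrightarrow> integral {0..T} (\<lambda>t. deriv \<eta> t * h t) = 0"
    and ab: "0 < a" "a < b" "b < T"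
  shows "h b \<le> h a"
proof (rule ccontr)
  assume "\<not> h b \<le> h a"
  \<comment> \<open>Subtracting the mean changes nothing, since the derivative of a test function has integral zero.\<close>
  define m where "m = (h a + h b) / 2"
  have m: "h a < m" "m < h b" using \<open>\<not> h b \<le> h a\<close> by (auto simp: m_def)
  have "a \<in> {0..T}" "b \<in> {0..T}" using ab by auto
  have "m - h a > 0" "h b - m > 0" using m by auto
  obtain d1 where d1: "d1 > 0" "\<And>x. x \<in> {0..T} \<Longrightarrow> dist x a < d1 \<Longrightarrow> dist (h x) (h a) < m - h a"
    using cont \<open>a \<in> {0..T}\<close> \<open>m - h a > 0\<close> unfolding continuous_on_iff by blast
  obtain d2 where d2: "d2 > 0" "\<And>x. x \<in> {0..T} \<Longrightarrow> dist x b < d2 \<Longrightarrow> dist (h x) (h b) < h b - m"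
    using cont \<open>b \<in> {0..T}\<close> \<open>h b - m > 0\<close> unfolding continuous_on_iff by blast
  define \<epsilon> where "\<epsilon> = min (min d1 d2) (min a (T - b)) / 2"
  have \<epsilon>: "\<epsilon> > 0" "\<epsilon> < d1" "\<epsilon> < d2" "\<epsilon> < a" "\<epsilon> < T - b" using d1(1) d2(1) ab by (auto simp: \<epsilon>_def)
  define \<rho> where "\<rho> = (\<lambda>x::real. bump (\<epsilon>\<^sup>2) (x\<^sup>2))"
  have \<rho>0: "\<rho> x \<ge> 0" for x by (simp add: \<rho>_def bump_nonneg)
  have \<rho>pos: "\<rho> x > 0 \<longleftrightarrow> \<bar>x\<bar> < \<epsilon>" for x
    using \<epsilon>(1) abs_le_square_iff[of \<epsilon> x] by (auto simp: \<rho>_def bump_pos_iff not_less[symmetric])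
  have \<rho>zero: "\<rho> x = 0" if "\<bar>x\<bar> \<ge> \<epsilon>" for x using \<rho>pos[of x] \<rho>0[of x] that by linarith
  have id: "smooth (\<lambda>x::real. x)" by (rule smooth_bounded_linear) simp
  have sm: "smooth (\<lambda>x. \<rho> (x - y))" for y
    unfolding \<rho>_def power2_eq_square
    by (intro smooth_bump smooth_mult smooth_diff smooth_const id)
  have "isCont \<rho> x" for x
    using smooth_continuous_on[OF sm[of 0], of UNIV] by (simp add: continuous_on_eq_continuous_at)
  then obtain G where G: "\<And>x. (G has_real_derivative \<rho> x) (at x)"
    using einterval_antiderivative[of "-\<infinity>" "\<infinity>" \<rho>] by (auto simp: has_real_derivative_iff_has_vector_derivative)
  have Gcont: "continuous_on S G" for S
    by (rule DERIV_continuous_on[OF has_field_derivative_at_within[OF G]])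
  have Gleft: "G x = G (- \<epsilon>)" if "x \<le> - \<epsilon>" for x
  proof (cases "x = - \<epsilon>")
    case False
    with that show ?thesis
      using DERIV_isconst_end[of x "- \<epsilon>" G, OF _ Gcont] DERIV_cong[OF G \<rho>zero] by simp
  qed simp
  have Gright: "G x = G \<epsilon>" if "x \<ge> \<epsilon>" for x
  proof (cases "x = \<epsilon>")
    case False
    with that show ?thesis
      using DERIV_isconst_end[of \<epsilon> x G, OF _ Gcont] DERIV_cong[OF G \<rho>zero] by simp
  qed simp
  \<comment> \<open>The antiderivative of the bump is constant to the left and to the right of its support, so the difference of two translates has compact support.\<close>
  define \<eta> where "\<eta> = (\<lambda>t. G (t - a) - G (t - b))"
  have D: "(\<eta> has_real_derivative \<rho> (t - a) - \<rho> (t - b)) (at t)" for t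
  proof -
    have "((\<lambda>x. G (x - y)) has_real_derivative \<rho> (t - y)) (at t)" for y
      using iffD1[OF DERIV_shift[of G "\<rho> (t - y)" t "- y"]] G by simp
    then show ?thesis unfolding \<eta>_def by (intro DERIV_diff)
  qed
  have zero: "\<eta> t = 0" if "t \<notin> {a - \<epsilon>..b + \<epsilon>}" for t
    using that ab Gleft[of "t - a"] Gleft[of "t - b"] Gright[of "t - a"] Gright[of "t - b"]
    by (auto simp: \<eta>_def not_le)
  have "time_test T \<eta>"
    unfolding time_test_def
    using smooth_real_antiderivative[OF smooth_diff[OF sm sm] D] zero \<epsilon>
    by (intro conjI exI[of _ "a - \<epsilon>"] exI[of _ "b + \<epsilon>"]) auto
  have "integral {0..T} (\<lambda>t. deriv \<eta> t * h t) = 0" by (rule weak) fact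
  moreover have "deriv \<eta> = (\<lambda>t. \<rho> (t - a) - \<rho> (t - b))" using DERIV_imp_deriv[OF D] by blast
  ultimately have w: "integral {0..T} (\<lambda>t. (\<rho> (t - a) - \<rho> (t - b)) * h t) = 0" by simp
  have c\<rho>: "continuous_on S (\<lambda>t. \<rho> (t - y))" for y S by (rule smooth_continuous_on[OF sm])
  have i1: "((\<lambda>t. (\<rho> (t - a) - \<rho> (t - b)) * h t) has_integral 0) {0..T}"
  proof -
    have "(\<lambda>t. (\<rho> (t - a) - \<rho> (t - b)) * h t) integrable_on {0..T}"
      by (intro integrable_continuous_real continuous_intros c\<rho> cont)
    then show ?thesis using w by (metis integrable_integral)
  qed
  have i2: "((\<lambda>t. \<rho> (t - a) - \<rho> (t - b)) has_integral 0) {0..T}"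
  proof -
    have "((\<lambda>t. \<rho> (t - a) - \<rho> (t - b)) has_integral \<eta> T - \<eta> 0) {0..T}"
      using ab D by (intro fundamental_theorem_of_calculus)
        (auto simp: has_real_derivative_iff_has_vector_derivative[symmetric] intro: has_field_derivative_at_within)
    then show ?thesis using zero[of T] zero[of 0] \<epsilon> by simp
  qed
  let ?F = "\<lambda>t. (\<rho> (t - a) - \<rho> (t - b)) * (m - h t)"
  have "(?F has_integral 0 * m - 0) {0..T}"
    using has_integral_diff[OF has_integral_mult_left[OF i2, of m] i1] by (simp add: algebra_simps)
  moreover have pos: "?F t \<ge> 0" "\<rho> (t - b) * (m - h t) \<le> 0" if "t \<in> {0..T}" for t
  proof -
    have "\<rho> (t - a) * (m - h t) \<ge> 0"
      using d1(2)[OF that] \<rho>0[of "t - a"] \<rho>zero[of "t - a"] \<epsilon>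
      by (cases "\<bar>t - a\<bar> < \<epsilon>") (auto simp: dist_real_def intro!: mult_nonneg_nonneg)
    moreover show *: "\<rho> (t - b) * (m - h t) \<le> 0"
      using d2(2)[OF that] \<rho>0[of "t - b"] \<rho>zero[of "t - b"] \<epsilon>
      by (cases "\<bar>t - b\<bar> < \<epsilon>") (auto simp: dist_real_def intro!: mult_nonneg_nonpos)
    ultimately show "?F t \<ge> 0" by (simp add: left_diff_distrib)
  qed
  moreover have "continuous_on {0..T} ?F" by (intro continuous_intros c\<rho> cont)
  ultimately have "?F a = 0"
    using ab by (intro has_integral_0_cbox_imp_0[of 0 T ?F a]) auto
  moreover have "\<rho> (a - a) * (m - h a) > 0" using \<rho>pos[of 0] \<epsilon> m by simp
  moreover have "\<rho> (a - b) * (m - h a) \<le> 0" using pos(2)[OF \<open>a \<in> {0..T}\<close>] .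
  ultimately show False unfolding left_diff_distrib by linarith
qed

text \<open>Lemma of du Bois-Reymond: subtracting an antiderivative of \<open>g\<close> leaves a function with weak derivative
  zero. It is constant, because neither it nor its negative increases.\<close>

lemma derivative_if_weak_derivative_continuous:
  fixes c g :: "real \<Rightarrow> real"
  assumes "T > 0" and c: "continuous_on {0..T} c" and g: "continuous_on {0..T} g"
    and weak: "\<And>\<eta>. time_test T \<eta> \<Longrightarrow>
      integral {0..T} (\<lambda>t. deriv \<eta> t * c t) = - integral {0..T} (\<lambda>t. \<eta> t * g t)"
    and t: "0 < t" "t < T"
  shows "(c has_real_derivative g t) (at t)"
proof -
  define G where "G = (\<lambda>t. integral {0..t} g)"
  define h where "h = (\<lambda>t. c t - G t)"
  have DG: "(G has_real_derivative g x) (at x within {0..T})" if "x \<in> {0..T}" for x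
    unfolding G_def by (rule integral_has_real_derivative[OF g that])
  have cG: "continuous_on {0..T} G" using DG by (rule DERIV_continuous_on)
  have ch: "continuous_on {0..T} h" unfolding h_def by (intro continuous_intros c cG)
  have w: "integral {0..T} (\<lambda>t. deriv \<eta> t * h t) = 0" if "time_test T \<eta>" for \<eta>
  proof -
    have sm: "smooth \<eta>" using that by (simp add: time_test_def)
    note D = smooth_DERIV_deriv[OF sm] and cd = continuous_on_deriv_smooth[OF sm]
    have c\<eta>: "continuous_on {0..T} \<eta>" by (rule smooth_continuous_on[OF sm])
    have "((\<lambda>x. \<eta> x * g x + deriv \<eta> x * G x) has_integral \<eta> T * G T - \<eta> 0 * G 0) {0..T}"
    proof (rule fundamental_theorem_of_calculus)
      show "((\<lambda>x. \<eta> x * G x) has_vector_derivative \<eta> x * g x + deriv \<eta> x * G x) (at x within {0..T})"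
        if "x \<in> {0..T}" for x
        using DERIV_mult'[OF has_field_derivative_at_within[OF D] DG[OF that]]
        by (simp add: has_real_derivative_iff_has_vector_derivative)
    qed (use \<open>T > 0\<close> in simp)
    moreover have "\<eta> 0 = 0" "\<eta> T = 0" using that by (auto simp: time_test_def)
    ultimately have "integral {0..T} (\<lambda>x. \<eta> x * g x + deriv \<eta> x * G x) = 0"
      by (simp add: integral_unique)
    moreover have "(\<lambda>x. \<eta> x * g x) integrable_on {0..T}" "(\<lambda>x. deriv \<eta> x * G x) integrable_on {0..T}"
       "(\<lambda>x. deriv \<eta> x * c x) integrable_on {0..T}"
      by (intro integrable_continuous_real continuous_intros cd c\<eta> g cG c)+
    ultimately show ?thesis
      using weak[OF that] by (simp add: integral_add h_def right_diff_distrib integral_diff)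
  qed
  have const: "h x = h y" if "0 < x" "x < y" "y < T" for x y
  proof (rule antisym)
    show "h y \<le> h x" by (rule not_increasing_if_weak_derivative_zero[OF ch w that])
    have "- h y \<le> - h x"
      using w by (intro not_increasing_if_weak_derivative_zero[OF continuous_on_minus[OF ch] _ that]) simp
    then show "h x \<le> h y" by simp
  qed
  have "h x = h t" if "x \<in> {0<..<T}" for x
  proof (cases x t rule: linorder_cases)
    case less then show ?thesis using const[of x t] that t by simp
  next
    case greater then show ?thesis using const[of t x] that t by simp
  qed simp
  then have "c x = h t + G x" if "x \<in> {0<..<T}" for x
    using that unfolding h_def by (metis diff_add_cancel)
  then have ev: "\<forall>\<^sub>F x in nhds t. c x = h t + G x"
    using eventually_nhds_in_open[of "{0<..<T}" t] t by (auto elim!: eventually_mono)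
  moreover have "((\<lambda>x. h t + G x) has_real_derivative g t) (at t)"
    using DG[of t] t at_within_Icc_at[of 0 t T] by (auto intro!: derivative_eq_intros)
  ultimately show ?thesis using DERIV_cong_ev[OF refl ev refl, of "g t"] by simp
qed

section \<open>Surface measure\<close>

abbreviation hausdorff2 :: "vec3 measure" where
  "hausdorff2 \<equiv> measure_of UNIV (sets borel) hausdorff2_outer"

lemma sets_hausdorff2 [simp, measurable_cong]: "sets hausdorff2 = sets borel"
  and space_hausdorff2 [simp]: "space hausdorff2 = UNIV"
  using sets.sigma_sets_eq[of "borel :: vec3 measure"] by simp_all

text \<open>The operator \<^const>\<open>measure_of\<close> keeps a set function that is countably additive on the Borel sets and
  replaces any other by the null measure. Upper bounds and isometry invariance of the outer measure pass to
  the result in both cases.\<close>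

lemma emeasure_hausdorff2:
  assumes "A \<in> sets borel"
  shows "emeasure hausdorff2 A =
    (if measure_space UNIV (sets (borel :: vec3 measure)) hausdorff2_outer then hausdorff2_outer A else 0)"
  using assms sets.sigma_sets_eq[of "borel :: vec3 measure"] by (simp add: emeasure_measure_of_conv)

lemma emeasure_hausdorff2_le: "A \<in> sets borel \<Longrightarrow> emeasure hausdorff2 A \<le> hausdorff2_outer A"
  by (simp add: emeasure_hausdorff2)

text \<open>The images of the sets of a cover form a cover with no larger diameters.\<close>

lemma hausdorff2_outer_image_le:
  assumes f: "\<And>x y. dist (f x) (f y) \<le> dist x y"
  shows "hausdorff2_outer (f ` A) \<le> hausdorff2_outer A"
  unfolding hausdorff2_outer_def
proof (rule SUP_mono', rule INF_mono)
  fix \<delta> and U :: "nat \<Rightarrow> vec3 set"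
  assume U: "U \<in> {U. A \<subseteq> (\<Union>i. U i) \<and> (\<forall>i. bounded (U i) \<and> diameter (U i) \<le> \<delta>)}"
  have bdd: "bounded (f ` U i)" for i
  proof -
    obtain x e where "\<And>y. y \<in> U i \<Longrightarrow> dist x y \<le> e" using U unfolding bounded_def by blast
    then have "\<forall>z\<in>f ` U i. dist (f x) z \<le> e" using f order_trans by blast
    then show ?thesis unfolding bounded_def by blast
  qed
  have diam: "diameter (f ` U i) \<le> diameter (U i)" for i
  proof (rule diameter_le)
    show "f ` U i \<noteq> {} \<or> 0 \<le> diameter (U i)" using U by (auto intro: diameter_ge_0)
    fix x y assume "x \<in> f ` U i" "y \<in> f ` U i"
    then obtain a b where "x = f a" "y = f b" "a \<in> U i" "b \<in> U i" by blast
    then show "norm (x - y) \<le> diameter (U i)"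
      using f[of a b] diameter_bounded_bound[of "U i" a b] U by (simp add: dist_norm)
  qed
  show "\<exists>V\<in>{V. f ` A \<subseteq> (\<Union>i. V i) \<and> (\<forall>i. bounded (V i) \<and> diameter (V i) \<le> \<delta>)}.
      (\<Sum>i. ennreal (pi / 4 * (diameter (V i))\<^sup>2)) \<le> (\<Sum>i. ennreal (pi / 4 * (diameter (U i))\<^sup>2))"
  proof (intro bexI[of _ "\<lambda>i. f ` U i"] suminf_le)
    show "(\<lambda>i. f ` U i) \<in> {V. f ` A \<subseteq> (\<Union>i. V i) \<and> (\<forall>i. bounded (V i) \<and> diameter (V i) \<le> \<delta>)}"
      using U bdd diam order_trans by (simp, blast)
    show "ennreal (pi / 4 * (diameter (f ` U i))\<^sup>2) \<le> ennreal (pi / 4 * (diameter (U i))\<^sup>2)" for i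
      using diam[of i] diameter_ge_0[OF bdd, of i]
      by (intro ennreal_leI mult_left_mono power_mono) auto
  qed auto
qed

text \<open>Subdividing the square into \<open>N\<^sup>2\<close> cells of side \<open>M / N\<close> gives a cover by sets of diameter at most
  \<open>2 L M / N\<close>. The sum of their squared diameters does not depend on \<open>N\<close>.\<close>

lemma hausdorff2_outer_square_image:
  fixes F :: "real \<times> real \<Rightarrow> vec3"
  assumes M: "M \<ge> 0" and L: "L \<ge> 0"
    and F: "\<And>a b a' b'. dist (F (a, b)) (F (a', b')) \<le> L * (\<bar>a - a'\<bar> + \<bar>b - b'\<bar>)"
  shows "hausdorff2_outer (F ` ({0..M} \<times> {0..M})) \<le> ennreal (pi * (L * M)\<^sup>2)"
  unfolding hausdorff2_outer_def
proof (rule SUP_least)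
  fix \<delta> :: real assume "\<delta> \<in> {0<..}"
  then have "\<delta> > 0" by simp
  obtain N0 :: nat where "real N0 > 2 * L * M / \<delta>" using reals_Archimedean2 by blast
  then obtain N where N: "real N > 2 * L * M / \<delta>" "N > 0"
    by (metis lessI less_trans of_nat_less_iff zero_less_Suc)
  define I where "I = (\<lambda>j. {M * real j / N..M * (real j + 1) / N})"
  have I: "\<exists>j<N. a \<in> I j" if "a \<in> {0..M}" for a
  proof -
    define x where "x = (if M = 0 then 0 else a * N / M)"
    have x: "0 \<le> x" "x \<le> N" "a = M * x / N"
      using that N(2) by (auto simp: x_def field_simps)
    have "\<exists>j<N. real j \<le> x \<and> x \<le> real j + 1"
    proof (cases "x = real N")
      case True
      then show ?thesis using N(2) by (intro exI[of _ "N - 1"]) auto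
    next
      case False
      then have "nat \<lfloor>x\<rfloor> < N" using x by linarith
      then show ?thesis using x(1) by (intro exI[of _ "nat \<lfloor>x\<rfloor>"] conjI; linarith)
    qed
    then obtain j where "j < N" "real j \<le> x" "x \<le> real j + 1" by blast
    then show ?thesis
      using M x(3) by (intro exI[of _ j]) (auto simp: I_def intro!: divide_right_mono mult_left_mono)
  qed
  \<comment> \<open>The cell in column \<open>j\<close> and row \<open>k\<close> has number \<open>j * N + k\<close>; the rest of the sequence is empty.\<close>
  define U where "U = (\<lambda>i. if i < N * N then F ` (I (i div N) \<times> I (i mod N)) else {})"
  have dist: "dist x y \<le> 2 * L * M / N" if "x \<in> U i" "y \<in> U i" for x y i
  proof -
    have *: "\<bar>u - v\<bar> \<le> M / N" if "u \<in> I j" "v \<in> I j" for u v j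
      using that by (auto simp: I_def abs_le_iff add_divide_distrib distrib_left)
    from that obtain a b a' b' where "x = F (a, b)" "y = F (a', b')" "a \<in> I (i div N)" "a' \<in> I (i div N)"
        "b \<in> I (i mod N)" "b' \<in> I (i mod N)"
      unfolding U_def by (auto split: if_splits)
    then have "dist x y \<le> L * (M / N + M / N)"
      using F[of a b a' b'] mult_left_mono[OF add_mono[OF * *] L, of a "i div N" a' b "i mod N" b'] by auto
    then show ?thesis by (simp add: field_simps)
  qed
  have nn: "2 * L * M / N \<ge> 0" using M L by simp
  have bdd: "bounded (U i)" for i
    using dist unfolding bounded_any_center[where a = "SOME x. x \<in> U i"] by (meson someI_ex)
  have diam: "diameter (U i) \<le> 2 * L * M / N" for i
    using nn dist by (intro diameter_le) (auto simp: dist_norm)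
  have "2 * L * M / N \<le> \<delta>"
    using N \<open>\<delta> > 0\<close> by (simp add: field_simps)
  moreover have "F ` ({0..M} \<times> {0..M}) \<subseteq> (\<Union>i. U i)"
  proof clarify
    fix a b assume "a \<in> {0..M}" "b \<in> {0..M}"
    then obtain j k where jk: "j < N" "a \<in> I j" "k < N" "b \<in> I k" using I by blast
    have "j * N + k < Suc j * N" using jk by simp
    also have "\<dots> \<le> N * N" using jk by (intro mult_le_mono1) simp
    finally have "j * N + k < N * N" .
    with jk have "F (a, b) \<in> U (j * N + k)" by (auto simp: U_def)
    then show "F (a, b) \<in> (\<Union>i. U i)" by blast
  qed
  ultimately have mem: "U \<in> {U. F ` ({0..M} \<times> {0..M}) \<subseteq> (\<Union>i. U i) \<and> (\<forall>i. bounded (U i) \<and> diameter (U i) \<le> \<delta>)}"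
    using bdd diam order_trans by (simp, blast)
  have "(\<Sum>i. ennreal (pi / 4 * (diameter (U i))\<^sup>2)) = (\<Sum>i<N * N. ennreal (pi / 4 * (diameter (U i))\<^sup>2))"
    by (rule suminf_finite) (auto simp: U_def)
  also have "\<dots> \<le> (\<Sum>i<N * N. ennreal (pi / 4 * (2 * L * M / N)\<^sup>2))"
    using diam diameter_ge_0[OF bdd]
    by (intro sum_mono ennreal_leI mult_left_mono power_mono) auto
  also have "\<dots> = ennreal (pi * (L * M)\<^sup>2)"
  proof -
    have "(\<Sum>i<N * N. ennreal (pi / 4 * (2 * L * M / N)\<^sup>2)) = ennreal (\<Sum>i<N * N. pi / 4 * (2 * L * M / N)\<^sup>2)"
      by (rule sum_ennreal) simp
    also have "(\<Sum>i<N * N. pi / 4 * (2 * L * M / N)\<^sup>2) = pi * (L * M)\<^sup>2"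
      using N(2) by (simp add: field_simps power2_eq_square)
    finally show ?thesis .
  qed
  finally show "(INF U\<in>{U. F ` ({0..M} \<times> {0..M}) \<subseteq> (\<Union>i. U i) \<and> (\<forall>i. bounded (U i) \<and> diameter (U i) \<le> \<delta>)}.
          \<Sum>i. ennreal (pi / 4 * (diameter (U i))\<^sup>2)) \<le> ennreal (pi * (L * M)\<^sup>2)"
    by (rule INF_lower2[OF mem])
qed

lemma hausdorff2_square_image:
  fixes F :: "real \<times> real \<Rightarrow> vec3"
  assumes M: "M \<ge> 0" and L: "L \<ge> 0"
    and F: "\<And>a b a' b'. dist (F (a, b)) (F (a', b')) \<le> L * (\<bar>a - a'\<bar> + \<bar>b - b'\<bar>)"
  shows "F ` ({0..M} \<times> {0..M}) \<in> sets borel" "emeasure hausdorff2 (F ` ({0..M} \<times> {0..M})) < \<infinity>"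
proof -
  have "(2 * L)-lipschitz_on UNIV F"
  proof (rule lipschitz_onI)
    fix x y :: "real \<times> real"
    have "\<bar>fst x - fst y\<bar> \<le> dist x y" "\<bar>snd x - snd y\<bar> \<le> dist x y"
      using dist_fst_le[of x y] dist_snd_le[of x y] by (simp_all add: dist_real_def)
    then have "L * (\<bar>fst x - fst y\<bar> + \<bar>snd x - snd y\<bar>) \<le> L * (2 * dist x y)"
      using L by (intro mult_left_mono) auto
    then show "dist (F x) (F y) \<le> 2 * L * dist x y"
      using F[of "fst x" "snd x" "fst y" "snd y"] by simp
  qed (use L in simp)
  then have "continuous_on UNIV F" by (rule lipschitz_on_continuous_on)
  then have "compact (F ` ({0..M} \<times> {0..M}))"
    by (intro compact_continuous_image compact_Times) (auto intro: continuous_on_subset)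
  then show *: "F ` ({0..M} \<times> {0..M}) \<in> sets borel" by (rule borel_compact)
  show "emeasure hausdorff2 (F ` ({0..M} \<times> {0..M})) < \<infinity>"
    using le_less_trans[OF order_trans[OF emeasure_hausdorff2_le[OF *] hausdorff2_outer_square_image[OF M L F]]]
    by (simp add: less_top)
qed

lemma norm3_le: "norm (x :: vec3) \<le> \<bar>x $ 1\<bar> + \<bar>x $ 2\<bar> + \<bar>x $ 3\<bar>"
  using norm_le_l1_cart[of x] by (simp add: sum_3)

lemma abs_sin_diff_le: "\<bar>sin x - sin y\<bar> \<le> \<bar>x - y\<bar>" for x y :: real
proof -
  have "\<bar>sin x - sin y\<bar> = 2 * \<bar>sin ((x - y) / 2)\<bar> * \<bar>cos ((x + y) / 2)\<bar>"
    by (simp add: sin_diff_sin abs_mult)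
  also have "\<dots> \<le> 2 * \<bar>(x - y) / 2\<bar> * 1"
    by (intro mult_mono abs_sin_x_le_abs_x) auto
  finally show ?thesis by simp
qed

lemma abs_cos_diff_le: "\<bar>cos x - cos y\<bar> \<le> \<bar>x - y\<bar>" for x y :: real
  using abs_sin_diff_le[of "pi / 2 - x" "pi / 2 - y"] by (simp add: sin_diff)

lemma abs_mult_diff_le:
  fixes a b a' b' :: real
  assumes "\<bar>a\<bar> \<le> 1" "\<bar>b'\<bar> \<le> 1"
  shows "\<bar>a * b - a' * b'\<bar> \<le> \<bar>a - a'\<bar> + \<bar>b - b'\<bar>"
proof -
  have "a * b - a' * b' = a * (b - b') + (a - a') * b'" by (simp add: algebra_simps)
  then have "\<bar>a * b - a' * b'\<bar> \<le> \<bar>a\<bar> * \<bar>b - b'\<bar> + \<bar>a - a'\<bar> * \<bar>b'\<bar>"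
    by (metis abs_mult abs_triangle_ineq)
  also have "\<dots> \<le> 1 * \<bar>b - b'\<bar> + \<bar>a - a'\<bar> * 1" using assms by (intro add_mono mult_mono) auto
  finally show ?thesis by simp
qed

text \<open>Spherical coordinates are a Lipschitz parametrisation of the sphere over a square; the polar angle
  only needs the lower half of its range.\<close>

lemma hausdorff2_sphere_finite: "emeasure hausdorff2 (sphere 0 1) < \<infinity>"
proof -
  define F :: "real \<times> real \<Rightarrow> vec3" where
    "F = (\<lambda>(\<phi>, \<theta>). vector [sin \<phi> * cos \<theta>, sin \<phi> * sin \<theta>, cos \<phi>])"
  have F: "dist (F (a, b)) (F (a', b')) \<le> 3 * (\<bar>a - a'\<bar> + \<bar>b - b'\<bar>)" for a b a' b'
  proof -
    have "\<bar>sin a * cos b - sin a' * cos b'\<bar> \<le> \<bar>a - a'\<bar> + \<bar>b - b'\<bar>"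
      "\<bar>sin a * sin b - sin a' * sin b'\<bar> \<le> \<bar>a - a'\<bar> + \<bar>b - b'\<bar>"
      "\<bar>cos a - cos a'\<bar> \<le> \<bar>a - a'\<bar>"
      using abs_mult_diff_le[of "sin a" "cos b'" "cos b" "sin a'"] abs_mult_diff_le[of "sin a" "sin b'" "sin b" "sin a'"]
        abs_sin_diff_le[of a a'] abs_cos_diff_le[of a a'] abs_sin_diff_le[of b b'] abs_cos_diff_le[of b b']
      by (simp_all)
    moreover have "dist (F (a, b)) (F (a', b')) \<le> \<bar>sin a * cos b - sin a' * cos b'\<bar> +
        \<bar>sin a * sin b - sin a' * sin b'\<bar> + \<bar>cos a - cos a'\<bar>"
      using norm3_le[of "F (a, b) - F (a', b')"] by (simp add: dist_norm F_def)
    ultimately show ?thesis using abs_ge_zero[of "b - b'"] by argo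
  qed
  note patch = hausdorff2_square_image[where M = "2 * pi" and L = 3 and F = F, OF _ _ F, simplified]
  have "sphere 0 1 \<subseteq> F ` ({0..2 * pi} \<times> {0..2 * pi})"
  proof
    fix x :: vec3 assume "x \<in> sphere 0 1"
    then have "norm x = 1" by simp
    then have n: "(x $ 1)\<^sup>2 + (x $ 2)\<^sup>2 + (x $ 3)\<^sup>2 = 1"
      by (simp add: norm_vec_def L2_set_def sum_3 real_sqrt_eq_1_iff)
    then have "(x $ 3)\<^sup>2 \<le> 1" using zero_le_power2[of "x $ 1"] zero_le_power2[of "x $ 2"] by linarith
    then have x3: "\<bar>x $ 3\<bar> \<le> 1" by (simp add: abs_square_le_1)
    define \<phi> where "\<phi> = arccos (x $ 3)"
    have \<phi>: "0 \<le> \<phi>" "\<phi> \<le> pi" "cos \<phi> = x $ 3"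
      using x3 by (auto simp: \<phi>_def arccos_lbound arccos_ubound abs_le_iff intro!: cos_arccos)
    then have s: "(sin \<phi>)\<^sup>2 = (x $ 1)\<^sup>2 + (x $ 2)\<^sup>2" using n sin_cos_squared_add[of \<phi>] by simp
    obtain \<theta> where \<theta>: "0 \<le> \<theta>" "\<theta> \<le> 2 * pi" "x $ 1 = sin \<phi> * cos \<theta>" "x $ 2 = sin \<phi> * sin \<theta>"
    proof (cases "sin \<phi> = 0")
      case True
      then have "x $ 1 = 0" "x $ 2 = 0" using s by (simp_all add: sum_power2_eq_zero_iff)
      then show ?thesis using that[of 0] True by simp
    next
      case False
      then have "(x $ 1 / sin \<phi>)\<^sup>2 + (x $ 2 / sin \<phi>)\<^sup>2 = 1"
        by (simp only: power_divide add_divide_distrib[symmetric] s[symmetric]) simp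
      then obtain t where "0 \<le> t" "t < 2 * pi" "x $ 1 / sin \<phi> = cos t" "x $ 2 / sin \<phi> = sin t"
        by (rule sincos_total_2pi)
      then show ?thesis using that[of t] False by (simp add: field_simps)
    qed
    have "x = F (\<phi>, \<theta>)" using \<phi> \<theta> by (simp add: F_def vec_eq_iff forall_3)
    then show "x \<in> F ` ({0..2 * pi} \<times> {0..2 * pi})" using \<phi> \<theta> pi_ge_zero by force
  qed
  moreover have "F ` ({0..2 * pi} \<times> {0..2 * pi}) \<in> sets hausdorff2" using patch(1) by simp
  ultimately show ?thesis using le_less_trans[OF emeasure_mono patch(2)] by simp
qed

text \<open>Points above the graph are in the open set \<open>R\<close>, and those below have a neighbourhood outside of it.\<close>

lemma frontier_subset_lipschitz_graph:
  assumes "open R" and R: "\<forall>x\<in>ball p \<rho>. x \<in> R \<longleftrightarrow> \<gamma> (x - (x \<bullet> e) *\<^sub>R e) < x \<bullet> e"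
    and \<gamma>: "L-lipschitz_on UNIV \<gamma>" and x: "x \<in> frontier R" "x \<in> ball p \<rho>"
  shows "\<gamma> (x - (x \<bullet> e) *\<^sub>R e) = x \<bullet> e"
proof (rule ccontr)
  assume ne: "\<gamma> (x - (x \<bullet> e) *\<^sub>R e) \<noteq> x \<bullet> e"
  have "x \<notin> R" using x(1) \<open>open R\<close> by (simp add: frontier_def interior_open)
  with ne R x(2) have lt: "x \<bullet> e < \<gamma> (x - (x \<bullet> e) *\<^sub>R e)" by force
  have c: "continuous_on UNIV (\<lambda>x. \<gamma> (x - (x \<bullet> e) *\<^sub>R e))"
    by (rule continuous_on_compose2[OF lipschitz_on_continuous_on[OF \<gamma>]]) (auto intro!: continuous_intros)
  have "open ({x. x \<bullet> e < \<gamma> (x - (x \<bullet> e) *\<^sub>R e)} \<inter> ball p \<rho>)"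
    by (intro open_Int open_Collect_less c continuous_intros open_ball)
  moreover have "x \<in> closure R" using x(1) by (simp add: frontier_def)
  ultimately obtain y where "y \<in> R" "y \<bullet> e < \<gamma> (y - (y \<bullet> e) *\<^sub>R e)" "y \<in> ball p \<rho>"
    using lt x(2) open_Int_closure_eq_empty[of _ R] by blast
  with R show False by force
qed

text \<open>An orthogonal map takes the third coordinate axis to \<open>e\<close>, so that two coordinates parametrise the plane
  orthogonal to \<open>e\<close>. They are shifted by \<open>r\<close> because the parameter square has a corner at the origin.\<close>

lemma lipschitz_graph_square_image:
  fixes e :: vec3
  assumes e: "norm e = 1" and \<gamma>: "L-lipschitz_on UNIV \<gamma>"
  obtains F :: "real \<times> real \<Rightarrow> vec3" and M where "M \<ge> 0"
    "\<And>a b a' b'. dist (F (a, b)) (F (a', b')) \<le> (1 + L) * (\<bar>a - a'\<bar> + \<bar>b - b'\<bar>)"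
    "\<And>x. norm x \<le> r \<Longrightarrow> \<gamma> (x - (x \<bullet> e) *\<^sub>R e) = x \<bullet> e \<Longrightarrow> x \<in> F ` ({0..M} \<times> {0..M})"
proof -
  have "norm (axis 3 1 :: vec3) = 1" by (simp add: norm_axis_1)
  then obtain f :: "vec3 \<Rightarrow> vec3" where f: "orthogonal_transformation f" "f (axis 3 1) = e"
    using orthogonal_transformation_exists_1 e by blast
  define y :: "real \<times> real \<Rightarrow> vec3" where "y = (\<lambda>(a, b). f (vector [a - \<bar>r\<bar>, b - \<bar>r\<bar>, 0]))"
  define F where "F = (\<lambda>u. y u + \<gamma> (y u) *\<^sub>R e)"
  have L: "L \<ge> 0" using \<gamma> by (rule lipschitz_on_nonneg)
  have y: "norm (y (a, b) - y (a', b')) \<le> \<bar>a - a'\<bar> + \<bar>b - b'\<bar>" for a b a' b'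
  proof -
    have "vector [a - \<bar>r\<bar>, b - \<bar>r\<bar>, 0] - vector [a' - \<bar>r\<bar>, b' - \<bar>r\<bar>, 0] = (vector [a - a', b - b', 0] :: vec3)"
      by (simp add: vec_eq_iff forall_3)
    then have "y (a, b) - y (a', b') = f (vector [a - a', b - b', 0])"
      by (simp add: y_def linear_diff[OF orthogonal_transformation_linear[OF f(1)], symmetric])
    then show ?thesis
      using orthogonal_transformation_norm[OF f(1)] norm3_le[of "vector [a - a', b - b', 0]"] by simp
  qed
  show ?thesis
  proof (rule that[of "2 * \<bar>r\<bar>" F])
    fix a b a' b'
    have "norm (F (a, b) - F (a', b')) = norm ((y (a, b) - y (a', b')) + (\<gamma> (y (a, b)) - \<gamma> (y (a', b'))) *\<^sub>R e)"
      by (simp add: F_def algebra_simps)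
    also have "\<dots> \<le> norm (y (a, b) - y (a', b')) + \<bar>\<gamma> (y (a, b)) - \<gamma> (y (a', b'))\<bar>"
      using norm_triangle_ineq e by (metis mult.right_neutral norm_scaleR)
    also have "\<dots> \<le> norm (y (a, b) - y (a', b')) + L * norm (y (a, b) - y (a', b'))"
      using lipschitz_onD[OF \<gamma>, of "y (a, b)" "y (a', b')"] by (simp add: dist_real_def dist_norm)
    also have "\<dots> = (1 + L) * norm (y (a, b) - y (a', b'))" by (simp add: algebra_simps)
    also have "\<dots> \<le> (1 + L) * (\<bar>a - a'\<bar> + \<bar>b - b'\<bar>)" using y L by (intro mult_left_mono) auto
    finally show "dist (F (a, b)) (F (a', b')) \<le> (1 + L) * (\<bar>a - a'\<bar> + \<bar>b - b'\<bar>)"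
      by (simp add: dist_norm)
  next
    fix x assume r: "norm x \<le> r" and x: "\<gamma> (x - (x \<bullet> e) *\<^sub>R e) = x \<bullet> e"
    have "surj f" by (rule orthogonal_transformation_surj[OF f(1)])
    then obtain z where z: "f z = x" by (metis surjD)
    have z3: "z $ 3 = x \<bullet> e"
      using f z by (metis cart_eq_inner_axis orthogonal_transformation_def)
    have zr: "\<bar>z $ i\<bar> \<le> r" for i
      using component_le_norm_cart[of z i] orthogonal_transformation_norm[OF f(1), of z] z r by simp
    have "r \<ge> 0" using r norm_ge_zero order_trans by blast
    have "vector [z $ 1, z $ 2, 0] = z - (x \<bullet> e) *\<^sub>R axis 3 1"
      by (simp add: vec_eq_iff forall_3 axis_def z3[symmetric])
    then have "f (vector [z $ 1, z $ 2, 0]) = x - (x \<bullet> e) *\<^sub>R e"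
      using orthogonal_transformation_linear[OF f(1)] f(2) z by (simp add: linear_diff linear_scale)
    then have "x = F (z $ 1 + r, z $ 2 + r)"
      using x \<open>r \<ge> 0\<close> by (simp add: F_def y_def)
    then show "x \<in> F ` ({0..2 * \<bar>r\<bar>} \<times> {0..2 * \<bar>r\<bar>})"
      using zr[of 1] zr[of 2] \<open>r \<ge> 0\<close> by (intro image_eqI) (auto simp: abs_le_iff)
  qed simp
qed

text \<open>By compactness, finitely many Lipschitz graphs cover the boundary.\<close>

lemma hausdorff2_frontier_finite:
  assumes "bounded R" "lipschitz_domain R"
  shows "emeasure hausdorff2 (frontier R) < \<infinity>"
proof -
  have "open R" using assms(2) by (simp add: lipschitz_domain_def)
  have "\<exists>\<rho>>0. \<exists>P\<in>sets borel. frontier R \<inter> ball p \<rho> \<subseteq> P \<and> emeasure hausdorff2 P < \<infinity>" if pR: "p \<in> frontier R" for p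
  proof -
    obtain e \<gamma> L \<rho> where e: "norm e = 1" and \<gamma>: "L-lipschitz_on UNIV \<gamma>" and \<rho>: "\<rho> > 0"
      and R: "\<forall>x\<in>ball p \<rho>. x \<in> R \<longleftrightarrow> \<gamma> (x - (x \<bullet> e) *\<^sub>R e) < x \<bullet> e"
      using assms(2)[unfolded lipschitz_domain_def, THEN conjunct2, THEN conjunct2, THEN conjunct2, THEN bspec, OF pR]
      by (elim exE conjE)
    obtain F M where M: "M \<ge> 0"
      and F: "\<And>a b a' b'. dist (F (a, b)) (F (a', b')) \<le> (1 + L) * (\<bar>a - a'\<bar> + \<bar>b - b'\<bar>)"
      and cover: "\<And>x. norm x \<le> norm p + \<rho> \<Longrightarrow> \<gamma> (x - (x \<bullet> e) *\<^sub>R e) = x \<bullet> e \<Longrightarrow> x \<in> F ` ({0..M} \<times> {0..M})"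
      by (rule lipschitz_graph_square_image[OF e \<gamma>, of "norm p + \<rho>"]) blast
    have "1 + L \<ge> 0" using lipschitz_on_nonneg[OF \<gamma>] by simp
    note patch = hausdorff2_square_image[OF M this F]
    have "frontier R \<inter> ball p \<rho> \<subseteq> F ` ({0..M} \<times> {0..M})"
    proof
      fix x assume x: "x \<in> frontier R \<inter> ball p \<rho>"
      then have "norm x \<le> norm p + \<rho>"
        using norm_triangle_ineq2[of x p] by (simp add: dist_norm norm_minus_commute)
      then show "x \<in> F ` ({0..M} \<times> {0..M})"
        using cover frontier_subset_lipschitz_graph[OF \<open>open R\<close> R \<gamma>] x by blast
    qed
    then show ?thesis using patch \<rho> by blast
  qed
  then obtain \<rho> P where \<rho>: "\<And>p. p \<in> frontier R \<Longrightarrow> \<rho> p > 0"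
    and P: "\<And>p. p \<in> frontier R \<Longrightarrow> P p \<in> sets borel \<and> frontier R \<inter> ball p (\<rho> p) \<subseteq> P p \<and> emeasure hausdorff2 (P p) < \<infinity>"
    by metis
  have "compact (frontier R)" using assms(1) by (rule compact_frontier_bounded)
  then obtain D where D: "D \<subseteq> frontier R" "finite D" "frontier R \<subseteq> (\<Union>p\<in>D. ball p (\<rho> p))"
    by (rule compactE_image[where C = "frontier R" and f = "\<lambda>p. ball p (\<rho> p)"]) (use \<rho> in auto)
  then have "frontier R \<subseteq> (\<Union>p\<in>D. P p)" using P by blast
  then have "emeasure hausdorff2 (frontier R) \<le> emeasure hausdorff2 (\<Union>p\<in>D. P p)"
    using D P by (intro emeasure_mono) (auto intro!: sets.finite_UN)
  also have "\<dots> \<le> (\<Sum>p\<in>D. emeasure hausdorff2 (P p))"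
    using D P by (intro emeasure_subadditive_finite) auto
  also have "\<dots> < \<infinity>" using D P by (auto simp: ennreal_sum_less_top)
  finally show ?thesis .
qed

lemma finite_surface_measure:
  assumes "S \<in> sets borel" "emeasure hausdorff2 S < \<infinity>"
  shows "finite_measure (surface_measure S)"
proof (rule finite_measureI)
  show "emeasure (surface_measure S) (space (surface_measure S)) \<noteq> \<infinity>"
    using assms by (simp add: surface_measure_def space_restrict_space emeasure_restrict_space)
qed

lemma sets_surface_measure [measurable_cong]: "sets (surface_measure S) = sets (restrict_space borel S)"
  unfolding surface_measure_def by (rule sets_restrict_space_cong) simp

lemma space_surface_measure [simp]: "space (surface_measure S) = S"
  by (simp add: surface_measure_def space_restrict_space)

lemma emeasure_hausdorff2_orthogonal:
  assumes f: "orthogonal_transformation f" and A: "A \<in> sets borel"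
  shows "emeasure hausdorff2 (f -` A) = emeasure hausdorff2 A"
proof -
  have iso: "dist (f x) (f y) = dist x y" for x y
    using f by (simp add: orthogonal_transformation_isometry)
  have bij: "bij f" by (rule orthogonal_transformation_bij[OF f])
  have g: "orthogonal_transformation (inv f)" by (rule orthogonal_transformation_inv[OF f])
  have isog: "dist (inv f x) (inv f y) = dist x y" for x y
    using g by (simp add: orthogonal_transformation_isometry)
  have "continuous_on UNIV f" by (rule linear_continuous_on[OF linear_linear[THEN iffD2, OF orthogonal_transformation_linear[OF f]]])
  then have "f \<in> borel_measurable borel" by (rule borel_measurable_continuous_onI)
  then have fA: "f -` A \<in> sets borel" using A by (metis inf_top.right_neutral measurable_sets space_borel)
  have "hausdorff2_outer (f -` A) \<le> hausdorff2_outer A"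
    using hausdorff2_outer_image_le[of "inv f" A] isog by (simp add: bij_vimage_eq_inv_image[OF bij])
  moreover have "hausdorff2_outer A \<le> hausdorff2_outer (f -` A)"
    using hausdorff2_outer_image_le[of f "f -` A"] iso bij by (simp add: surj_image_vimage_eq bij_is_surj)
  ultimately show ?thesis using A fA by (simp add: emeasure_hausdorff2)
qed

lemma measurable_sphere_orthogonal:
  assumes f: "orthogonal_transformation f"
  shows "f \<in> measurable sphere_measure sphere_measure"
proof -
  have "continuous_on UNIV f" by (rule linear_continuous_on[OF linear_linear[THEN iffD2, OF orthogonal_transformation_linear[OF f]]])
  then have "f \<in> borel_measurable borel" by (rule borel_measurable_continuous_onI)
  then show ?thesis
    using orthogonal_transformation_norm[OF f]
    unfolding measurable_cong_sets[OF sets_surface_measure sets_surface_measure]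
    by (intro measurable_restrict_space2 measurable_restrict_space1) (auto simp: space_restrict_space)
qed

lemma distr_sphere_orthogonal:
  assumes f: "orthogonal_transformation f"
  shows "distr sphere_measure sphere_measure f = sphere_measure"
proof (rule measure_eqI)
  fix A assume "A \<in> sets (distr sphere_measure sphere_measure f)"
  then have A: "A \<in> sets sphere_measure" by simp
  have ball: "(sphere 0 1 :: vec3 set) \<in> sets borel" by (rule borel_closed) simp
  have A': "A \<in> sets borel" "A \<subseteq> sphere 0 1"
    using A ball by (auto simp: sets_surface_measure sets_restrict_space_iff)
  have sub: "f -` A \<subseteq> sphere 0 1" using A'(2) orthogonal_transformation_norm[OF f] by fastforce
  have "emeasure (distr sphere_measure sphere_measure f) A = emeasure sphere_measure (f -` A \<inter> sphere 0 1)"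
    using A measurable_sphere_orthogonal[OF f] by (simp add: emeasure_distr)
  also have "\<dots> = emeasure hausdorff2 (f -` A)"
    using sub ball by (simp add: surface_measure_def emeasure_restrict_space Int_absorb2)
  also have "\<dots> = emeasure hausdorff2 A" by (rule emeasure_hausdorff2_orthogonal[OF f A'(1)])
  also have "\<dots> = emeasure sphere_measure A"
    using A'(2) ball by (simp add: surface_measure_def emeasure_restrict_space)
  finally show "emeasure (distr sphere_measure sphere_measure f) A = emeasure sphere_measure A" .
qed simp

section \<open>Measurability of the unit normal\<close>

text \<open>The definition of the outward normal with fixed tolerances \<open>1 / (n + 1)\<close> for the slope and \<open>1 / (m + 1)\<close>
  for the radius. For fixed tolerances the condition on \<open>(p, \<nu>)\<close> is closed, which makes the normal
  accessible to Borel sets.\<close>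

definition normal_up_to :: "vec3 set \<Rightarrow> nat \<Rightarrow> nat \<Rightarrow> (vec3 \<times> vec3) set" where
  "normal_up_to R n m = {(p, \<nu>). norm \<nu> = 1 \<and> (\<forall>y. dist p y < 1 / real (Suc m) \<longrightarrow>
     (y \<notin> R \<longrightarrow> (y - p) \<bullet> \<nu> \<ge> - (1 / real (Suc n)) * norm (y - p)) \<and>
     (y \<in> R \<longrightarrow> (y - p) \<bullet> \<nu> \<le> 1 / real (Suc n) * norm (y - p)))}"

lemma closed_normal_up_to: "closed (normal_up_to R n m)"
proof -
  have "normal_up_to R n m = {q. norm (snd q) = 1} \<inter>
    (\<Inter>y\<in>- R. {q. dist (fst q) y \<ge> 1 / real (Suc m)} \<union> {q. (y - fst q) \<bullet> snd q \<ge> - (1 / real (Suc n)) * norm (y - fst q)}) \<inter>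
    (\<Inter>y\<in>R. {q. dist (fst q) y \<ge> 1 / real (Suc m)} \<union> {q. (y - fst q) \<bullet> snd q \<le> 1 / real (Suc n) * norm (y - fst q)})"
    unfolding normal_up_to_def by (auto simp: not_le[symmetric])
  also have "closed \<dots>"
    by (intro closed_Int closed_INT closed_Un ballI closed_Collect_eq closed_Collect_le continuous_intros)
  finally show ?thesis .
qed

lemma normal_up_to_imp:
  assumes "(p, \<nu>) \<in> normal_up_to R n m" "dist p y < 1 / real (Suc m)"
  shows "y \<notin> R \<Longrightarrow> (y - p) \<bullet> \<nu> \<ge> - (1 / real (Suc n)) * norm (y - p)"
    and "y \<in> R \<Longrightarrow> (y - p) \<bullet> \<nu> \<le> 1 / real (Suc n) * norm (y - p)"
  using assms unfolding normal_up_to_def by blast+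

text \<open>Move from \<open>p\<close> a little in the direction \<open>d = \<nu>' - \<nu>\<close>. Seen from \<open>\<nu>\<close> the new point is inside \<open>R\<close>, seen from
  \<open>\<nu>'\<close> it is outside, unless \<open>d\<close> is within the tolerance.\<close>

lemma normal_up_to_close:
  assumes 1: "(p, \<nu>) \<in> normal_up_to R n m" and 2: "(p, \<nu>') \<in> normal_up_to R n' m'" and "n \<le> n'"
  shows "norm (\<nu> - \<nu>') \<le> 2 / real (Suc n)"
proof (cases "\<nu> = \<nu>'")
  case False
  define d where "d = \<nu>' - \<nu>"
  have d: "norm d > 0" using False by (simp add: d_def)
  have "norm \<nu> = 1" "norm \<nu>' = 1" using 1 2 by (auto simp: normal_up_to_def)
  then have "\<nu> \<bullet> \<nu> = 1" "\<nu>' \<bullet> \<nu>' = 1" by (simp_all add: norm_eq_1)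
  then have d1: "d \<bullet> \<nu> = - (norm d)\<^sup>2 / 2" and d2: "d \<bullet> \<nu>' = (norm d)\<^sup>2 / 2"
    by (simp_all add: d_def power2_norm_eq_inner inner_diff inner_commute field_simps)
  \<comment> \<open>Half of the smaller radius, measured along \<open>d\<close>.\<close>
  define \<tau> where "\<tau> = min (1 / real (Suc m)) (1 / real (Suc m')) / (2 * norm d)"
  have \<tau>: "\<tau> > 0" using d by (simp add: \<tau>_def)
  have "\<tau> * norm d = min (1 / real (Suc m)) (1 / real (Suc m')) / 2" using d by (simp add: \<tau>_def)
  moreover have half: "min a b / 2 < a \<and> min a b / 2 < b" if "a > 0" "b > 0" for a b :: real
    using that by (auto simp: min_def)
  have "min (1 / real (Suc m)) (1 / real (Suc m')) / 2 < 1 / real (Suc m)"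
    "min (1 / real (Suc m)) (1 / real (Suc m')) / 2 < 1 / real (Suc m')"
    using half[of "1 / real (Suc m)" "1 / real (Suc m')"] by simp_all
  ultimately have \<tau>d: "\<tau> * norm d < 1 / real (Suc m)" "\<tau> * norm d < 1 / real (Suc m')" by metis+
  define y where "y = p + \<tau> *\<^sub>R d"
  have y: "y - p = \<tau> *\<^sub>R d" "norm (y - p) = \<tau> * norm d" "dist p y = \<tau> * norm d"
    using \<tau> by (simp_all add: y_def dist_norm)
  have le: "1 / real (Suc n') \<le> 1 / real (Suc n)" using \<open>n \<le> n'\<close> by (simp add: frac_le)
  have "\<tau> * ((norm d)\<^sup>2 / 2) \<le> 1 / real (Suc n) * (\<tau> * norm d)"
  proof (cases "y \<in> R")
    case False
    from normal_up_to_imp(1)[OF 1 _ this] show ?thesis using \<tau>d y d1 \<tau> by simp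
  next
    case True
    from normal_up_to_imp(2)[OF 2 _ this] have "\<tau> * ((norm d)\<^sup>2 / 2) \<le> 1 / real (Suc n') * (\<tau> * norm d)"
      using \<tau>d y d2 \<tau> by simp
    also have "\<dots> \<le> 1 / real (Suc n) * (\<tau> * norm d)" using \<tau> d le by (intro mult_right_mono) auto
    finally show ?thesis .
  qed
  then have "(\<tau> * norm d) * (norm d / 2) \<le> (\<tau> * norm d) * (1 / real (Suc n))"
    by (simp add: power2_eq_square algebra_simps)
  then have "norm d / 2 \<le> 1 / real (Suc n)" using \<tau> d by (metis mult_le_cancel_left_pos mult_pos_pos)
  then show ?thesis by (simp add: d_def norm_minus_commute)
qed simp

lemma normal_up_to_if_outward_normal:
  assumes "is_outward_normal R p \<nu>"
  shows "\<exists>m. (p, \<nu>) \<in> normal_up_to R n m"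
proof -
  have "1 / real (Suc n) > 0" by simp
  then obtain \<delta> where \<delta>: "\<delta> > 0" and *: "\<And>y. y \<in> ball p \<delta> \<Longrightarrow>
        ((y - p) \<bullet> \<nu> < - (1 / real (Suc n)) * norm (y - p) \<longrightarrow> y \<in> R) \<and>
        ((y - p) \<bullet> \<nu> > 1 / real (Suc n) * norm (y - p) \<longrightarrow> y \<notin> R)"
    using assms[unfolded is_outward_normal_def, THEN conjunct2, THEN spec, THEN mp, OF \<open>1 / real (Suc n) > 0\<close>]
    by (elim exE conjE) (drule bspec; assumption | blast)
  obtain m where "1 / real (Suc m) < \<delta>" using nat_approx_posE[OF \<delta>] by blast
  then have "dist p y < 1 / real (Suc m) \<Longrightarrow> y \<in> ball p \<delta>" for y by simp
  moreover have "norm \<nu> = 1" using assms by (simp add: is_outward_normal_def)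
  ultimately have "(p, \<nu>) \<in> normal_up_to R n m"
    using * unfolding normal_up_to_def by (auto simp: not_le[symmetric])
  then show ?thesis ..
qed

lemma is_outward_normal_unique:
  assumes "is_outward_normal R p \<nu>" "is_outward_normal R p \<nu>'" shows "\<nu> = \<nu>'"
proof -
  have le: "norm (\<nu> - \<nu>') \<le> 2 / real (Suc n)" for n
    using normal_up_to_if_outward_normal[OF assms(1), of n] normal_up_to_if_outward_normal[OF assms(2), of n]
      normal_up_to_close[of p \<nu> R n _ \<nu>' n] by blast
  have "(\<lambda>n. 2 * inverse (real (Suc n))) \<longlonglongrightarrow> 2 * 0"
    by (intro tendsto_mult LIMSEQ_inverse_real_of_nat tendsto_const)
  then have "norm (\<nu> - \<nu>') \<le> 2 * 0"
    by (rule tendsto_lowerbound[OF _ always_eventually]) (use le in \<open>auto simp: divide_inverse\<close>)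
  then show ?thesis by simp
qed

text \<open>Approximate normals for smaller and smaller tolerances form a Cauchy sequence, and its limit is a
  normal. Thus an existential quantifier over \<open>\<nu>\<close> can be exchanged with the quantifier over the tolerance.\<close>

lemma outward_normal_if_normal_up_to:
  assumes C: "closed C" and ex: "\<And>n. \<exists>m \<nu>. \<nu> \<in> C \<and> (p, \<nu>) \<in> normal_up_to R n m"
  shows "\<exists>\<nu>\<in>C. is_outward_normal R p \<nu>"
proof -
  obtain m \<nu> where \<nu>: "\<And>n. \<nu> n \<in> C" "\<And>n. (p, \<nu> n) \<in> normal_up_to R n (m n)"
    using ex by metis
  have close: "norm (\<nu> n - \<nu> n') \<le> 2 / real (Suc n)" if "n \<le> n'" for n n'
    by (rule normal_up_to_close[OF \<nu>(2) \<nu>(2) that])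
  have "Cauchy \<nu>"
  proof (rule metric_CauchyI)
    fix e :: real assume "e > 0"
    then have "e / 4 > 0" by simp
    then obtain N where N: "1 / real (Suc N) < e / 4" using nat_approx_posE by blast
    have "dist (\<nu> i) (\<nu> j) < e" if "i \<ge> N" "j \<ge> N" for i j
    proof -
      have "dist (\<nu> i) (\<nu> j) \<le> norm (\<nu> N - \<nu> i) + norm (\<nu> N - \<nu> j)"
        using dist_triangle3[of "\<nu> i" "\<nu> j" "\<nu> N"] by (simp add: dist_norm)
      also have "\<dots> \<le> 4 * (1 / real (Suc N))" using close[OF that(1)] close[OF that(2)] by simp
      also have "\<dots> < e" using N by linarith
      finally show ?thesis .
    qed
    then show "\<exists>M. \<forall>m\<ge>M. \<forall>n\<ge>M. dist (\<nu> m) (\<nu> n) < e" by blast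
  qed
  then obtain l where l: "\<nu> \<longlonglongrightarrow> l" using Cauchy_convergent convergent_def by blast
  have "l \<in> C" using closed_sequentially[OF C] \<nu>(1) l by blast
  have ln: "norm (\<nu> n - l) \<le> 2 / real (Suc n)" for n
  proof (rule tendsto_upperbound)
    show "(\<lambda>j. norm (\<nu> n - \<nu> j)) \<longlonglongrightarrow> norm (\<nu> n - l)" by (intro tendsto_intros l)
    show "\<forall>\<^sub>F j in sequentially. norm (\<nu> n - \<nu> j) \<le> 2 / real (Suc n)"
      using eventually_ge_at_top[of n] by (rule eventually_mono) (rule close)
  qed simp
  have "norm (\<nu> n) = 1" for n using \<nu>(2)[of n] by (simp add: normal_up_to_def)
  then have "norm l = 1" using tendsto_norm[OF l] LIMSEQ_unique[OF _ tendsto_const[of "1::real"]] by simp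
  moreover have "\<exists>\<delta>>0. \<forall>y\<in>ball p \<delta>. ((y - p) \<bullet> l < - \<epsilon> * norm (y - p) \<longrightarrow> y \<in> R) \<and>
        ((y - p) \<bullet> l > \<epsilon> * norm (y - p) \<longrightarrow> y \<notin> R)" if "\<epsilon> > 0" for \<epsilon>
  proof -
    have "\<epsilon> / 3 > 0" using that by simp
    then obtain n where n: "1 / real (Suc n) < \<epsilon> / 3" using nat_approx_posE by blast
    have "((y - p) \<bullet> l < - \<epsilon> * norm (y - p) \<longrightarrow> y \<in> R) \<and> ((y - p) \<bullet> l > \<epsilon> * norm (y - p) \<longrightarrow> y \<notin> R)"
      if y: "y \<in> ball p (1 / real (Suc (m n)))" for y
    proof -
      have "\<bar>(y - p) \<bullet> (\<nu> n - l)\<bar> \<le> norm (y - p) * (2 / real (Suc n))"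
        using Cauchy_Schwarz_ineq2[of "y - p" "\<nu> n - l"] mult_left_mono[OF ln[of n], of "norm (y - p)"] by simp
      then have a: "\<bar>(y - p) \<bullet> \<nu> n - (y - p) \<bullet> l\<bar> \<le> 2 * (1 / real (Suc n) * norm (y - p))"
        by (simp add: inner_diff_right mult.commute)
      have b: "1 / real (Suc n) * norm (y - p) \<le> \<epsilon> / 3 * norm (y - p)"
        using n by (intro mult_right_mono) auto
      have yd: "dist p y < 1 / real (Suc (m n))" using y by simp
      show ?thesis
        using normal_up_to_imp[OF \<nu>(2)[of n] yd] a b unfolding abs_le_iff
        by (cases "y \<in> R") (simp_all, argo+)
    qed
    then show ?thesis by (intro exI[of _ "1 / real (Suc (m n))"]) simp
  qed
  ultimately have "is_outward_normal R p l" by (simp add: is_outward_normal_def)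
  with \<open>l \<in> C\<close> show ?thesis by blast
qed

text \<open>The projection of a closed set need not be Borel in general, but here it is a countable union of
  projections of compact sets.\<close>

lemma borel_fst_image_normal_up_to:
  assumes "closed C"
  shows "fst ` (normal_up_to R n m \<inter> UNIV \<times> C) \<in> sets borel"
proof -
  have "normal_up_to R n m \<inter> UNIV \<times> C = (\<Union>j. normal_up_to R n m \<inter> (cball 0 (real j) \<times> (C \<inter> cball 0 1)))"
    using real_arch_simple by (auto simp: normal_up_to_def)
  then have "fst ` (normal_up_to R n m \<inter> UNIV \<times> C) =
      (\<Union>j. fst ` (normal_up_to R n m \<inter> (cball 0 (real j) \<times> (C \<inter> cball 0 1))))"
    by (simp only: image_UN)
  moreover have "compact (fst ` (normal_up_to R n m \<inter> (cball 0 (real j) \<times> (C \<inter> cball 0 1))))" for j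
    using assms by (intro compact_continuous_image closed_Int_compact closed_normal_up_to compact_Times
        compact_cball continuous_intros)
  then have "fst ` (normal_up_to R n m \<inter> (cball 0 (real j) \<times> (C \<inter> cball 0 1))) \<in> sets borel" for j
    by (rule borel_compact)
  then have "(\<Union>j. fst ` (normal_up_to R n m \<inter> (cball 0 (real j) \<times> (C \<inter> cball 0 1)))) \<in> sets borel"
    by (intro sets.countable_UN) blast
  ultimately show ?thesis by simp
qed

lemma borel_has_normal_in:
  assumes "closed C"
  shows "{p. \<exists>\<nu>\<in>C. is_outward_normal R p \<nu>} \<in> sets borel"
proof -
  have "{p. \<exists>\<nu>\<in>C. is_outward_normal R p \<nu>} = (\<Inter>n. \<Union>m. fst ` (normal_up_to R n m \<inter> UNIV \<times> C))"
  proof (intro equalityI subsetI)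
    fix p assume "p \<in> {p. \<exists>\<nu>\<in>C. is_outward_normal R p \<nu>}"
    then obtain \<nu> where \<nu>: "\<nu> \<in> C" "is_outward_normal R p \<nu>" by blast
    show "p \<in> (\<Inter>n. \<Union>m. fst ` (normal_up_to R n m \<inter> UNIV \<times> C))"
      using normal_up_to_if_outward_normal[OF \<nu>(2)] \<nu>(1) by force
  next
    fix p assume p: "p \<in> (\<Inter>n. \<Union>m. fst ` (normal_up_to R n m \<inter> UNIV \<times> C))"
    have "\<exists>m \<nu>. \<nu> \<in> C \<and> (p, \<nu>) \<in> normal_up_to R n m" for n using p by force
    then show "p \<in> {p. \<exists>\<nu>\<in>C. is_outward_normal R p \<nu>}"
      using outward_normal_if_normal_up_to[OF assms] by blast
  qed
  also have "\<dots> \<in> sets borel"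
    using borel_fst_image_normal_up_to[OF assms] by (intro sets.countable_INT sets.countable_UN) auto
  finally show ?thesis .
qed

lemma borel_measurable_outward_normal [measurable]: "outward_normal R \<in> borel_measurable borel"
  unfolding borel_eq_closed
proof (rule measurable_measure_of)
  fix C :: "vec3 set" assume "C \<in> Collect closed"
  then have C: "closed C" by simp
  let ?E = "\<lambda>C. {p. \<exists>\<nu>\<in>C. is_outward_normal R p \<nu>}"
  have eq: "outward_normal R p = \<nu>" if "is_outward_normal R p \<nu>" for p \<nu>
    using that someI[of "is_outward_normal R p"] is_outward_normal_unique unfolding outward_normal_def by metis
  have "outward_normal R -` C \<inter> space borel = ?E C \<union> (if 0 \<in> C then - ?E UNIV else {})"
  proof (intro equalityI subsetI)
    fix p assume "p \<in> outward_normal R -` C \<inter> space borel"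
    then show "p \<in> ?E C \<union> (if 0 \<in> C then - ?E UNIV else {})"
      using eq[of p] by (cases "\<exists>\<nu>. is_outward_normal R p \<nu>") (auto simp: outward_normal_def[of R p])
  next
    fix p assume "p \<in> ?E C \<union> (if 0 \<in> C then - ?E UNIV else {})"
    then consider \<nu> where "\<nu> \<in> C" "is_outward_normal R p \<nu>"
      | "0 \<in> C" "\<nexists>\<nu>. is_outward_normal R p \<nu>" by (auto split: if_splits)
    then show "p \<in> outward_normal R -` C \<inter> space borel"
    proof cases
      case 1 then show ?thesis using eq by simp
    next
      case 2 then show ?thesis by (simp add: outward_normal_def)
    qed
  qed
  then show "outward_normal R -` C \<inter> space (sigma UNIV (Collect closed)) \<in> sets (sigma UNIV (Collect closed))"
    using borel_has_normal_in[OF C, of R] borel_has_normal_in[OF closed_UNIV, of R]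
    unfolding borel_eq_closed[symmetric] by auto
qed auto

section \<open>Functions orthogonal to all polynomials\<close>

text \<open>Phase space and its boundary thereby carry the Borel sets of a bounded subset of \<open>\<real>\<^sup>6\<close>.\<close>

lemma sets_restrict_borel_Times:
  fixes A :: "'a::second_countable_topology set" and B :: "'b::second_countable_topology set"
  assumes "A \<in> sets borel" "B \<in> sets borel"
  shows "sets (restrict_space borel A \<Otimes>\<^sub>M restrict_space borel B) = sets (restrict_space borel (A \<times> B))"
    (is "sets ?P = sets ?Q")
proof (rule antisym)
  have AB: "A \<times> B \<in> sets (borel :: ('a \<times> 'b) measure)"
    using pair_measureI[OF assms] unfolding borel_prod .
  show "sets ?P \<subseteq> sets ?Q"
  proof (rule sets_pair_in_sets)
    fix a b assume "a \<in> sets (restrict_space borel A)" "b \<in> sets (restrict_space borel B)"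
    then have "a \<in> sets borel" "b \<in> sets borel" "a \<subseteq> A" "b \<subseteq> B"
      using assms by (auto simp: sets_restrict_space_iff)
    then show "a \<times> b \<in> sets ?Q"
      using AB pair_measureI[of a borel b borel] unfolding borel_prod by (auto simp: sets_restrict_space_iff)
  qed
  have "(\<lambda>x. x) \<in> measurable ?P (borel \<Otimes>\<^sub>M borel)"
    using measurable_Pair[OF measurable_compose[OF measurable_fst measurable_restrict_space1[OF measurable_ident]]
        measurable_compose[OF measurable_snd measurable_restrict_space1[OF measurable_ident]]]
    by (simp add: id_def)
  then have id: "(\<lambda>x. x) \<in> measurable ?P borel" unfolding borel_prod .
  show "sets ?Q \<subseteq> sets ?P"
  proof
    fix X assume "X \<in> sets ?Q"
    then have "X \<in> sets borel" "X \<subseteq> A \<times> B" using AB by (auto simp: sets_restrict_space_iff)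
    then show "X \<in> sets ?P"
      using measurable_sets[OF id, of X] by (simp add: space_pair_measure space_restrict_space Int_absorb2)
  qed
qed

lemma continuous_imp_measurable_restrict:
  fixes f :: "'a::topological_space \<Rightarrow> 'b::topological_space"
  assumes M: "sets M = sets (restrict_space borel S)" and f: "continuous_on UNIV f"
  shows "f \<in> borel_measurable M"
  unfolding measurable_cong_sets[OF M refl]
  by (intro measurable_restrict_space1 borel_measurable_continuous_onI f)

lemma continuous_imp_bounded_on_space:
  fixes f :: "'a::euclidean_space \<Rightarrow> real"
  assumes M: "sets M = sets (restrict_space borel S)" and S: "bounded S" and f: "continuous_on UNIV f"
  obtains B where "B \<ge> 0" "\<And>x. x \<in> space M \<Longrightarrow> \<bar>f x\<bar> \<le> B"
proof -
  have "compact (closure S)" using S by simp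
  then have "bounded (f ` closure S)"
    using f by (intro compact_imp_bounded compact_continuous_image) (auto intro: continuous_on_subset)
  then obtain B where "B > 0" and B: "\<And>y. y \<in> f ` closure S \<Longrightarrow> norm y \<le> B" unfolding bounded_pos by blast
  show ?thesis
  proof (rule that[of B])
    fix x assume "x \<in> space M"
    then have "x \<in> S" using sets_eq_imp_space_eq[OF M] by (simp add: space_restrict_space)
    then show "\<bar>f x\<bar> \<le> B" using B[of "f x"] closure_subset by auto
  qed (use \<open>B > 0\<close> in simp)
qed

lemma integrable_mult_continuous:
  fixes f h :: "'a::euclidean_space \<Rightarrow> real"
  assumes M: "sets M = sets (restrict_space borel S)" "bounded S" and f: "continuous_on UNIV f"
    and h: "integrable M h"
  shows "integrable M (\<lambda>x. h x * f x)"
proof -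
  obtain B where B: "B \<ge> 0" "\<And>x. x \<in> space M \<Longrightarrow> \<bar>f x\<bar> \<le> B"
    using continuous_imp_bounded_on_space[OF M f] by blast
  show ?thesis
  proof (rule Bochner_Integration.integrable_bound)
    show "integrable M (\<lambda>x. B * h x)" using h by simp
    show "(\<lambda>x. h x * f x) \<in> borel_measurable M"
      using h continuous_imp_measurable_restrict[OF M(1) f] by (intro borel_measurable_times) auto
    show "AE x in M. norm (h x * f x) \<le> norm (B * h x)"
    proof (rule AE_I2)
      fix x assume "x \<in> space M"
      then have "\<bar>h x\<bar> * \<bar>f x\<bar> \<le> \<bar>h x\<bar> * B" using B by (intro mult_left_mono) auto
      then show "norm (h x * f x) \<le> norm (B * h x)" using B(1) by (simp add: abs_mult mult.commute)
    qed
  qed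
qed

text \<open>By Stone-Weierstrass \<open>h\<close> is orthogonal to all continuous functions. Indicators of closed sets are
  bounded limits of continuous functions, and closed sets generate the Borel sets, so the integral of \<open>h\<close>
  over each Borel set is zero.\<close>

lemma AE_zero_if_orthogonal_to_polynomials:
  fixes h :: "'a::euclidean_space \<Rightarrow> real"
  assumes M: "sets M = sets (restrict_space borel S)" "bounded S" and h: "integrable M h"
    and poly: "\<And>p. real_polynomial_function p \<Longrightarrow> (LINT x|M. h x * p x) = 0"
  shows "AE x in M. h x = 0"
proof -
  have sp: "space M = S" using sets_eq_imp_space_eq[OF M(1)] by (simp add: space_restrict_space)
  have hm: "h \<in> borel_measurable M" using h by simp
  have cont: "(LINT x|M. h x * f x) = 0" if f: "continuous_on UNIV f" for f
  proof -
    define I where "I = (LINT x|M. \<bar>h x\<bar>)"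
    have "I \<ge> 0" by (simp add: I_def)
    have "\<bar>LINT x|M. h x * f x\<bar> \<le> e * I" if "e > 0" for e
    proof -
      have "compact (closure S)" "continuous_on (closure S) f" using M(2) f by (auto intro: continuous_on_subset)
      then obtain p where p: "real_polynomial_function p" "\<And>x. x \<in> closure S \<Longrightarrow> \<bar>f x - p x\<bar> < e"
        using Stone_Weierstrass_real_polynomial_function[OF _ _ \<open>e > 0\<close>] by blast
      have cp: "continuous_on UNIV p" using smooth_continuous_on[OF smooth_polynomial[OF p(1)]] .
      have i: "integrable M (\<lambda>x. h x * f x)" "integrable M (\<lambda>x. h x * p x)"
        by (rule integrable_mult_continuous[OF M f h], rule integrable_mult_continuous[OF M cp h])
      have "(LINT x|M. h x * f x) = (LINT x|M. h x * f x - h x * p x)"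
        using i poly[OF p(1)] by simp
      also have "\<bar>\<dots>\<bar> \<le> (LINT x|M. e * \<bar>h x\<bar>)"
      proof (rule integral_abs_bound[THEN order_trans], rule integral_mono)
        fix x assume "x \<in> space M"
        then have "\<bar>f x - p x\<bar> \<le> e" using p(2)[of x] sp closure_subset[of S] by force
        then have "\<bar>h x\<bar> * \<bar>f x - p x\<bar> \<le> \<bar>h x\<bar> * e" by (rule mult_left_mono) simp
        then show "\<bar>h x * f x - h x * p x\<bar> \<le> e * \<bar>h x\<bar>"
          by (simp add: abs_mult[symmetric] right_diff_distrib mult.commute)
      qed (use i h in auto)
      finally show ?thesis by (simp add: I_def)
    qed
    then have "\<bar>LINT x|M. h x * f x\<bar> \<le> 0 + e" if "e > 0" for e
    proof -
      have "\<bar>LINT x|M. h x * f x\<bar> \<le> e / (I + 1) * I"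
        using \<open>\<And>e. e > 0 \<Longrightarrow> \<bar>LINT x|M. h x * f x\<bar> \<le> e * I\<close>[of "e / (I + 1)"] that \<open>I \<ge> 0\<close> by simp
      also have "\<dots> \<le> e" using that \<open>I \<ge> 0\<close> by (simp add: field_simps)
      finally show ?thesis by simp
    qed
    then have "\<bar>LINT x|M. h x * f x\<bar> \<le> 0" by (rule field_le_epsilon)
    then show ?thesis by simp
  qed
  have closed: "(LINT x|M. h x * indicator C x) = 0" if C: "closed C" for C
  proof (cases "C = {}")
    case False
    \<comment> \<open>These decrease to the indicator of \<open>C\<close>.\<close>
    define f where "f = (\<lambda>(n::nat) x. max 0 (1 - real n * infdist x C))"
    have cf: "continuous_on UNIV (f n)" for n
      unfolding f_def by (intro continuous_intros)
    have "(\<lambda>n. LINT x|M. h x * f n x) \<longlonglongrightarrow> (LINT x|M. h x * indicator C x)"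
    proof (rule integral_dominated_convergence[where w = "\<lambda>x. \<bar>h x\<bar>"])
      have "C \<inter> S \<in> sets M"
        using C unfolding M(1) sets_restrict_space by (auto simp: Int_commute intro: borel_closed)
      then have "(\<lambda>x. indicator (C \<inter> S) x :: real) \<in> borel_measurable M" by simp
      moreover have "\<And>x. x \<in> space M \<Longrightarrow> (indicator (C \<inter> S) x :: real) = indicator C x" using sp by (simp add: indicator_def)
      ultimately have "(\<lambda>x. indicator C x :: real) \<in> borel_measurable M" by (simp cong: measurable_cong)
      then show "(\<lambda>x. h x * indicator C x) \<in> borel_measurable M" using hm by (intro borel_measurable_times)
      show "(\<lambda>x. h x * f n x) \<in> borel_measurable M" for n
        by (intro borel_measurable_times hm continuous_imp_measurable_restrict[OF M(1) cf])
      show "AE x in M. norm (h x * f n x) \<le> \<bar>h x\<bar>" for n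
      proof (rule AE_I2)
        fix x
        have "\<bar>f n x\<bar> \<le> 1" using infdist_nonneg[of x C] by (auto simp: f_def)
        then have "\<bar>h x\<bar> * \<bar>f n x\<bar> \<le> \<bar>h x\<bar> * 1" by (rule mult_left_mono) simp
        then show "norm (h x * f n x) \<le> \<bar>h x\<bar>" by (simp add: abs_mult)
      qed
      show "AE x in M. (\<lambda>n. h x * f n x) \<longlonglongrightarrow> h x * indicator C x"
      proof (rule AE_I2, rule tendsto_mult[OF tendsto_const])
        fix x
        show "(\<lambda>n. f n x) \<longlonglongrightarrow> indicator C x"
        proof (cases "x \<in> C")
          case True
          then show ?thesis by (simp add: f_def)
        next
          case x: False
          then have d: "infdist x C > 0" using infdist_pos_not_in_closed[OF C False] by simp
          obtain N :: nat where N: "1 / infdist x C \<le> real N" using real_arch_simple by blast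
          have "f n x = 0" if "n \<ge> N" for n
          proof -
            have "1 / infdist x C \<le> real n" using N that by linarith
            then have "1 \<le> real n * infdist x C" using d by (simp add: field_simps)
            then show ?thesis by (simp add: f_def)
          qed
          then have "\<forall>\<^sub>F n in sequentially. f n x = indicator C x"
            using x by (intro eventually_sequentiallyI[of N]) simp
          then show ?thesis by (rule tendsto_eventually)
        qed
      qed
    qed (use h in simp)
    then show ?thesis using cont[OF cf] by (simp add: LIMSEQ_const_iff)
  qed simp
  have ind: "integrable M (\<lambda>x. h x * indicator B x)" if "B \<inter> S \<in> sets M" for B
  proof -
    have "integrable M (\<lambda>x. h x * indicator (B \<inter> S) x)"
      using integrable_real_mult_indicator[OF that h] by simp
    then show ?thesis using sp by (subst Bochner_Integration.integrable_cong[OF refl]) (auto simp: indicator_def)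
  qed
  have borelM: "B \<inter> S \<in> sets M" if "B \<in> sets borel" for B
    using that unfolding M(1) sets_restrict_space by (auto simp: Int_commute)
  have all: "(LINT x|M. h x * indicator B x) = 0" if "B \<in> sets borel" for B
  proof -
    have "Int_stable (Collect closed :: 'a set set)" by (auto simp: Int_stable_def)
    moreover have "Collect closed \<subseteq> Pow (UNIV :: 'a set)" by simp
    moreover have "B \<in> sigma_sets UNIV (Collect closed)"
      using that unfolding borel_eq_closed by simp
    ultimately show ?thesis
    proof (induction rule: sigma_sets_induct_disjoint)
      case (basic A)
      then show ?case using closed by simp
    next
      case empty
      show ?case by simp
    next
      case (compl A)
      then have A: "A \<in> sets borel" unfolding borel_eq_closed by simp
      have "(LINT x|M. h x * indicator (UNIV - A) x) = (LINT x|M. h x * indicator UNIV x - h x * indicator A x)"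
        by (intro Bochner_Integration.integral_cong) (auto simp: indicator_def)
      also have "\<dots> = 0" using compl closed[of UNIV] ind[OF borelM[OF A]] h
        by (subst Bochner_Integration.integral_diff) auto
      finally show ?case .
    next
      case (union A)
      then have A: "A i \<in> sets borel" for i unfolding borel_eq_closed by auto
      have "(\<lambda>n. LINT x|M. h x * indicator (\<Union>i<n. A i) x) \<longlonglongrightarrow> (LINT x|M. h x * indicator (\<Union>i. A i) x)"
      proof (rule integral_dominated_convergence[where w = "\<lambda>x. \<bar>h x\<bar>"])
        show "(\<lambda>x. h x * indicator (\<Union>i. A i) x) \<in> borel_measurable M"
          using A by (intro borel_measurable_integrable ind borelM sets.countable_UN) auto
        show "(\<lambda>x. h x * indicator (\<Union>i<n. A i) x) \<in> borel_measurable M" for n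
          using A by (intro borel_measurable_integrable ind borelM sets.countable_UN) auto
        show "AE x in M. norm (h x * indicator (\<Union>i<n. A i) x) \<le> \<bar>h x\<bar>" for n
          by (auto simp: indicator_def)
        show "AE x in M. (\<lambda>n. h x * indicator (\<Union>i<n. A i) x) \<longlonglongrightarrow> h x * indicator (\<Union>i. A i) x"
          by (intro AE_I2 tendsto_mult tendsto_const LIMSEQ_indicator_UN)
      qed (use h in simp)
      moreover have "(LINT x|M. h x * indicator (\<Union>i<n. A i) x) = 0" for n
      proof -
        have "(LINT x|M. h x * indicator (\<Union>i<n. A i) x) = (LINT x|M. (\<Sum>i<n. h x * indicator (A i) x))"
          using union(1) by (intro Bochner_Integration.integral_cong refl)
            (simp add: indicator_UN_disjoint disjoint_family_on_mono[of "{..<n}" UNIV] sum_distrib_left)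
        also have "\<dots> = (\<Sum>i<n. LINT x|M. h x * indicator (A i) x)"
          using A by (intro Bochner_Integration.integral_sum ind borelM) auto
        also have "\<dots> = 0" using union by simp
        finally show ?thesis .
      qed
      ultimately show ?case by (simp add: LIMSEQ_const_iff)
    qed
  qed
  \<comment> \<open>On the Borel set where \<open>h\<close> is positive, \<open>\<bar>h\<bar> = 2 h - h\<close>; elsewhere \<open>\<bar>h\<bar> = 0 - h\<close>.\<close>
  define P where "P = {x \<in> space M. h x > 0}"
  have P: "P \<in> sets M" unfolding P_def using hm by measurable
  then obtain B where B: "B \<in> sets borel" "P = S \<inter> B" unfolding M(1) sets_restrict_space by auto
  have "(LINT x|M. \<bar>h x\<bar>) = (LINT x|M. 2 * (h x * indicator B x) - h x * indicator UNIV x)"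
  proof (rule Bochner_Integration.integral_cong[OF refl])
    fix x assume "x \<in> space M"
    then have "x \<in> B \<longleftrightarrow> h x > 0" using B(2) sp by (auto simp: P_def)
    then show "\<bar>h x\<bar> = 2 * (h x * indicator B x) - h x * indicator UNIV x" by (auto simp: indicator_def)
  qed
  also have "\<dots> = 0" using all[OF B(1)] all[of UNIV] ind[OF borelM[OF B(1)]] h
    by (subst Bochner_Integration.integral_diff) auto
  finally have "AE x in M. \<bar>h x\<bar> = 0"
    using h by (subst (asm) integral_nonneg_eq_0_iff_AE) auto
  then show ?thesis by simp
qed

section \<open>The inner product of square-integrable functions\<close>

lemma L2_measurable: "f \<in> L2 M \<Longrightarrow> f \<in> borel_measurable M"
  by (simp add: L2_def)

lemma L2_integrable_mult:
  assumes "f \<in> L2 M" "g \<in> L2 M" shows "integrable M (\<lambda>x. f x * g x)"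
proof (rule Bochner_Integration.integrable_bound)
  show "integrable M (\<lambda>x. (f x)\<^sup>2 + (g x)\<^sup>2)" using assms by (simp add: L2_def)
  show "(\<lambda>x. f x * g x) \<in> borel_measurable M" using assms by (auto simp: L2_def)
  have "\<bar>a * b\<bar> \<le> \<bar>a\<^sup>2 + b\<^sup>2\<bar>" for a b :: real
  proof -
    have "2 * (\<bar>a\<bar> * \<bar>b\<bar>) \<le> a\<^sup>2 + b\<^sup>2" using sum_squares_bound[of "\<bar>a\<bar>" "\<bar>b\<bar>"] by simp
    moreover have "0 \<le> \<bar>a\<bar> * \<bar>b\<bar>" by simp
    ultimately have "\<bar>a * b\<bar> \<le> a\<^sup>2 + b\<^sup>2" unfolding abs_mult by linarith
    then show ?thesis by linarith
  qed
  then show "AE x in M. norm (f x * g x) \<le> norm ((f x)\<^sup>2 + (g x)\<^sup>2)" by simp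
qed

lemma L2_lincomb:
  assumes "f \<in> L2 M" "g \<in> L2 M" shows "(\<lambda>x. a * f x + b * g x) \<in> L2 M"
proof -
  have "integrable M (\<lambda>x. a\<^sup>2 * (f x)\<^sup>2 + b\<^sup>2 * (g x)\<^sup>2 + 2 * a * b * (f x * g x))"
    using assms L2_integrable_mult[OF assms] by (auto simp: L2_def)
  then show ?thesis
    using assms by (auto simp: L2_def power2_eq_square algebra_simps)
qed

lemma L2_sum: "finite I \<Longrightarrow> (\<And>i. i \<in> I \<Longrightarrow> f i \<in> L2 M) \<Longrightarrow> (\<lambda>x. \<Sum>i\<in>I. c i * f i x) \<in> L2 M"
proof (induction I rule: finite_induct)
  case (insert i I)
  then show ?case using L2_lincomb[of "f i" M "\<lambda>x. \<Sum>i\<in>I. c i * f i x" "c i" 1] by simp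
qed (simp add: L2_def)

lemma L2_bounded:
  assumes "finite_measure M" "f \<in> borel_measurable M" "\<And>x. x \<in> space M \<Longrightarrow> \<bar>f x\<bar> \<le> B"
  shows "f \<in> L2 M"
proof -
  have "integrable M (\<lambda>x. (f x)\<^sup>2)"
    using assms power_mono[of "\<bar>f _\<bar>" B 2]
    by (intro finite_measure.integrable_const_bound[where B = "B\<^sup>2"]) (auto intro!: AE_I2)
  with assms show ?thesis by (simp add: L2_def)
qed

lemma L2_mult_bounded:
  assumes f: "f \<in> L2 M" and g: "g \<in> borel_measurable M" "\<And>x. x \<in> space M \<Longrightarrow> \<bar>g x\<bar> \<le> B"
  shows "(\<lambda>x. g x * f x) \<in> L2 M"
proof -
  have "integrable M (\<lambda>x. (g x * f x)\<^sup>2)"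
  proof (rule Bochner_Integration.integrable_bound)
    show "integrable M (\<lambda>x. B\<^sup>2 * (f x)\<^sup>2)" using f by (simp add: L2_def)
    show "(\<lambda>x. (g x * f x)\<^sup>2) \<in> borel_measurable M" using f g by (auto simp: L2_def)
    show "AE x in M. norm ((g x * f x)\<^sup>2) \<le> norm (B\<^sup>2 * (f x)\<^sup>2)"
    proof (rule AE_I2)
      fix x assume "x \<in> space M"
      then have "\<bar>g x\<bar>\<^sup>2 \<le> B\<^sup>2" using g(2) by (intro power_mono) auto
      then have "(g x)\<^sup>2 * (f x)\<^sup>2 \<le> B\<^sup>2 * (f x)\<^sup>2" by (intro mult_right_mono) auto
      then show "norm ((g x * f x)\<^sup>2) \<le> norm (B\<^sup>2 * (f x)\<^sup>2)" by (simp add: power_mult_distrib)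
    qed
  qed
  then show ?thesis using f g by (auto simp: L2_def)
qed

lemma ip_commute: "ip M f g = ip M g f"
  by (simp add: ip_def mult.commute)

lemma ip_lincomb_left:
  assumes "f \<in> L2 M" "g \<in> L2 M" "h \<in> L2 M"
  shows "ip M (\<lambda>x. a * f x + b * g x) h = a * ip M f h + b * ip M g h"
  using L2_integrable_mult[OF assms(1,3)] L2_integrable_mult[OF assms(2,3)]
  by (simp add: ip_def distrib_right mult.assoc)

lemma ip_sum_left:
  assumes "finite I" "\<And>i. i \<in> I \<Longrightarrow> f i \<in> L2 M" "h \<in> L2 M"
  shows "ip M (\<lambda>x. \<Sum>i\<in>I. c i * f i x) h = (\<Sum>i\<in>I. c i * ip M (f i) h)"
  using L2_integrable_mult[OF assms(2,3)]
  by (simp add: ip_def sum_distrib_right mult.assoc Bochner_Integration.integral_sum)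

lemma ip_cong_AE:
  assumes "f \<in> borel_measurable M" "f' \<in> borel_measurable M" "h \<in> borel_measurable M" "AE x in M. f x = f' x"
  shows "ip M f h = ip M f' h"
  unfolding ip_def using assms by (intro integral_cong_AE) auto

lemma L2norm_square: "(L2norm M f)\<^sup>2 = ip M f f"
  by (simp add: L2norm_def ip_def power2_eq_square[symmetric])

lemma ip_self_nonneg: "ip M f f \<ge> 0"
  by (simp add: ip_def)

lemma ip_self_eq_0:
  assumes "f \<in> L2 M" "ip M f f = 0" shows "AE x in M. f x = 0"
  using assms integral_nonneg_eq_0_iff_AE[of M "\<lambda>x. (f x)\<^sup>2"] by (simp add: ip_def L2_def power2_eq_square)

text \<open>Cauchy-Schwarz inequality, from the nonnegativity of \<open>\<parallel>x f + y g\<parallel>\<^sup>2\<close> as a quadratic form in \<open>x\<close>, \<open>y\<close>.\<close>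

lemma abs_ip_le:
  assumes f: "f \<in> L2 M" and g: "g \<in> L2 M"
  shows "\<bar>ip M f g\<bar> \<le> L2norm M f * L2norm M g"
proof -
  let ?A = "ip M f f" and ?B = "ip M f g" and ?C = "ip M g g"
  have q: "0 \<le> x\<^sup>2 * ?A + 2 * x * y * ?B + y\<^sup>2 * ?C" for x y
  proof -
    have "(\<lambda>t. x * f t + y * g t) \<in> L2 M" by (rule L2_lincomb[OF f g])
    then have "ip M (\<lambda>t. x * f t + y * g t) (\<lambda>t. x * f t + y * g t)
        = x * ip M (\<lambda>t. x * f t + y * g t) f + y * ip M (\<lambda>t. x * f t + y * g t) g"
      using f g by (simp add: ip_lincomb_left ip_commute[of M f "\<lambda>t. x * f t + y * g t"] ip_commute[of M g "\<lambda>t. x * f t + y * g t"])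
    also have "\<dots> = x\<^sup>2 * ?A + 2 * x * y * ?B + y\<^sup>2 * ?C"
      using f g by (simp add: ip_lincomb_left ip_commute[of M g f] power2_eq_square algebra_simps)
    finally show ?thesis using ip_self_nonneg[of M "\<lambda>t. x * f t + y * g t"] by simp
  qed
  have "?B\<^sup>2 \<le> ?A * ?C"
  proof (cases "?A = 0")
    case True
    have "?B = 0"
    proof (rule ccontr)
      assume "?B \<noteq> 0"
      \<comment> \<open>The quadratic form takes the value \<open>- 1\<close> here.\<close>
      then show False using q[of "- (?C + 1) / (2 * ?B)" 1] True by (simp add: field_simps)
    qed
    then show ?thesis using True by simp
  next
    case False
    then have A: "?A > 0" using ip_self_nonneg[of M f] by simp
    \<comment> \<open>The vector \<open>x f + y g\<close> with \<open>x = B\<close>, \<open>y = - A\<close> is orthogonal to \<open>f\<close>.\<close>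
    have "0 \<le> ?A * (?A * ?C - ?B\<^sup>2)" using q[of ?B "- ?A"] by (simp add: power2_eq_square algebra_simps)
    then show ?thesis using A by (simp add: zero_le_mult_iff)
  qed
  then have "\<bar>?B\<bar>\<^sup>2 \<le> (L2norm M f * L2norm M g)\<^sup>2" by (simp add: power_mult_distrib L2norm_square)
  then show ?thesis by (rule power2_le_imp_le) (simp add: L2norm_def)
qed

section \<open>Uniqueness and linearity of streams and traces\<close>

lemma borel_sphere: "sphere (0::vec3) 1 \<in> sets borel"
  by (rule borel_closed) simp

lemma finite_sphere_measure: "finite_measure sphere_measure"
  by (rule finite_surface_measure[OF borel_sphere hausdorff2_sphere_finite])

lemma continuous_sgrad:
  assumes "smooth \<eta>" shows "continuous_on UNIV (sgrad \<eta>)"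
proof -
  have eq: "sgrad \<eta> = (\<lambda>x. \<Sum>i\<in>Basis. (snd x \<bullet> i) * frechet_derivative \<eta> (at x) (i, 0))"
  proof
    fix x :: "vec3 \<times> vec3"
    obtain r s where x: "x = (r, s)" by fastforce
    define D where "D = frechet_derivative \<eta> (at (r, s))"
    have D: "(\<eta> has_derivative D) (at (r, s))" unfolding D_def by (rule smooth_has_derivative[OF assms])
    have "((\<lambda>r'. (r', s)) has_derivative (\<lambda>v. (v, 0))) (at r)"
      by (intro has_derivative_Pair has_derivative_ident has_derivative_const)
    from has_derivative_compose[OF this D]
    have D': "((\<lambda>r'. \<eta> (r', s)) has_derivative (\<lambda>v. D (v, 0))) (at r)" .
    then have "sgrad \<eta> (r, s) = D (s, 0)"
      unfolding sgrad_def using frechet_derivative_at[OF D', symmetric] by simp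
    also have "\<dots> = D (\<Sum>i\<in>Basis. (s \<bullet> i) *\<^sub>R i, 0)" by (simp add: euclidean_representation)
    also have "\<dots> = (\<Sum>i\<in>Basis. D ((s \<bullet> i) *\<^sub>R i, 0))"
      by (rule linear_sum[OF has_derivative_linear[OF D']])
    also have "\<dots> = (\<Sum>i\<in>Basis. (s \<bullet> i) * D (i, 0))"
      using linear_scale[OF has_derivative_linear[OF D']] by (intro sum.cong) auto
    finally show "sgrad \<eta> x = (\<Sum>i\<in>Basis. (snd x \<bullet> i) * frechet_derivative \<eta> (at x) (i, 0))"
      by (simp add: x D_def)
  qed
  show ?thesis unfolding eq
    by (intro continuous_intros smooth_continuous_on[OF smooth_directional_derivative[OF assms]])
qed

lemma smooth_dist_square: "smooth (\<lambda>x :: vec3 \<times> vec3. (fst x - p) \<bullet> (fst x - p))"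
proof -
  have "smooth (\<lambda>x :: vec3 \<times> vec3. fst x \<bullet> i - p \<bullet> i)" for i
    by (intro smooth_diff smooth_const smooth_bounded_linear bounded_linear_inner_left_comp bounded_linear_fst)
  then have "smooth (\<lambda>x :: vec3 \<times> vec3. \<Sum>i\<in>Basis. (fst x \<bullet> i - p \<bullet> i) * (fst x \<bullet> i - p \<bullet> i))"
    by (intro smooth_sum smooth_mult)
  moreover have "(fst x - p) \<bullet> (fst x - p) = (\<Sum>i\<in>Basis. (fst x \<bullet> i - p \<bullet> i) * (fst x \<bullet> i - p \<bullet> i))"
    for x :: "vec3 \<times> vec3"
    by (subst euclidean_inner) (simp only: inner_diff_left)
  ultimately show ?thesis by simp
qed

locale lipschitz_phase_space =
  fixes R :: "vec3 set"
  assumes bounded_domain: "bounded R" and lipschitz_domain: "lipschitz_domain R"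
begin

lemma open_domain: "open R"
  using lipschitz_domain by (simp add: lipschitz_domain_def)

lemma finite_phase_measure: "finite_measure (phase_measure R)"
  unfolding phase_measure_def
proof (rule finite_measure_pair_measure[OF finite_sphere_measure])
  show "finite_measure (restrict_space lborel R)"
    using emeasure_bounded_finite[OF bounded_domain] open_domain
    by (intro finite_measureI) (simp add: space_restrict_space emeasure_restrict_space)
qed

lemma finite_bdry_measure: "finite_measure (bdry_measure R)"
  unfolding bdry_measure_def
  by (intro finite_measure_pair_measure finite_sphere_measure finite_surface_measure
      hausdorff2_frontier_finite bounded_domain lipschitz_domain) simp

lemma sets_phase_measure: "sets (phase_measure R) = sets (restrict_space borel (R \<times> sphere 0 1))"
proof -
  have "sets (phase_measure R) = sets (restrict_space borel R \<Otimes>\<^sub>M restrict_space borel (sphere (0::vec3) 1))"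
    unfolding phase_measure_def
    by (intro sets_pair_measure_cong sets_surface_measure sets_restrict_space_cong sets_lborel)
  then show ?thesis using sets_restrict_borel_Times[OF _ borel_sphere, of R] open_domain by simp
qed

lemma sets_bdry_measure: "sets (bdry_measure R) = sets (restrict_space borel (frontier R \<times> sphere 0 1))"
proof -
  have "sets (bdry_measure R) = sets (restrict_space borel (frontier R) \<Otimes>\<^sub>M restrict_space borel (sphere (0::vec3) 1))"
    unfolding bdry_measure_def by (intro sets_pair_measure_cong sets_surface_measure)
  then show ?thesis using sets_restrict_borel_Times[OF _ borel_sphere, of "frontier R"] by simp
qed

lemma space_phase_measure: "space (phase_measure R) = R \<times> sphere 0 1"
  by (simp add: phase_measure_def space_pair_measure space_restrict_space)

lemma space_bdry_measure: "space (bdry_measure R) = frontier R \<times> sphere 0 1"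
  by (simp add: bdry_measure_def space_pair_measure)

lemma bounded_phase_space: "bounded (R \<times> sphere (0::vec3) 1)" "bounded (frontier R \<times> sphere (0::vec3) 1)"
  using compact_imp_bounded[OF compact_frontier_bounded[OF bounded_domain]] bounded_domain
  by (auto intro!: bounded_Times)

lemma L2_mult_continuous:
  assumes f: "f \<in> L2 (phase_measure R)" and c: "continuous_on UNIV c"
  shows "(\<lambda>x. c x * f x) \<in> L2 (phase_measure R)"
proof -
  obtain B where B: "\<And>x. x \<in> space (phase_measure R) \<Longrightarrow> \<bar>c x\<bar> \<le> B"
    using continuous_imp_bounded_on_space[OF sets_phase_measure bounded_phase_space(1) c] by blast
  show ?thesis
    by (rule L2_mult_bounded[OF f continuous_imp_measurable_restrict[OF sets_phase_measure c] B])
qed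

lemma L2_continuous:
  assumes c: "continuous_on UNIV c" shows "c \<in> L2 (phase_measure R)"
proof -
  have "(\<lambda>_. 1) \<in> L2 (phase_measure R)"
    by (rule L2_bounded[OF finite_phase_measure, where B = 1]) auto
  from L2_mult_continuous[OF this c] show ?thesis by simp
qed

lemma L2_sgrad: "smooth \<eta> \<Longrightarrow> sgrad \<eta> \<in> L2 (phase_measure R)"
  and L2_smooth: "smooth \<eta> \<Longrightarrow> \<eta> \<in> L2 (phase_measure R)"
  by (auto intro: L2_continuous continuous_sgrad smooth_continuous_on)

lemma has_stream_L2: "has_stream R v g \<Longrightarrow> g \<in> L2 (phase_measure R)"
  by (simp add: has_stream_def)

text \<open>Two weak derivatives have the same integral against a bump function on a ball times any polynomial, so
  they agree on the ball where the bump is positive.\<close>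

lemma has_stream_unique:
  assumes 1: "has_stream R v g1" and 2: "has_stream R v g2"
  shows "AE x in phase_measure R. g1 x = g2 x"
proof -
  let ?P = "phase_measure R"
  note g = has_stream_L2[OF 1] has_stream_L2[OF 2]
  have loc: "AE x in ?P. fst x \<in> ball p \<rho> \<longrightarrow> g1 x = g2 x" if \<rho>: "\<rho> > 0" "cball p \<rho> \<subseteq> R" for p \<rho>
  proof -
    define \<beta> where "\<beta> = (\<lambda>x :: vec3 \<times> vec3. bump (\<rho>\<^sup>2) ((fst x - p) \<bullet> (fst x - p)))"
    have \<beta>: "smooth \<beta>" unfolding \<beta>_def by (rule smooth_bump[OF smooth_dist_square])
    have c\<beta>: "continuous_on UNIV \<beta>" by (rule smooth_continuous_on[OF \<beta>])
    have out: "\<beta> (r, s) = 0" if "r \<notin> cball p \<rho>" for r s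
    proof -
      have "\<rho> \<le> norm (r - p)" using that by (simp add: dist_norm norm_minus_commute)
      then have "\<rho>\<^sup>2 \<le> (r - p) \<bullet> (r - p)" using \<rho>(1) by (simp add: power_mono flip: power2_norm_eq_inner)
      then show ?thesis by (simp add: \<beta>_def bump_eq_0)
    qed
    have pos: "\<beta> (r, s) > 0" if "r \<in> ball p \<rho>" for r s
    proof -
      have "norm (r - p) < \<rho>" using that by (simp add: dist_norm norm_minus_commute)
      then have "(r - p) \<bullet> (r - p) < \<rho>\<^sup>2" by (simp add: power_strict_mono flip: power2_norm_eq_inner)
      then show ?thesis by (simp add: \<beta>_def bump_pos_iff)
    qed
    have "AE x in ?P. \<beta> x * g1 x - \<beta> x * g2 x = 0"
    proof (rule AE_zero_if_orthogonal_to_polynomials[OF sets_phase_measure bounded_phase_space(1)])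
      have "(\<lambda>x. 1 * (\<beta> x * g1 x) + (-1) * (\<beta> x * g2 x)) \<in> L2 ?P"
        by (intro L2_lincomb L2_mult_continuous g c\<beta>)
      then have "(\<lambda>x. \<beta> x * g1 x - \<beta> x * g2 x) \<in> L2 ?P" by simp
      from L2_integrable_mult[OF this L2_continuous[OF continuous_on_const[of UNIV 1]]]
      show "integrable ?P (\<lambda>x. \<beta> x * g1 x - \<beta> x * g2 x)" by simp
    next
      fix q :: "vec3 \<times> vec3 \<Rightarrow> real" assume q: "real_polynomial_function q"
      have sm: "smooth (\<lambda>x. \<beta> x * q x)" by (intro smooth_mult \<beta> smooth_polynomial q)
      have "test_fun R (\<lambda>x. \<beta> x * q x)"
        unfolding test_fun_def using sm out \<rho> by (auto intro!: exI[of _ "cball p \<rho>"])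
      then have "ip ?P g1 (\<lambda>x. \<beta> x * q x) = ip ?P g2 (\<lambda>x. \<beta> x * q x)"
        using 1 2 by (simp add: has_stream_def)
      moreover have "integrable ?P (\<lambda>x. g1 x * (\<beta> x * q x))" "integrable ?P (\<lambda>x. g2 x * (\<beta> x * q x))"
        by (intro L2_integrable_mult g L2_smooth sm)+
      ultimately have "(LINT x|?P. g1 x * (\<beta> x * q x) - g2 x * (\<beta> x * q x)) = 0"
        by (simp add: ip_def)
      then show "(LINT x|?P. (\<beta> x * g1 x - \<beta> x * g2 x) * q x) = 0"
        by (simp add: algebra_simps)
    qed
    then show ?thesis
    proof (eventually_elim)
      case (elim x)
      show ?case using elim pos[of "fst x" "snd x"] by auto
    qed
  qed
  \<comment> \<open>Countably many of the balls cover \<open>R\<close>, so that the union of the exceptional sets is null.\<close>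
  define F where "F = {(p, \<rho>). \<rho> > 0 \<and> cball p \<rho> \<subseteq> R}"
  obtain F' where F': "F' \<subseteq> (\<lambda>(p, \<rho>). ball p \<rho>) ` F" "countable F'" "\<Union>F' = \<Union>((\<lambda>(p, \<rho>). ball p \<rho>) ` F)"
    by (rule Lindelof[of "(\<lambda>(p, \<rho>). ball p \<rho>) ` F"]) auto
  have cover: "R \<subseteq> \<Union>F'"
  proof
    fix r assume "r \<in> R"
    then obtain \<rho> where "\<rho> > 0" "cball r \<rho> \<subseteq> R" using open_domain open_contains_cball by blast
    then have "(r, \<rho>) \<in> F" "r \<in> ball r \<rho>" by (auto simp: F_def)
    then show "r \<in> \<Union>F'" unfolding F'(3) by force
  qed
  have "AE x in ?P. fst x \<in> N \<longrightarrow> g1 x = g2 x" if "N \<in> F'" for N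
  proof -
    from that F'(1) obtain p \<rho> where "N = ball p \<rho>" "\<rho> > 0" "cball p \<rho> \<subseteq> R" by (auto simp: F_def)
    then show ?thesis using loc by simp
  qed
  then have "AE x in ?P. \<forall>N\<in>F'. fst x \<in> N \<longrightarrow> g1 x = g2 x" using F'(2) by (rule AE_ball_countable')
  moreover have "AE x in ?P. x \<in> space ?P" by (rule AE_space)
  ultimately show ?thesis
  proof eventually_elim
    case (elim x)
    then have "fst x \<in> R" by (auto simp: space_phase_measure)
    then show ?case using elim(1) cover by blast
  qed
qed

lemma has_stream_lincomb:
  assumes u: "u \<in> L2 (phase_measure R)" "has_stream R u gu" and v: "v \<in> L2 (phase_measure R)" "has_stream R v gv"
  shows "has_stream R (\<lambda>x. a * u x + b * v x) (\<lambda>x. a * gu x + b * gv x)"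
  unfolding has_stream_def
proof (intro conjI allI impI)
  note g = has_stream_L2[OF u(2)] has_stream_L2[OF v(2)]
  show "(\<lambda>x. a * gu x + b * gv x) \<in> L2 (phase_measure R)" by (intro L2_lincomb g)
  fix \<eta> assume t: "test_fun R \<eta>"
  then have sm: "smooth \<eta>" by (simp add: test_fun_def)
  show "ip (phase_measure R) (\<lambda>x. a * u x + b * v x) (sgrad \<eta>) =
      - ip (phase_measure R) (\<lambda>x. a * gu x + b * gv x) \<eta>"
    using t u v by (simp add: ip_lincomb_left L2_sgrad sm L2_smooth g has_stream_def)
qed

lemma W_space_imp:
  assumes "v \<in> W_space R"
  shows "v \<in> L2 (phase_measure R)" "has_stream R v (stream R v)" "has_trace R v (bdry_trace R v)"
    "stream R v \<in> L2 (phase_measure R)"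
  using assms has_stream_L2[of v "stream R v"] someI_ex[of "has_stream R v"] someI_ex[of "has_trace R v"]
  by (auto simp: W_space_def stream_def bdry_trace_def)

lemma stream_lincomb:
  assumes u: "u \<in> W_space R" and v: "v \<in> W_space R" and w: "(\<lambda>x. a * u x + b * v x) \<in> W_space R"
  shows "AE x in phase_measure R. stream R (\<lambda>x. a * u x + b * v x) x = a * stream R u x + b * stream R v x"
  by (intro has_stream_unique[OF W_space_imp(2)[OF w]] has_stream_lincomb W_space_imp u v)

lemma borel_measurable_sn: "sn R \<in> borel_measurable (bdry_measure R)"
proof -
  have "(\<lambda>x. snd x \<bullet> outward_normal R (fst x)) \<in> borel_measurable borel"
    by (intro borel_measurable_inner measurable_compose[OF _ borel_measurable_outward_normal]
        borel_measurable_continuous_onI continuous_intros)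
  then show ?thesis
    unfolding measurable_cong_sets[OF sets_bdry_measure refl] sn_def
    by (intro measurable_restrict_space1) (simp add: case_prod_beta)
qed

lemma abs_sn_le: "x \<in> space (bdry_measure R) \<Longrightarrow> \<bar>sn R x\<bar> \<le> 1"
proof -
  assume x: "x \<in> space (bdry_measure R)"
  have "norm (outward_normal R (fst x)) \<le> 1"
  proof (cases "\<exists>\<nu>. is_outward_normal R (fst x) \<nu>")
    case True
    then have "is_outward_normal R (fst x) (outward_normal R (fst x))"
      using someI_ex[OF True] by (simp add: outward_normal_def)
    then show ?thesis by (simp add: is_outward_normal_def)
  qed (simp add: outward_normal_def)
  moreover have "norm (snd x) = 1" using x by (auto simp: space_bdry_measure)
  ultimately have "norm (snd x) * norm (outward_normal R (fst x)) \<le> 1" by simp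
  with Cauchy_Schwarz_ineq2[of "snd x" "outward_normal R (fst x)"] show ?thesis
    by (simp add: sn_def case_prod_beta)
qed

text \<open>The definition of a trace controls \<open>\<bar>s \<cdot> n\<bar>\<^bsup>1/2\<^esup> \<gamma>\<close>, while Green's formula pairs with \<open>(s \<cdot> n) \<gamma>\<close>. The quotient
  of the two weights is bounded by one.\<close>

lemma sn_mult_L2:
  assumes \<gamma>: "(\<lambda>x. sqrt \<bar>sn R x\<bar> * \<gamma> x) \<in> L2 (bdry_measure R)"
  shows "(\<lambda>x. sn R x * \<gamma> x) \<in> L2 (bdry_measure R)"
proof -
  have "(\<lambda>x. (sgn (sn R x) * sqrt \<bar>sn R x\<bar>) * (sqrt \<bar>sn R x\<bar> * \<gamma> x)) \<in> L2 (bdry_measure R)"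
  proof (rule L2_mult_bounded[OF \<gamma>])
    show "(\<lambda>x. sgn (sn R x) * sqrt \<bar>sn R x\<bar>) \<in> borel_measurable (bdry_measure R)"
      using borel_measurable_sn by measurable
    fix x assume "x \<in> space (bdry_measure R)"
    from abs_sn_le[OF this] show "\<bar>sgn (sn R x) * sqrt \<bar>sn R x\<bar>\<bar> \<le> 1"
      by (auto simp: abs_mult sgn_if)
  qed
  moreover have "(\<lambda>x. (sgn (sn R x) * sqrt \<bar>sn R x\<bar>) * (sqrt \<bar>sn R x\<bar> * \<gamma> x)) = (\<lambda>x. sn R x * \<gamma> x)"
  proof
    fix x
    have "sqrt \<bar>sn R x\<bar> * sqrt \<bar>sn R x\<bar> = \<bar>sn R x\<bar>" by simp
    then have "sgn (sn R x) * sqrt \<bar>sn R x\<bar> * sqrt \<bar>sn R x\<bar> = sn R x"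
      by (simp add: mult.assoc mult_sgn_abs)
    then show "(sgn (sn R x) * sqrt \<bar>sn R x\<bar>) * (sqrt \<bar>sn R x\<bar> * \<gamma> x) = sn R x * \<gamma> x"
      by (metis mult.assoc)
  qed
  ultimately show ?thesis by simp
qed

lemma smooth_L2_bdry:
  assumes "smooth \<eta>" shows "\<eta> \<in> L2 (bdry_measure R)"
proof -
  have c: "continuous_on UNIV \<eta>" by (rule smooth_continuous_on[OF assms])
  obtain B where B: "\<And>x. x \<in> space (bdry_measure R) \<Longrightarrow> \<bar>\<eta> x\<bar> \<le> B"
    using continuous_imp_bounded_on_space[OF sets_bdry_measure bounded_phase_space(2) c] by blast
  show ?thesis
    by (rule L2_bounded[OF finite_bdry_measure continuous_imp_measurable_restrict[OF sets_bdry_measure c] B])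
qed

text \<open>Polynomials are smooth up to the boundary, so Green's formula determines the integral of \<open>(s \<cdot> n) \<gamma>\<close> against
  each of them. The weight in the conclusion is the one in the boundary term of the bilinear form.\<close>

lemma has_trace_unique:
  assumes 1: "has_trace R v \<gamma>1" and 2: "has_trace R v \<gamma>2"
  shows "AE x in bdry_measure R. sqrt \<bar>sn R x\<bar> * \<gamma>1 x = sqrt \<bar>sn R x\<bar> * \<gamma>2 x"
proof -
  let ?M = "bdry_measure R"
  have g: "(\<lambda>x. sn R x * \<gamma>1 x) \<in> L2 ?M" "(\<lambda>x. sn R x * \<gamma>2 x) \<in> L2 ?M"
    using 1 2 by (auto simp: has_trace_def intro!: sn_mult_L2)
  have "AE x in ?M. sn R x * \<gamma>1 x - sn R x * \<gamma>2 x = 0"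
  proof (rule AE_zero_if_orthogonal_to_polynomials[OF sets_bdry_measure bounded_phase_space(2)])
    have "integrable ?M (\<lambda>x. sn R x * \<gamma>1 x * 1)" "integrable ?M (\<lambda>x. sn R x * \<gamma>2 x * 1)"
      by (intro L2_integrable_mult[OF _ smooth_L2_bdry] smooth_const g)+
    then show "integrable ?M (\<lambda>x. sn R x * \<gamma>1 x - sn R x * \<gamma>2 x)" by simp
  next
    fix p :: "vec3 \<times> vec3 \<Rightarrow> real" assume "real_polynomial_function p"
    then have p: "smooth p" by (rule smooth_polynomial)
    have "(LINT x|?M. sn R x * \<gamma>1 x * p x) = (LINT x|?M. sn R x * \<gamma>2 x * p x)"
      using 1[unfolded has_trace_def, THEN conjunct2, rule_format, OF p]
        2[unfolded has_trace_def, THEN conjunct2, rule_format, OF p] by simp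
    moreover have "integrable ?M (\<lambda>x. sn R x * \<gamma>1 x * p x)" "integrable ?M (\<lambda>x. sn R x * \<gamma>2 x * p x)"
      by (intro L2_integrable_mult g smooth_L2_bdry p)+
    ultimately show "(LINT x|?M. (sn R x * \<gamma>1 x - sn R x * \<gamma>2 x) * p x) = 0"
      by (simp add: left_diff_distrib)
  qed
  then show ?thesis by eventually_elim auto
qed

lemma has_trace_lincomb:
  assumes u: "u \<in> W_space R" and v: "v \<in> W_space R" and w: "(\<lambda>x. a * u x + b * v x) \<in> W_space R"
  shows "has_trace R (\<lambda>x. a * u x + b * v x) (\<lambda>x. a * bdry_trace R u x + b * bdry_trace R v x)"
  unfolding has_trace_def
proof (intro conjI allI impI)
  let ?M = "bdry_measure R" and ?P = "phase_measure R"
  note U = W_space_imp[OF u] and V = W_space_imp[OF v] and W = W_space_imp[OF w]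
  have tu: "(\<lambda>x. sqrt \<bar>sn R x\<bar> * bdry_trace R u x) \<in> L2 ?M" and tv: "(\<lambda>x. sqrt \<bar>sn R x\<bar> * bdry_trace R v x) \<in> L2 ?M"
    using U(3) V(3) by (simp_all add: has_trace_def)
  show "(\<lambda>x. sqrt \<bar>sn R x\<bar> * (a * bdry_trace R u x + b * bdry_trace R v x)) \<in> L2 ?M"
    using L2_lincomb[OF tu tv, of a b] by (simp add: algebra_simps)
  fix \<eta> :: "vec3 \<times> vec3 \<Rightarrow> real" assume sm: "smooth \<eta>"
  have st: "ip ?P (stream R (\<lambda>x. a * u x + b * v x)) \<eta> = ip ?P (\<lambda>x. a * stream R u x + b * stream R v x) \<eta>"
    by (intro ip_cong_AE stream_lincomb u v w L2_measurable W L2_lincomb U V L2_smooth sm)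
  have bd: "(LINT x|?M. sn R x * (a * bdry_trace R u x + b * bdry_trace R v x) * \<eta> x) =
     a * (LINT x|?M. sn R x * bdry_trace R u x * \<eta> x) + b * (LINT x|?M. sn R x * bdry_trace R v x * \<eta> x)"
  proof -
    have "integrable ?M (\<lambda>x. sn R x * bdry_trace R u x * \<eta> x)" "integrable ?M (\<lambda>x. sn R x * bdry_trace R v x * \<eta> x)"
      by (intro L2_integrable_mult sn_mult_L2 tu tv smooth_L2_bdry sm)+
    moreover have "(\<lambda>x. sn R x * (a * bdry_trace R u x + b * bdry_trace R v x) * \<eta> x) =
       (\<lambda>x. a * (sn R x * bdry_trace R u x * \<eta> x) + b * (sn R x * bdry_trace R v x * \<eta> x))"
      by (simp add: algebra_simps)
    ultimately show ?thesis by simp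
  qed
  have green: "ip ?P u (sgrad \<eta>) + ip ?P (stream R u) \<eta> = (LINT x|?M. sn R x * bdry_trace R u x * \<eta> x)"
    "ip ?P v (sgrad \<eta>) + ip ?P (stream R v) \<eta> = (LINT x|?M. sn R x * bdry_trace R v x * \<eta> x)"
    using U(3) V(3) sm by (simp_all add: has_trace_def)
  show "ip ?P (\<lambda>x. a * u x + b * v x) (sgrad \<eta>) + ip ?P (stream R (\<lambda>x. a * u x + b * v x)) \<eta>
      = (LINT x|?M. sn R x * (a * bdry_trace R u x + b * bdry_trace R v x) * \<eta> x)"
    unfolding st bd green[symmetric]
      ip_lincomb_left[OF U(1) V(1) L2_sgrad[OF sm]] ip_lincomb_left[OF U(4) V(4) L2_smooth[OF sm]]
    by (simp add: algebra_simps)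
qed

lemma bdry_trace_lincomb:
  assumes u: "u \<in> W_space R" and v: "v \<in> W_space R" and w: "(\<lambda>x. a * u x + b * v x) \<in> W_space R"
  shows "AE x in bdry_measure R. sqrt \<bar>sn R x\<bar> * bdry_trace R (\<lambda>x. a * u x + b * v x) x
      = a * (sqrt \<bar>sn R x\<bar> * bdry_trace R u x) + b * (sqrt \<bar>sn R x\<bar> * bdry_trace R v x)"
  using has_trace_unique[OF W_space_imp(3)[OF w] has_trace_lincomb[OF u v w]]
  by eventually_elim (simp add: algebra_simps)

end

section \<open>Scattering\<close>

lemma AE_pair_fst:
  assumes N: "sigma_finite_measure N" and Q: "AE r in M. Q r"
  shows "AE x in M \<Otimes>\<^sub>M N. Q (fst x)"
proof -
  interpret N: sigma_finite_measure N by fact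
  obtain Z where Z: "Z \<in> null_sets M" "{r \<in> space M. \<not> Q r} \<subseteq> Z"
    using Q unfolding eventually_ae_filter by blast
  have "Z \<times> space N \<in> null_sets (M \<Otimes>\<^sub>M N)"
    using Z(1) by (auto simp: null_sets_def N.emeasure_pair_measure_Times)
  then show ?thesis
    by (rule AE_I') (use Z(2) in \<open>auto simp: space_pair_measure\<close>)
qed

text \<open>The Schur test for a symmetric kernel: bound \<open>f(s) f(s')\<close> by \<open>(f(s)\<^sup>2 + f(s')\<^sup>2) / 2\<close>. By symmetry
  both halves contribute the row sum times the squared norm.\<close>

lemma quadratic_form_le_row_sum:
  fixes \<kappa> :: real
  assumes N: "finite_measure N" and k: "(\<lambda>(s, s'). k s s') \<in> borel_measurable (N \<Otimes>\<^sub>M N)"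
    and bnd: "\<And>s s'. s \<in> space N \<Longrightarrow> s' \<in> space N \<Longrightarrow> 0 \<le> k s s' \<and> k s s' \<le> \<kappa>"
    and sym: "\<And>s s'. k s s' = k s' s"
    and row: "\<And>s. s \<in> space N \<Longrightarrow> (LINT s'|N. k s s') = c"
    and f: "f \<in> L2 N"
  shows "integrable N (\<lambda>s. (LINT s'|N. k s s' * f s') * f s)"
    "(LINT s|N. (LINT s'|N. k s s' * f s') * f s) \<le> c * (LINT s|N. (f s)\<^sup>2)"
proof -
  interpret N: finite_measure N by fact
  interpret NN: pair_sigma_finite N N ..
  have fm [measurable]: "f \<in> borel_measurable N" using f by (rule L2_measurable)
  have f2: "integrable N (\<lambda>s. (f s)\<^sup>2)" using f by (simp add: L2_def)
  have k' [measurable]: "(\<lambda>x. k (fst x) (snd x)) \<in> borel_measurable (N \<Otimes>\<^sub>M N)"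
    using k by (simp add: case_prod_beta)
  have ks [measurable]: "k s \<in> borel_measurable N" if "s \<in> space N" for s
    using measurable_compose[OF measurable_Pair1' k', of s] that by simp
  have kL2: "k s \<in> L2 N" if "s \<in> space N" for s
    by (rule L2_bounded[OF N ks[OF that], of \<kappa>]) (use bnd[OF that] in force)
  have one: "(\<lambda>_. 1) \<in> L2 N" by (rule L2_bounded[OF N, of _ 1]) auto
  have ik: "integrable N (k s)" if "s \<in> space N" for s
    using L2_integrable_mult[OF kL2[OF that] one] by simp
  have ikf: "integrable N (\<lambda>s'. k s s' * f s')" if "s \<in> space N" for s
    by (rule L2_integrable_mult[OF kL2[OF that] f])
  have "integrable (N \<Otimes>\<^sub>M N) (\<lambda>x. (f (snd x))\<^sup>2)"
    using f2 by (intro NN.Fubini_integrable) (auto simp: N.integrable_const)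
  then have i2: "integrable (N \<Otimes>\<^sub>M N) (\<lambda>x. \<kappa> * (f (snd x))\<^sup>2)" by simp
  have ik2: "integrable (N \<Otimes>\<^sub>M N) (\<lambda>x. k (fst x) (snd x) * (f (snd x))\<^sup>2)"
  proof (rule Bochner_Integration.integrable_bound[OF i2])
    show "AE x in N \<Otimes>\<^sub>M N. norm (k (fst x) (snd x) * (f (snd x))\<^sup>2) \<le> norm (\<kappa> * (f (snd x))\<^sup>2)"
    proof (rule AE_I2)
      fix x assume "x \<in> space (N \<Otimes>\<^sub>M N)"
      then have "0 \<le> k (fst x) (snd x) \<and> k (fst x) (snd x) \<le> \<kappa>"
        using bnd by (auto simp: space_pair_measure)
      then show "norm (k (fst x) (snd x) * (f (snd x))\<^sup>2) \<le> norm (\<kappa> * (f (snd x))\<^sup>2)"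
        by (auto simp: abs_mult intro!: mult_right_mono)
    qed
  qed measurable
  have row2: "integrable N (\<lambda>s'. k s s' * (f s')\<^sup>2)" if "s \<in> space N" for s
  proof (rule Bochner_Integration.integrable_bound[of _ "\<lambda>s'. \<kappa> * (f s')\<^sup>2"])
    show "AE s' in N. norm (k s s' * (f s')\<^sup>2) \<le> norm (\<kappa> * (f s')\<^sup>2)"
      using bnd[OF that]
      by (intro AE_I2) (auto simp: abs_mult intro!: mult_right_mono order_trans[OF _ abs_ge_self])
  qed (use f2 that in \<open>auto intro!: borel_measurable_times ks\<close>)
  have cross: "integrable N (\<lambda>s. LINT s'|N. k s s' * (f s')\<^sup>2)"
      "(LINT s|N. LINT s'|N. k s s' * (f s')\<^sup>2) = c * (LINT s|N. (f s)\<^sup>2)"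
  proof -
    show "integrable N (\<lambda>s. LINT s'|N. k s s' * (f s')\<^sup>2)" using NN.integrable_fst'[OF ik2] by simp
    have "(LINT s|N. LINT s'|N. k s s' * (f s')\<^sup>2) = (LINT s'|N. LINT s|N. k s s' * (f s')\<^sup>2)"
      by (intro NN.Fubini_integral[symmetric]) (unfold case_prod_beta, rule ik2)
    also have "\<dots> = (LINT s'|N. c * (f s')\<^sup>2)"
    proof (rule Bochner_Integration.integral_cong[OF refl])
      fix s' assume s': "s' \<in> space N"
      have "(LINT s|N. k s s' * (f s')\<^sup>2) = (LINT s|N. k s' s) * (f s')\<^sup>2"
        using ik[OF s'] by (simp add: sym[of _ s'])
      then show "(LINT s|N. k s s' * (f s')\<^sup>2) = c * (f s')\<^sup>2" using row[OF s'] by simp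
    qed
    finally show "(LINT s|N. LINT s'|N. k s s' * (f s')\<^sup>2) = c * (LINT s|N. (f s)\<^sup>2)" by simp
  qed
  have meas: "(\<lambda>s. LINT s'|N. k s s' * f s') \<in> borel_measurable N"
  proof (rule N.borel_measurable_lebesgue_integral)
    have "(\<lambda>x. k (fst x) (snd x) * f (snd x)) \<in> borel_measurable (N \<Otimes>\<^sub>M N)" by measurable
    then show "(\<lambda>(s, s'). k s s' * f s') \<in> borel_measurable (N \<Otimes>\<^sub>M N)" by (simp add: case_prod_beta)
  qed
  have fabs: "integrable N (\<lambda>s. \<kappa> * \<bar>f s\<bar>)" using L2_integrable_mult[OF f one] by simp
  have bounded: "\<bar>LINT s'|N. k s s' * f s'\<bar> \<le> (LINT s|N. \<kappa> * \<bar>f s\<bar>)" if "s \<in> space N" for s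
  proof (rule integral_abs_bound[THEN order_trans], rule integral_mono)
    fix s' assume "s' \<in> space N"
    then show "\<bar>k s s' * f s'\<bar> \<le> \<kappa> * \<bar>f s'\<bar>" using bnd[OF that] by (simp add: abs_mult mult_right_mono)
  qed (use ikf[OF that] fabs in auto)
  show int: "integrable N (\<lambda>s. (LINT s'|N. k s s' * f s') * f s)"
    by (rule L2_integrable_mult[OF L2_bounded[OF N meas bounded] f])
  have pt: "(LINT s'|N. k s s' * f s') * f s \<le> (c * (f s)\<^sup>2 + (LINT s'|N. k s s' * (f s')\<^sup>2)) / 2" if s: "s \<in> space N" for s
  proof -
    have "(LINT s'|N. k s s' * f s') * f s = (LINT s'|N. k s s' * f s' * f s)"
      using ikf[OF s] by simp
    also have "\<dots> \<le> (LINT s'|N. (k s s' * (f s)\<^sup>2 + k s s' * (f s')\<^sup>2) / 2)"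
    proof (rule integral_mono)
      fix s' assume "s' \<in> space N"
      then have "k s s' * (2 * f s' * f s) \<le> k s s' * ((f s')\<^sup>2 + (f s)\<^sup>2)"
        using bnd[OF s] by (intro mult_left_mono sum_squares_bound) auto
      then show "k s s' * f s' * f s \<le> (k s s' * (f s)\<^sup>2 + k s s' * (f s')\<^sup>2) / 2"
        by (simp add: algebra_simps)
    qed (use ikf[OF s] ik[OF s] row2[OF s] in auto)
    also have "\<dots> = ((LINT s'|N. k s s') * (f s)\<^sup>2 + (LINT s'|N. k s s' * (f s')\<^sup>2)) / 2"
      using ik[OF s] row2[OF s] by simp
    finally show ?thesis using row[OF s] by simp
  qed
  have "(LINT s|N. (LINT s'|N. k s s' * f s') * f s) \<le> (LINT s|N. (c * (f s)\<^sup>2 + (LINT s'|N. k s s' * (f s')\<^sup>2)) / 2)"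
    using pt int f2 cross(1) by (intro integral_mono) auto
  also have "\<dots> = (c * (LINT s|N. (f s)\<^sup>2) + (LINT s|N. LINT s'|N. k s s' * (f s')\<^sup>2)) / 2"
    using f2 cross(1) by simp
  finally show "(LINT s|N. (LINT s'|N. k s s' * f s') * f s) \<le> c * (LINT s|N. (f s)\<^sup>2)"
    using cross(2) by simp
qed

text \<open>Position \<open>r\<close> is a parameter, and the kernel acts on the angular variable only.\<close>

locale scattering_kernel = M: finite_measure M + N: finite_measure N
  for M :: "'a measure" and N :: "'b measure" +
  fixes K :: "'a \<Rightarrow> 'b \<Rightarrow> 'b \<Rightarrow> real" and \<kappa> :: real
  assumes kernel_measurable [measurable]:
      "(\<lambda>x. K (fst (fst x)) (snd (fst x)) (snd x)) \<in> borel_measurable ((M \<Otimes>\<^sub>M N) \<Otimes>\<^sub>M N)"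
    and kernel_bounds: "r \<in> space M \<Longrightarrow> s \<in> space N \<Longrightarrow> s' \<in> space N \<Longrightarrow> 0 \<le> K r s s' \<and> K r s s' \<le> \<kappa>"
begin

sublocale MN: pair_sigma_finite M N ..

definition scatter :: "('a \<times> 'b \<Rightarrow> real) \<Rightarrow> 'a \<times> 'b \<Rightarrow> real" where
  "scatter f = (\<lambda>(r, s). LINT s'|N. K r s s' * f (r, s'))"

lemma L2_section:
  assumes f: "f \<in> L2 (M \<Otimes>\<^sub>M N)"
  shows "AE r in M. (\<lambda>s. f (r, s)) \<in> L2 N"
proof -
  have "AE r in M. integrable N (\<lambda>s. (f (r, s))\<^sup>2)"
    using f MN.AE_integrable_fst'[of "\<lambda>x. (f x)\<^sup>2"] by (simp add: L2_def)
  moreover have "AE r in M. r \<in> space M" by (rule AE_space)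
  ultimately show ?thesis
  proof eventually_elim
    case (elim r)
    have "(\<lambda>s. f (r, s)) \<in> borel_measurable N"
      using measurable_compose[OF measurable_Pair1'[OF elim(2)] L2_measurable[OF f]] .
    with elim show ?case by (simp add: L2_def)
  qed
qed

lemma measurable_kernel_section:
  assumes "r \<in> space M" "s \<in> space N" shows "K r s \<in> borel_measurable N"
proof -
  have "(r, s) \<in> space (M \<Otimes>\<^sub>M N)" using assms by (simp add: space_pair_measure)
  from measurable_compose[OF measurable_Pair1'[OF this] kernel_measurable] show ?thesis by simp
qed

lemma L2_kernel_section:
  assumes "r \<in> space M" "s \<in> space N" shows "K r s \<in> L2 N"
  by (rule L2_bounded[OF N.finite_measure_axioms measurable_kernel_section[OF assms], of \<kappa>])
     (use kernel_bounds[OF assms] in force)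

lemma measurable_kernel_slice:
  assumes "r \<in> space M" shows "(\<lambda>(s, s'). K r s s') \<in> borel_measurable (N \<Otimes>\<^sub>M N)"
proof -
  have "(\<lambda>x. ((r, fst x), snd x)) \<in> measurable (N \<Otimes>\<^sub>M N) ((M \<Otimes>\<^sub>M N) \<Otimes>\<^sub>M N)"
    using assms by measurable
  from measurable_compose[OF this kernel_measurable] show ?thesis by (simp add: case_prod_beta)
qed

lemma measurable_scatter:
  assumes [measurable]: "f \<in> borel_measurable (M \<Otimes>\<^sub>M N)"
  shows "scatter f \<in> borel_measurable (M \<Otimes>\<^sub>M N)"
proof -
  have "(\<lambda>x. K (fst (fst x)) (snd (fst x)) (snd x) * f (fst (fst x), snd x)) \<in> borel_measurable ((M \<Otimes>\<^sub>M N) \<Otimes>\<^sub>M N)"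
    by measurable
  then have "(\<lambda>x. LINT s'|N. K (fst x) (snd x) s' * f (fst x, s')) \<in> borel_measurable (M \<Otimes>\<^sub>M N)"
    by (intro N.borel_measurable_lebesgue_integral) (simp add: case_prod_beta)
  then show ?thesis by (simp add: scatter_def case_prod_beta)
qed

lemma scatter_square_le:
  assumes r: "r \<in> space M" and s: "s \<in> space N" and f: "(\<lambda>s. f (r, s)) \<in> L2 N"
  shows "(scatter f (r, s))\<^sup>2 \<le> \<kappa>\<^sup>2 * measure N (space N) * (LINT s|N. (f (r, s))\<^sup>2)"
proof -
  note K = L2_kernel_section[OF r s]
  have "\<bar>scatter f (r, s)\<bar>\<^sup>2 \<le> (L2norm N (K r s) * L2norm N (\<lambda>s. f (r, s)))\<^sup>2"
    using abs_ip_le[OF K f] by (intro power_mono) (auto simp: scatter_def ip_def)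
  also have "\<dots> = (LINT s'|N. (K r s s')\<^sup>2) * (LINT s|N. (f (r, s))\<^sup>2)"
    by (simp add: power_mult_distrib L2norm_def)
  also have "\<dots> \<le> (LINT s'|N. \<kappa>\<^sup>2) * (LINT s|N. (f (r, s))\<^sup>2)"
  proof (rule mult_right_mono, rule integral_mono)
    show "integrable N (\<lambda>s'. (K r s s')\<^sup>2)" using K by (simp add: L2_def)
    fix s' assume "s' \<in> space N"
    then show "(K r s s')\<^sup>2 \<le> \<kappa>\<^sup>2" using kernel_bounds[OF r s] by (intro power_mono) auto
  qed auto
  finally show ?thesis by (simp add: mult.commute)
qed

text \<open>Cauchy-Schwarz in the angular variable bounds the square of the scattered function by a multiple of the
  angular integral of \<open>f\<^sup>2\<close>, which is integrable in \<open>r\<close> by Fubini's theorem.\<close>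

lemma L2_scatter:
  assumes f: "f \<in> L2 (M \<Otimes>\<^sub>M N)" shows "scatter f \<in> L2 (M \<Otimes>\<^sub>M N)"
proof -
  define c where "c = \<kappa>\<^sup>2 * measure N (space N)"
  define G where "G = (\<lambda>r. LINT s|N. (f (r, s))\<^sup>2)"
  have m [measurable]: "scatter f \<in> borel_measurable (M \<Otimes>\<^sub>M N)"
    by (rule measurable_scatter[OF L2_measurable[OF f]])
  have G: "integrable M G" using f MN.integrable_fst'[of "\<lambda>x. (f x)\<^sup>2"] by (simp add: L2_def G_def)
  have "AE r in M. r \<in> space M" by (rule AE_space)
  with L2_section[OF f] have ae: "AE r in M. integrable N (\<lambda>s. (scatter f (r, s))\<^sup>2) \<and>
      (LINT s|N. (scatter f (r, s))\<^sup>2) \<le> measure N (space N) * c * G r"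
  proof eventually_elim
    case (elim r)
    have le: "(scatter f (r, s))\<^sup>2 \<le> c * G r" if "s \<in> space N" for s
      using scatter_square_le[OF elim(2) that elim(1)] by (simp add: c_def G_def)
    have "(\<lambda>s. scatter f (r, s)) \<in> borel_measurable N"
      using measurable_compose[OF measurable_Pair1'[OF elim(2)] m] .
    then have int: "integrable N (\<lambda>s. (scatter f (r, s))\<^sup>2)"
      using le by (intro N.integrable_const_bound[of _ "c * G r"]) auto
    have "(LINT s|N. (scatter f (r, s))\<^sup>2) \<le> (LINT s|N. c * G r)"
      using le int by (intro integral_mono) auto
    with int show ?case by simp
  qed
  have "integrable (M \<Otimes>\<^sub>M N) (\<lambda>x. (scatter f x)\<^sup>2)"
  proof (rule MN.Fubini_integrable)
    show "integrable M (\<lambda>r. LINT s|N. norm ((scatter f (r, s))\<^sup>2))"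
    proof (rule Bochner_Integration.integrable_bound)
      show "integrable M (\<lambda>r. measure N (space N) * c * G r)" using G by simp
      show "(\<lambda>r. LINT s|N. norm ((scatter f (r, s))\<^sup>2)) \<in> borel_measurable M" by measurable
      show "AE r in M. norm (LINT s|N. norm ((scatter f (r, s))\<^sup>2)) \<le> norm (measure N (space N) * c * G r)"
        using ae by eventually_elim (auto simp: abs_of_nonneg)
    qed
    show "AE r in M. integrable N (\<lambda>s. (scatter f (r, s))\<^sup>2)" using ae by eventually_elim simp
  qed measurable
  then show ?thesis by (simp add: L2_def)
qed

text \<open>Additivity of the inner integral holds at the positions where both angular sections are square
  integrable, hence almost everywhere.\<close>

lemma scatter_lincomb:
  assumes f: "f \<in> L2 (M \<Otimes>\<^sub>M N)" and g: "g \<in> L2 (M \<Otimes>\<^sub>M N)"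
  shows "AE x in M \<Otimes>\<^sub>M N. scatter (\<lambda>x. a * f x + b * g x) x = a * scatter f x + b * scatter g x"
proof -
  have "AE x in M \<Otimes>\<^sub>M N. (\<lambda>s. f (fst x, s)) \<in> L2 N" "AE x in M \<Otimes>\<^sub>M N. (\<lambda>s. g (fst x, s)) \<in> L2 N"
    by (intro AE_pair_fst[OF N.sigma_finite_measure_axioms] L2_section f g)+
  moreover have "AE x in M \<Otimes>\<^sub>M N. x \<in> space (M \<Otimes>\<^sub>M N)" by (rule AE_space)
  ultimately show ?thesis
  proof eventually_elim
    case (elim x)
    obtain r s where x: "x = (r, s)" "r \<in> space M" "s \<in> space N"
      using elim(3) by (auto simp: space_pair_measure)
    have "integrable N (\<lambda>s'. K r s s' * f (r, s'))" "integrable N (\<lambda>s'. K r s s' * g (r, s'))"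
      using elim x by (auto intro!: L2_integrable_mult L2_kernel_section)
    moreover have "(\<lambda>s'. K r s s' * (a * f (r, s') + b * g (r, s'))) =
        (\<lambda>s'. a * (K r s s' * f (r, s')) + b * (K r s s' * g (r, s')))" by (simp add: algebra_simps)
    ultimately show ?case by (simp add: x scatter_def)
  qed
qed

lemma scatter_AE_zero:
  assumes "AE x in M \<Otimes>\<^sub>M N. f x = 0"
  shows "AE x in M \<Otimes>\<^sub>M N. scatter f x = 0"
proof -
  have "AE r in M. AE s in N. f (r, s) = 0" using assms by (rule MN.AE_pair)
  then have "AE x in M \<Otimes>\<^sub>M N. AE s in N. f (fst x, s) = 0"
    by (rule AE_pair_fst[OF N.sigma_finite_measure_axioms])
  then show ?thesis
  proof eventually_elim
    case (elim x)
    have "(LINT s'|N. K (fst x) (snd x) s' * f (fst x, s')) = 0"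
      by (rule integral_eq_zero_AE) (use elim in \<open>eventually_elim, simp\<close>)
    then show ?case by (simp add: scatter_def case_prod_beta)
  qed
qed

text \<open>At almost every \<open>r\<close> the scattering term is at most \<open>\<sigma>(r)\<close> times the angular integral of \<open>f\<^sup>2\<close>, so the
  total removal rate \<open>\<tau>(r)\<close> leaves at least \<open>\<tau>(r) - \<sigma>(r) \<ge> \<alpha>\<close>.\<close>

lemma collision_coercive:
  assumes sym: "\<And>r s s'. K r s s' = K r s' s"
    and row: "\<And>r s. r \<in> space M \<Longrightarrow> s \<in> space N \<Longrightarrow> (LINT s'|N. K r s s') = \<sigma> r"
    and \<tau>: "\<And>r. r \<in> space M \<Longrightarrow> \<alpha> \<le> \<tau> r - \<sigma> r"
    and f: "f \<in> L2 (M \<Otimes>\<^sub>M N)"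
    and \<tau>f: "(\<lambda>x. \<tau> (fst x) * f x) \<in> L2 (M \<Otimes>\<^sub>M N)"
  shows "\<alpha> * ip (M \<Otimes>\<^sub>M N) f f \<le> ip (M \<Otimes>\<^sub>M N) (\<lambda>x. \<tau> (fst x) * f x - scatter f x) f"
proof -
  have i: "integrable (M \<Otimes>\<^sub>M N) (\<lambda>x. \<tau> (fst x) * f x * f x)" "integrable (M \<Otimes>\<^sub>M N) (\<lambda>x. scatter f x * f x)"
    "integrable (M \<Otimes>\<^sub>M N) (\<lambda>x. f x * f x)"
    by (intro L2_integrable_mult \<tau>f f L2_scatter)+
  have "\<alpha> * ip (M \<Otimes>\<^sub>M N) f f = (LINT r|M. \<alpha> * (LINT s|N. f (r, s) * f (r, s)))"
    unfolding ip_def by (simp add: MN.integral_fst'[OF i(3), symmetric])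
  also have "\<dots> \<le> (LINT r|M. (LINT s|N. \<tau> r * f (r, s) * f (r, s)) - (LINT s|N. scatter f (r, s) * f (r, s)))"
  proof (rule integral_mono_AE)
    show "integrable M (\<lambda>r. \<alpha> * (LINT s|N. f (r, s) * f (r, s)))" using MN.integrable_fst'[OF i(3)] by simp
    show "integrable M (\<lambda>r. (LINT s|N. \<tau> r * f (r, s) * f (r, s)) - (LINT s|N. scatter f (r, s) * f (r, s)))"
      using MN.integrable_fst'[OF i(1)] MN.integrable_fst'[OF i(2)] by simp
    have "AE r in M. r \<in> space M" by (rule AE_space)
    with L2_section[OF f]
    show "AE r in M. \<alpha> * (LINT s|N. f (r, s) * f (r, s)) \<le>
        (LINT s|N. \<tau> r * f (r, s) * f (r, s)) - (LINT s|N. scatter f (r, s) * f (r, s))"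
    proof eventually_elim
      case (elim r)
      define F where "F = (LINT s|N. (f (r, s))\<^sup>2)"
      have "(LINT s|N. scatter f (r, s) * f (r, s)) \<le> \<sigma> r * F"
        using quadratic_form_le_row_sum(2)[OF N.finite_measure_axioms measurable_kernel_slice[OF elim(2)]
            kernel_bounds[OF elim(2)] sym row[OF elim(2)] elim(1)]
        by (simp add: scatter_def F_def)
      moreover have "(LINT s|N. \<tau> r * f (r, s) * f (r, s)) = \<tau> r * F"
        by (simp add: F_def power2_eq_square mult.assoc)
      moreover have "\<alpha> * F \<le> (\<tau> r - \<sigma> r) * F" using \<tau>[OF elim(2)] by (intro mult_right_mono) (auto simp: F_def)
      ultimately show ?case by (simp add: F_def power2_eq_square left_diff_distrib)
    qed
  qed
  also have "\<dots> = ip (M \<Otimes>\<^sub>M N) (\<lambda>x. \<tau> (fst x) * f x - scatter f x) f"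
    using MN.integrable_fst'[OF i(1)] MN.integrable_fst'[OF i(2)] MN.integral_fst'[OF i(1)] MN.integral_fst'[OF i(2)] i
    by (simp add: ip_def left_diff_distrib)
  finally show ?thesis .
qed

end

section \<open>Exponential decay for coercive forms\<close>

lemma fin_dim_subspaceD:
  assumes "fin_dim_subspace M X"
  shows "f \<in> X \<Longrightarrow> f \<in> L2 M" "(\<lambda>_. 0) \<in> X"
    "f \<in> X \<Longrightarrow> g \<in> X \<Longrightarrow> (\<lambda>x. a * f x + b * g x) \<in> X"
    "f \<in> X \<Longrightarrow> g \<in> borel_measurable M \<Longrightarrow> AE x in M. f x = g x \<Longrightarrow> g \<in> X"
proof -
  show "f \<in> X \<Longrightarrow> f \<in> L2 M" and "(\<lambda>_. 0) \<in> X"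
    using assms by (auto simp: fin_dim_subspace_def)
  have add: "\<forall>f\<in>X. \<forall>g\<in>X. (\<lambda>x. f x + g x) \<in> X" and scale: "\<forall>c. \<forall>f\<in>X. (\<lambda>x. c * f x) \<in> X"
    and closed: "\<forall>f\<in>X. \<forall>g\<in>borel_measurable M. (AE x in M. f x = g x) \<longrightarrow> g \<in> X"
    using assms by (simp_all add: fin_dim_subspace_def)
  show "(\<lambda>x. a * f x + b * g x) \<in> X" if "f \<in> X" "g \<in> X"
    using add[rule_format, of "\<lambda>x. a * f x" "\<lambda>x. b * g x"] scale that by simp
  show "g \<in> X" if "f \<in> X" "g \<in> borel_measurable M" "AE x in M. f x = g x"
    using closed that by blast
qed

lemma fin_dim_subspace_sum:
  assumes X: "fin_dim_subspace M X" and I: "finite I" "\<And>i. i \<in> I \<Longrightarrow> f i \<in> X"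
  shows "(\<lambda>x. \<Sum>i\<in>I. c i * f i x) \<in> X"
  using I
proof (induction I rule: finite_induct)
  case (insert i I)
  then show ?case
    using fin_dim_subspaceD(3)[OF X, of "f i" "\<lambda>x. \<Sum>i\<in>I. c i * f i x" "c i" 1] by simp
qed (simp add: fin_dim_subspaceD(2)[OF X])

definition orthonormal_in :: "'a measure \<Rightarrow> ('a \<Rightarrow> real) set \<Rightarrow> bool" where
  "orthonormal_in M E \<longleftrightarrow> finite E \<and> E \<subseteq> L2 M \<and> (\<forall>e\<in>E. \<forall>e'\<in>E. ip M e e' = (if e = e' then 1 else 0))"

lemma ip_sum_orthonormal:
  assumes E: "orthonormal_in M E" and e: "e \<in> E"
  shows "ip M (\<lambda>x. \<Sum>b\<in>E. c b * b x) e = c e"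
proof -
  have "ip M (\<lambda>x. \<Sum>b\<in>E. c b * b x) e = (\<Sum>b\<in>E. c b * ip M b e)"
    using E e by (intro ip_sum_left) (auto simp: orthonormal_in_def)
  also have "\<dots> = (\<Sum>b\<in>E. if b = e then c b else 0)"
    using E e by (intro sum.cong) (auto simp: orthonormal_in_def)
  also have "\<dots> = c e" using E e by (simp add: orthonormal_in_def)
  finally show ?thesis .
qed

text \<open>Gram-Schmidt for a semi-inner product: if the residual of the new vector has norm zero it vanishes
  almost everywhere and the family is kept, otherwise the normalised residual is added.\<close>

lemma gram_schmidt:
  assumes X: "fin_dim_subspace M X" and D: "finite D" "D \<subseteq> X"
  shows "\<exists>E\<subseteq>X. orthonormal_in M E \<and> (\<forall>d\<in>D. AE x in M. d x = (\<Sum>e\<in>E. ip M d e * e x))"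
  using D
proof (induction D rule: finite_induct)
  case empty
  show ?case by (intro exI[of _ "{}"]) (simp add: orthonormal_in_def)
next
  case (insert d D)
  then obtain E where E: "E \<subseteq> X" "orthonormal_in M E"
    and span: "\<And>f. f \<in> D \<Longrightarrow> AE x in M. f x = (\<Sum>e\<in>E. ip M f e * e x)" by auto
  have fE: "finite E" using E by (simp add: orthonormal_in_def)
  have d: "d \<in> X" using insert by simp
  have EL: "e \<in> E \<Longrightarrow> e \<in> L2 M" for e using E by (auto simp: orthonormal_in_def)
  define p where "p = (\<lambda>x. \<Sum>e\<in>E. ip M d e * e x)"
  have p: "p \<in> X" unfolding p_def using E(1) fE by (intro fin_dim_subspace_sum[OF X]) auto
  define r where "r = (\<lambda>x. 1 * d x + (-1) * p x)"
  have r: "r \<in> X" unfolding r_def by (intro fin_dim_subspaceD(3)[OF X] d p)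
  note L = fin_dim_subspaceD(1)[OF X]
  have re: "ip M r e = 0" if "e \<in> E" for e
    using ip_lincomb_left[OF L[OF d] L[OF p] EL[OF that], of 1 "-1"] ip_sum_orthonormal[OF E(2) that, of "ip M d"]
    by (simp add: r_def p_def)
  show ?case
  proof (cases "ip M r r = 0")
    case True
    then have "AE x in M. r x = 0" by (rule ip_self_eq_0[OF L[OF r]])
    then have "AE x in M. d x = (\<Sum>e\<in>E. ip M d e * e x)" by eventually_elim (simp add: r_def p_def)
    with E span show ?thesis by (intro exI[of _ E]) auto
  next
    case False
    define n where "n = sqrt (ip M r r)"
    have n: "n > 0" "n * n = ip M r r" using False ip_self_nonneg[of M r] by (auto simp: n_def)
    define q where "q = (\<lambda>x. 1 / n * r x + 0 * r x)"
    have q: "q \<in> X" unfolding q_def by (intro fin_dim_subspaceD(3)[OF X] r)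
    have qL: "ip M q h = ip M r h / n" if "h \<in> L2 M" for h
      unfolding q_def using ip_lincomb_left[OF L[OF r] L[OF r] that, of "1 / n" 0] by simp
    have qr: "ip M q r = n" using qL[OF L[OF r]] n(1) by (simp add: n(2)[symmetric])
    have qq: "ip M q q = 1" using qL[OF L[OF q]] qr n ip_commute[of M q r] by simp
    have qe: "ip M q e = 0" if "e \<in> E" for e using qL[OF EL[OF that]] re[OF that] by simp
    have "q \<notin> E" using qe qq by force
    have eq: "ip M e q = 0" if "e \<in> E" for e using qe[OF that] ip_commute[of M e q] by simp
    have "orthonormal_in M (insert q E)"
      using E(2) \<open>q \<notin> E\<close> L[OF q] by (auto simp: orthonormal_in_def qq qe eq)
    moreover have "AE x in M. f x = (\<Sum>e\<in>insert q E. ip M f e * e x)" if "f \<in> insert d D" for f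
    proof (cases "f = d")
      case True
      have "p \<in> L2 M" by (rule L[OF p])
      have pq: "ip M p q = 0"
        unfolding p_def using ip_sum_left[OF fE EL L[OF q], of "\<lambda>e. e" "ip M d"] by (simp add: eq)
      have "ip M r q = ip M d q - ip M p q"
        using ip_lincomb_left[OF L[OF d] L[OF p] L[OF q], of 1 "-1"] by (simp add: r_def)
      then have "ip M d q = n" using pq qr ip_commute[of M q r] by simp
      then have "d x = (\<Sum>e\<in>insert q E. ip M d e * e x)" for x
        using fE \<open>q \<notin> E\<close> n(1) by (simp add: q_def r_def p_def)
      then show ?thesis using True by simp
    next
      case False
      with that have f: "f \<in> D" by simp
      have "f \<in> X" using f insert by auto
      have "ip M f q = ip M (\<lambda>x. \<Sum>e\<in>E. ip M f e * e x) q"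
        by (intro ip_cong_AE span f L2_measurable L[OF q] L[OF \<open>f \<in> X\<close>] L2_sum fE EL)
      also have "\<dots> = 0"
        using ip_sum_left[OF fE EL L[OF q], of "\<lambda>e. e" "ip M f"] by (simp add: eq)
      finally have "ip M f q = 0" .
      then show ?thesis using span[OF f] fE \<open>q \<notin> E\<close> by simp
    qed
    ultimately show ?thesis using E(1) q by (intro exI[of _ "insert q E"]) auto
  qed
qed

lemma orthonormal_basis_exists:
  assumes X: "fin_dim_subspace M X"
  obtains E where "E \<subseteq> X" "orthonormal_in M E" "\<And>f. f \<in> X \<Longrightarrow> AE x in M. f x = (\<Sum>e\<in>E. ip M f e * e x)"
proof -
  note L = fin_dim_subspaceD(1)[OF X]
  obtain D where D: "finite D" "D \<subseteq> X" and span: "\<And>f. f \<in> X \<Longrightarrow> \<exists>c. AE x in M. f x = (\<Sum>b\<in>D. c b * b x)"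
    using X unfolding fin_dim_subspace_def by blast
  obtain E where E: "E \<subseteq> X" "orthonormal_in M E" and DE: "\<And>d. d \<in> D \<Longrightarrow> AE x in M. d x = (\<Sum>e\<in>E. ip M d e * e x)"
    using gram_schmidt[OF X D] by blast
  have EL: "e \<in> E \<Longrightarrow> e \<in> L2 M" and DL: "d \<in> D \<Longrightarrow> d \<in> L2 M" for e d using E D L by auto
  have "AE x in M. f x = (\<Sum>e\<in>E. ip M f e * e x)" if f: "f \<in> X" for f
  proof -
    obtain c where c: "AE x in M. f x = (\<Sum>b\<in>D. c b * b x)" using span[OF f] by blast
    have fe: "ip M f e = (\<Sum>b\<in>D. c b * ip M b e)" if "e \<in> E" for e
    proof -
      have "ip M f e = ip M (\<lambda>x. \<Sum>b\<in>D. c b * b x) e"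
        by (intro ip_cong_AE c L2_measurable L[OF f] L2_sum D DL EL that)
      also have "\<dots> = (\<Sum>b\<in>D. c b * ip M b e)" by (intro ip_sum_left D DL EL that)
      finally show ?thesis .
    qed
    have "AE x in M. \<forall>d\<in>D. d x = (\<Sum>e\<in>E. ip M d e * e x)"
      using D(1) DE by (intro AE_finite_allI)
    with c show ?thesis
    proof eventually_elim
      case (elim x)
      have "(\<Sum>e\<in>E. ip M f e * e x) = (\<Sum>e\<in>E. \<Sum>b\<in>D. c b * ip M b e * e x)"
        by (simp add: fe sum_distrib_right)
      also have "\<dots> = (\<Sum>b\<in>D. c b * (\<Sum>e\<in>E. ip M b e * e x))"
        by (subst sum.swap) (simp add: sum_distrib_left mult.assoc)
      also have "\<dots> = (\<Sum>b\<in>D. c b * b x)" using elim(2) by (intro sum.cong) auto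
      finally show ?case using elim(1) by simp
    qed
  qed
  then show ?thesis using that E by blast
qed

text \<open>Links the Lebesgue integrals over the open time interval with the gauge integral over the closed
  one. Since Lebesgue measure is complete, equality almost everywhere with \<open>g\<close> also makes \<open>f\<close> measurable.\<close>

lemma lebesgue_on_integral_AE_eq:
  fixes f g :: "real \<Rightarrow> real"
  assumes g: "continuous_on {0..T} g" and AE: "AE t in lebesgue_on {0<..<T}. f t = g t"
  shows "(LINT t|lebesgue_on {0<..<T}. f t) = integral {0..T} g"
proof -
  have S: "{0<..<T} \<in> sets lebesgue" by simp
  have "g absolutely_integrable_on {0..T}" by (rule absolutely_integrable_continuous_real[OF g])
  then have ag: "g absolutely_integrable_on {0<..<T}"
    by (rule set_integrable_subset) auto
  have "AE t in lebesgue. t \<in> {0<..<T} \<longrightarrow> f t = g t" using AE by (simp add: AE_restrict_space_iff)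
  then obtain N where N: "N \<in> null_sets lebesgue" "{t. \<not> (t \<in> {0<..<T} \<longrightarrow> f t = g t)} \<subseteq> N"
    unfolding eventually_ae_filter by auto
  have neg: "negligible N" using N(1) by (simp add: negligible_iff_null_sets)
  have eq: "\<And>t. t \<in> {0<..<T} - N \<Longrightarrow> f t = g t" using N(2) by blast
  have "f absolutely_integrable_on {0<..<T}" by (rule absolutely_integrable_spike[OF ag neg eq])
  then have "integrable (lebesgue_on {0<..<T}) f"
    using S by (simp add: set_integrable_def integrable_restrict_space)
  then have "(LINT t|lebesgue_on {0<..<T}. f t) = integral {0<..<T} f"
    using S by (rule lebesgue_integral_eq_integral)
  also have "\<dots> = integral {0<..<T} g"
    by (rule integral_spike[OF neg]) (simp add: eq)
  also have "\<dots> = integral {0..T} g" by (simp add: integral_open_interval_real)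
  finally show ?thesis .
qed

text \<open>Elements of \<open>X\<close> are functions, not classes, so a form on \<open>X\<close> may distinguish functions that agree almost
  everywhere. The condition on null functions excludes this.\<close>

locale coercive_form =
  fixes M :: "'a measure" and X :: "('a \<Rightarrow> real) set" and B :: "('a \<Rightarrow> real) \<Rightarrow> ('a \<Rightarrow> real) \<Rightarrow> real"
    and \<alpha> :: real
  assumes fin_dim: "fin_dim_subspace M X"
    and left_linear: "\<And>f g \<psi> a b. f \<in> X \<Longrightarrow> g \<in> X \<Longrightarrow> \<psi> \<in> X \<Longrightarrow> B (\<lambda>x. a * f x + b * g x) \<psi> = a * B f \<psi> + b * B g \<psi>"
    and right_linear: "\<And>f g \<psi> a b. f \<in> X \<Longrightarrow> g \<in> X \<Longrightarrow> \<psi> \<in> X \<Longrightarrow> B \<psi> (\<lambda>x. a * f x + b * g x) = a * B \<psi> f + b * B \<psi> g"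
    and left_null: "\<And>f \<psi>. f \<in> X \<Longrightarrow> \<psi> \<in> X \<Longrightarrow> AE x in M. f x = 0 \<Longrightarrow> B f \<psi> = 0"
    and coercive: "\<And>f. f \<in> X \<Longrightarrow> \<alpha> * ip M f f \<le> B f f"
begin

lemmas subspace = fin_dim_subspaceD[OF fin_dim]

lemma diff_mem: "f \<in> X \<Longrightarrow> g \<in> X \<Longrightarrow> (\<lambda>x. f x - g x) \<in> X"
  using subspace(3)[of f g 1 "-1"] by simp

lemma left_diff: "f \<in> X \<Longrightarrow> g \<in> X \<Longrightarrow> \<psi> \<in> X \<Longrightarrow> B (\<lambda>x. f x - g x) \<psi> = B f \<psi> - B g \<psi>"
  using left_linear[of f g \<psi> 1 "-1"] by simp

lemma left_cong_AE:
  assumes "f \<in> X" "g \<in> X" "\<psi> \<in> X" "AE x in M. f x = g x"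
  shows "B f \<psi> = B g \<psi>"
  using left_null[OF diff_mem[OF assms(1,2)] assms(3)] assms left_diff by simp

lemma left_sum:
  assumes "finite I" "\<And>i. i \<in> I \<Longrightarrow> f i \<in> X" "\<psi> \<in> X"
  shows "B (\<lambda>x. \<Sum>i\<in>I. c i * f i x) \<psi> = (\<Sum>i\<in>I. c i * B (f i) \<psi>)"
  using assms(1,2)
proof (induction I rule: finite_induct)
  case empty
  show ?case using left_linear[of "\<lambda>_. 0" "\<lambda>_. 0" \<psi> 0 0] subspace(2) assms(3) by simp
next
  case (insert i I)
  then show ?case
    using left_linear[of "f i" "\<lambda>x. \<Sum>i\<in>I. c i * f i x" \<psi> "c i" 1] fin_dim_subspace_sum[OF fin_dim, of I f c] assms(3)
    by simp
qed

lemma right_sum: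
  assumes "finite I" "\<And>i. i \<in> I \<Longrightarrow> f i \<in> X" "\<psi> \<in> X"
  shows "B \<psi> (\<lambda>x. \<Sum>i\<in>I. c i * f i x) = (\<Sum>i\<in>I. c i * B \<psi> (f i))"
  using assms(1,2)
proof (induction I rule: finite_induct)
  case empty
  show ?case using right_linear[of "\<lambda>_. 0" "\<lambda>_. 0" \<psi> 0 0] subspace(2) assms(3) by simp
next
  case (insert i I)
  then show ?case
    using right_linear[of "f i" "\<lambda>x. \<Sum>i\<in>I. c i * f i x" \<psi> "c i" 1] fin_dim_subspace_sum[OF fin_dim, of I f c] assms(3)
    by simp
qed

text \<open>In an orthonormal basis the coefficients \<open>c\<close> of \<open>u - z\<close> solve a linear system of ordinary differential
  equations with the matrix of \<open>- B\<close>, first weakly and then, since its right-hand side is continuous,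
  classically. Coercivity bounds the derivative of the sum of their squares.\<close>

theorem exponential_decay:
  assumes T: "T > 0" and u: "H1_time M T X u u'" and z: "z \<in> X"
    and evol: "\<And>\<psi>. \<psi> \<in> X \<Longrightarrow> AE t in time_measure T. ip M (u' t) \<psi> + B (u t) \<psi> = F \<psi>"
    and stat: "\<And>\<psi>. \<psi> \<in> X \<Longrightarrow> B z \<psi> = F \<psi>"
    and t: "0 \<le> t" "t \<le> T"
  shows "(L2norm M (\<lambda>x. u t x - z x))\<^sup>2 \<le> exp (- 2 * \<alpha> * t) * (L2norm M (\<lambda>x. u 0 x - z x))\<^sup>2"
proof -
  obtain E where E: "E \<subseteq> X" "orthonormal_in M E" and span: "\<And>f. f \<in> X \<Longrightarrow> AE x in M. f x = (\<Sum>b\<in>E. ip M f b * b x)"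
    using orthonormal_basis_exists[OF fin_dim] by blast
  have fE: "finite E" using E(2) by (simp add: orthonormal_in_def)
  have EX: "b \<in> E \<Longrightarrow> b \<in> X" and EL: "b \<in> E \<Longrightarrow> b \<in> L2 M" for b using E(1) subspace(1) by auto
  have uX: "u \<tau> \<in> X" if "\<tau> \<in> {0..T}" for \<tau> using u that by (simp add: H1_time_def)
  define e where "e = (\<lambda>\<tau> x. u \<tau> x - z x)"
  have eX: "e \<tau> \<in> X" if "\<tau> \<in> {0..T}" for \<tau> unfolding e_def by (rule diff_mem[OF uX[OF that] z])
  define c where "c = (\<lambda>b \<tau>. ip M (e \<tau>) b)"
  have uc: "ip M (u \<tau>) b = c b \<tau> + ip M z b" if "b \<in> E" "\<tau> \<in> {0..T}" for b \<tau>
    using ip_lincomb_left[OF subspace(1)[OF uX[OF that(2)]] subspace(1)[OF z] EL[OF that(1)], of 1 "-1"]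
    by (simp add: c_def e_def)
  have cont_u: "continuous_on {0..T} (\<lambda>\<tau>. ip M (u \<tau>) b)" if b: "b \<in> E" for b
    unfolding continuous_on_def
  proof
    fix \<tau> assume \<tau>: "\<tau> \<in> {0..T}"
    have lim: "((\<lambda>\<tau>'. L2norm M (\<lambda>x. u \<tau>' x - u \<tau> x) * L2norm M b) \<longlongrightarrow> 0 * L2norm M b) (at \<tau> within {0..T})"
      using u \<tau> by (intro tendsto_mult tendsto_const) (auto simp: H1_time_def)
    have "((\<lambda>\<tau>'. ip M (u \<tau>') b - ip M (u \<tau>) b) \<longlongrightarrow> 0) (at \<tau> within {0..T})"
    proof (rule Lim_null_comparison)
      show "\<forall>\<^sub>F \<tau>' in at \<tau> within {0..T}. norm (ip M (u \<tau>') b - ip M (u \<tau>) b) \<le> L2norm M (\<lambda>x. u \<tau>' x - u \<tau> x) * L2norm M b"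
        unfolding eventually_at_filter
      proof (rule always_eventually, intro allI impI)
        fix \<tau>' assume "\<tau>' \<in> {0..T}"
        note L = subspace(1)[OF uX[OF this]] subspace(1)[OF uX[OF \<tau>]]
        have "ip M (u \<tau>') b - ip M (u \<tau>) b = ip M (\<lambda>x. u \<tau>' x - u \<tau> x) b"
          using ip_lincomb_left[OF L EL[OF b], of 1 "-1"] by simp
        moreover have "(\<lambda>x. u \<tau>' x - u \<tau> x) \<in> L2 M" using L2_lincomb[OF L, of 1 "-1"] by simp
        ultimately show "norm (ip M (u \<tau>') b - ip M (u \<tau>) b) \<le> L2norm M (\<lambda>x. u \<tau>' x - u \<tau> x) * L2norm M b"
          using abs_ip_le[OF _ EL[OF b]] by simp
      qed
    qed (use lim in simp)
    then show "((\<lambda>\<tau>. ip M (u \<tau>) b) \<longlongrightarrow> ip M (u \<tau>) b) (at \<tau> within {0..T})"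
      by (simp add: Lim_null[symmetric])
  qed
  have cont_c: "continuous_on {0..T} (c b)" if "b \<in> E" for b
  proof -
    have "continuous_on {0..T} (\<lambda>\<tau>. ip M (u \<tau>) b - ip M z b)" by (intro continuous_intros cont_u that)
    then show ?thesis by (rule continuous_on_eq) (simp add: uc[OF that])
  qed
  define g where "g = (\<lambda>b \<tau>. - (\<Sum>b'\<in>E. c b' \<tau> * B b' b))"
  have cont_g: "continuous_on {0..T} (g b)" for b
    unfolding g_def by (intro continuous_intros cont_c)
  have Be: "B (e \<tau>) \<psi> = (\<Sum>b\<in>E. c b \<tau> * B b \<psi>)" if "\<tau> \<in> {0..T}" "\<psi> \<in> X" for \<tau> \<psi>
  proof -
    have "B (e \<tau>) \<psi> = B (\<lambda>x. \<Sum>b\<in>E. c b \<tau> * b x) \<psi>"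
      unfolding c_def
      by (intro left_cong_AE eX that span fin_dim_subspace_sum[OF fin_dim fE] EX)
    also have "\<dots> = (\<Sum>b\<in>E. c b \<tau> * B b \<psi>)" by (intro left_sum fE EX that)
    finally show ?thesis .
  qed
  \<comment> \<open>Expanding \<open>e\<close> in the basis turns the equation into one for the coefficients alone.\<close>
  have u'g: "AE \<tau> in time_measure T. ip M (u' \<tau>) b = g b \<tau>" if b: "b \<in> E" for b
  proof -
    have "AE \<tau> in time_measure T. \<tau> \<in> space (time_measure T)" by (rule AE_space)
    with evol[OF EX[OF b]] show ?thesis
    proof eventually_elim
      case (elim \<tau>)
      then have \<tau>: "\<tau> \<in> {0..T}" by (auto simp: time_measure_def space_restrict_space)
      have "B (u \<tau>) b - F b = B (e \<tau>) b"
        using left_diff[OF uX[OF \<tau>] z EX[OF b]] stat[OF EX[OF b]] by (simp add: e_def)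
      with elim(1) show ?case using Be[OF \<tau> EX[OF b]] by (simp add: g_def)
    qed
  qed
  have deriv_u: "((\<lambda>\<tau>. ip M (u \<tau>) b) has_real_derivative g b \<tau>) (at \<tau>)" if b: "b \<in> E" and \<tau>: "0 < \<tau>" "\<tau> < T" for b \<tau>
  proof (rule derivative_if_weak_derivative_continuous[OF T cont_u[OF b] cont_g _ \<tau>])
    fix \<eta> assume \<eta>: "time_test T \<eta>"
    then have sm: "smooth \<eta>" by (simp add: time_test_def)
    note cd = continuous_on_deriv_smooth[OF sm]
    have "(LINT \<tau>|time_measure T. deriv \<eta> \<tau> * ip M (u \<tau>) b) = - (LINT \<tau>|time_measure T. \<eta> \<tau> * ip M (u' \<tau>) b)"
      using u EX[OF b] \<eta> unfolding H1_time_def time_test_def by blast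
    moreover have "(LINT \<tau>|time_measure T. deriv \<eta> \<tau> * ip M (u \<tau>) b) = integral {0..T} (\<lambda>\<tau>. deriv \<eta> \<tau> * ip M (u \<tau>) b)"
      unfolding time_measure_def
      by (intro lebesgue_on_integral_AE_eq continuous_intros cd cont_u b) simp
    moreover have "(LINT \<tau>|time_measure T. \<eta> \<tau> * ip M (u' \<tau>) b) = integral {0..T} (\<lambda>\<tau>. \<eta> \<tau> * g b \<tau>)"
      using u'g[OF b] unfolding time_measure_def
      by (intro lebesgue_on_integral_AE_eq continuous_intros smooth_continuous_on[OF sm] cont_g) (auto elim!: eventually_mono)
    ultimately show "integral {0..T} (\<lambda>\<tau>. deriv \<eta> \<tau> * ip M (u \<tau>) b) = - integral {0..T} (\<lambda>\<tau>. \<eta> \<tau> * g b \<tau>)"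
      by simp
  qed
  have deriv_c: "(c b has_real_derivative g b \<tau>) (at \<tau>)" if b: "b \<in> E" and \<tau>: "0 < \<tau>" "\<tau> < T" for b \<tau>
  proof -
    have "((\<lambda>\<tau>. ip M (u \<tau>) b - ip M z b) has_real_derivative g b \<tau>) (at \<tau>)"
      using DERIV_diff[OF deriv_u[OF b \<tau>] DERIV_const] by simp
    then show ?thesis
      by (rule has_field_derivative_transform_within_open[of _ _ _ "{0<..<T}"]) (use \<tau> uc[OF b] in auto)
  qed
  define S where "S = (\<lambda>\<tau>. \<Sum>b\<in>E. (c b \<tau>)\<^sup>2)"
  have norm_e: "(L2norm M (e \<tau>))\<^sup>2 = S \<tau>" if \<tau>: "\<tau> \<in> {0..T}" for \<tau>
  proof -
    note L = subspace(1)[OF eX[OF \<tau>]]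
    have "ip M (e \<tau>) (e \<tau>) = ip M (\<lambda>x. \<Sum>b\<in>E. c b \<tau> * b x) (e \<tau>)"
      unfolding c_def by (intro ip_cong_AE span eX \<tau> L2_measurable L L2_sum fE EL)
    also have "\<dots> = (\<Sum>b\<in>E. c b \<tau> * ip M b (e \<tau>))" by (intro ip_sum_left fE EL L)
    also have "\<dots> = S \<tau>" by (simp add: S_def c_def ip_commute[of M _ "e \<tau>"] power2_eq_square)
    finally show ?thesis by (simp add: L2norm_square)
  qed
  \<comment> \<open>Testing with \<open>e\<close>, represented by its basis expansion \<open>p\<close>.\<close>
  have dissip: "(\<Sum>b\<in>E. c b \<tau> * g b \<tau>) \<le> - \<alpha> * S \<tau>" if \<tau>: "\<tau> \<in> {0..T}" for \<tau>
  proof -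
    define p where "p = (\<lambda>x. \<Sum>b\<in>E. c b \<tau> * b x)"
    have p: "p \<in> X" unfolding p_def by (intro fin_dim_subspace_sum[OF fin_dim fE] EX)
    have "ip M p p = (\<Sum>b\<in>E. c b \<tau> * ip M b p)"
      using ip_sum_left[OF fE EL subspace(1)[OF p], of "\<lambda>b. b" "\<lambda>b. c b \<tau>"] by (simp add: p_def)
    also have "\<dots> = (\<Sum>b\<in>E. c b \<tau> * c b \<tau>)"
      using ip_sum_orthonormal[OF E(2), of _ "\<lambda>b. c b \<tau>"] by (intro sum.cong) (auto simp: p_def ip_commute)
    finally have "ip M p p = S \<tau>" by (simp add: S_def power2_eq_square)
    moreover have "B p p = (\<Sum>b\<in>E. c b \<tau> * B p b)"
      using right_sum[OF fE EX p, of "\<lambda>b. b" "\<lambda>b. c b \<tau>"] by (simp add: p_def)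
    moreover have "B p b = - g b \<tau>" if "b \<in> E" for b
      using left_sum[OF fE EX EX[OF that], of "\<lambda>b. b" "\<lambda>b. c b \<tau>"] by (simp add: p_def g_def)
    ultimately show ?thesis using coercive[OF p] by (simp add: sum_negf)
  qed
  have "exp (2 * \<alpha> * t) * S t \<le> exp (2 * \<alpha> * 0) * S 0"
  proof (rule DERIV_nonpos_imp_decreasing_open[OF t(1), of "\<lambda>\<tau>. exp (2 * \<alpha> * \<tau>) * S \<tau>"])
    fix \<tau> assume "0 < \<tau>" "\<tau> < t"
    then have \<tau>: "0 < \<tau>" "\<tau> < T" "\<tau> \<in> {0..T}" using t by auto
    have "(S has_real_derivative (\<Sum>b\<in>E. 2 * c b \<tau> * g b \<tau>)) (at \<tau>)"
      unfolding S_def using DERIV_power[OF deriv_c[OF _ \<tau>(1,2)], of _ 2]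
      by (intro DERIV_sum) (simp add: mult.commute mult.left_commute)
    moreover have "((\<lambda>\<tau>. exp (2 * \<alpha> * \<tau>)) has_real_derivative 2 * \<alpha> * exp (2 * \<alpha> * \<tau>)) (at \<tau>)"
      by (auto intro!: derivative_eq_intros)
    ultimately have "((\<lambda>\<tau>. exp (2 * \<alpha> * \<tau>) * S \<tau>) has_real_derivative
        2 * \<alpha> * exp (2 * \<alpha> * \<tau>) * S \<tau> + (\<Sum>b\<in>E. 2 * c b \<tau> * g b \<tau>) * exp (2 * \<alpha> * \<tau>)) (at \<tau>)"
      by (rule DERIV_mult[rotated])
    moreover have "2 * \<alpha> * exp (2 * \<alpha> * \<tau>) * S \<tau> + (\<Sum>b\<in>E. 2 * c b \<tau> * g b \<tau>) * exp (2 * \<alpha> * \<tau>)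
        = 2 * exp (2 * \<alpha> * \<tau>) * ((\<Sum>b\<in>E. c b \<tau> * g b \<tau>) + \<alpha> * S \<tau>)"
      by (simp add: algebra_simps sum_distrib_left)
    moreover have "\<dots> \<le> 0" using dissip[OF \<tau>(3)] by (intro mult_nonneg_nonpos) auto
    ultimately show "\<exists>y. ((\<lambda>\<tau>. exp (2 * \<alpha> * \<tau>) * S \<tau>) has_real_derivative y) (at \<tau>) \<and> y \<le> 0"
      by auto
  next
    have "continuous_on {0..t} (c b)" if "b \<in> E" for b
      by (rule continuous_on_subset[OF cont_c[OF that]]) (use t in auto)
    then show "continuous_on {0..t} (\<lambda>\<tau>. exp (2 * \<alpha> * \<tau>) * S \<tau>)"
      unfolding S_def by (intro continuous_intros)
  qed
  then have "S t \<le> exp (- 2 * \<alpha> * t) * S 0"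
    by (simp add: exp_minus field_simps)
  then show ?thesis using norm_e[of t] norm_e[of 0] t T by (simp add: e_def)
qed

end

section \<open>The transport form\<close>

text \<open>Closure under equality almost everywhere: a perturbation of \<open>f + g\<close> on a null set can be absorbed by \<open>g\<close>.\<close>

lemma fin_dim_subspace_direct_sum:
  assumes X: "fin_dim_subspace M X" and Y: "fin_dim_subspace M Y"
  shows "fin_dim_subspace M (direct_sum X Y)"
proof -
  note X' = fin_dim_subspaceD[OF X] and Y' = fin_dim_subspaceD[OF Y]
  have mem: "(\<lambda>x. f x + g x) \<in> direct_sum X Y" if "f \<in> X" "g \<in> Y" for f g
    using that unfolding direct_sum_def by blast
  have elim: "\<exists>f\<in>X. \<exists>g\<in>Y. h = (\<lambda>x. f x + g x)" if "h \<in> direct_sum X Y" for h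
    using that unfolding direct_sum_def by blast
  have lin: "(\<lambda>x. a * h x + b * h' x) \<in> direct_sum X Y" if h: "h \<in> direct_sum X Y" "h' \<in> direct_sum X Y" for h h' a b
  proof -
    obtain f g f' g' where fg: "f \<in> X" "g \<in> Y" "h = (\<lambda>x. f x + g x)" "f' \<in> X" "g' \<in> Y" "h' = (\<lambda>x. f' x + g' x)"
      using elim[OF h(1)] elim[OF h(2)] by blast
    have "(\<lambda>x. (a * f x + b * f' x) + (a * g x + b * g' x)) \<in> direct_sum X Y"
      by (rule mem[OF X'(3)[OF fg(1,4)] Y'(3)[OF fg(2,5)]])
    then show ?thesis by (simp add: fg algebra_simps)
  qed
  have L: "h \<in> L2 M" if h: "h \<in> direct_sum X Y" for h
  proof -
    obtain f g where "f \<in> X" "g \<in> Y" "h = (\<lambda>x. f x + g x)" using elim[OF h] by blast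
    then show ?thesis using L2_lincomb[OF X'(1) Y'(1), of f g 1 1] by simp
  qed
  have cl: "h' \<in> direct_sum X Y"
    if h: "h \<in> direct_sum X Y" and h': "h' \<in> borel_measurable M" and ae: "AE x in M. h x = h' x" for h h'
  proof -
    obtain f g where fg: "f \<in> X" "g \<in> Y" "h = (\<lambda>x. f x + g x)" using elim[OF h] by blast
    have "(\<lambda>x. h' x - f x) \<in> Y"
    proof (rule Y'(4)[OF fg(2)])
      show "(\<lambda>x. h' x - f x) \<in> borel_measurable M"
        using h' L2_measurable[OF X'(1)[OF fg(1)]] by (rule borel_measurable_diff)
      show "AE x in M. g x = h' x - f x" using ae by eventually_elim (simp add: fg(3))
    qed
    from mem[OF fg(1) this] show ?thesis by simp
  qed
  obtain D where D: "finite D" "D \<subseteq> X" "\<And>f. f \<in> X \<Longrightarrow> \<exists>c. AE x in M. f x = (\<Sum>b\<in>D. c b * b x)"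
    using X unfolding fin_dim_subspace_def by blast
  obtain E where E: "finite E" "E \<subseteq> Y" "\<And>f. f \<in> Y \<Longrightarrow> \<exists>c. AE x in M. f x = (\<Sum>b\<in>E. c b * b x)"
    using Y unfolding fin_dim_subspace_def by blast
  have span: "\<exists>c. AE x in M. h x = (\<Sum>b\<in>D \<union> E. c b * b x)" if h: "h \<in> direct_sum X Y" for h
  proof -
    obtain f g where fg: "f \<in> X" "g \<in> Y" "h = (\<lambda>x. f x + g x)" using elim[OF h] by blast
    obtain c c' where c: "AE x in M. f x = (\<Sum>b\<in>D. c b * b x)" "AE x in M. g x = (\<Sum>b\<in>E. c' b * b x)"
      using D(3)[OF fg(1)] E(3)[OF fg(2)] by blast
    define d where "d = (\<lambda>b. (if b \<in> D then c b else 0) + (if b \<in> E then c' b else 0))"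
    from c have "AE x in M. h x = (\<Sum>b\<in>D \<union> E. d b * b x)"
    proof eventually_elim
      case (elim x)
      have "(\<Sum>b\<in>D \<union> E. d b * b x) =
          (\<Sum>b\<in>D \<union> E. if b \<in> D then c b * b x else 0) + (\<Sum>b\<in>D \<union> E. if b \<in> E then c' b * b x else 0)"
        unfolding sum.distrib[symmetric] by (intro sum.cong) (auto simp: d_def distrib_right)
      also have "\<dots> = (\<Sum>b\<in>D. c b * b x) + (\<Sum>b\<in>E. c' b * b x)"
        using D(1) E(1) by (simp add: sum.If_cases Int_absorb1)
      finally show ?case using elim by (simp add: fg(3))
    qed
    then show ?thesis by blast
  qed
  have zero: "(\<lambda>_. 0) \<in> direct_sum X Y" using mem[OF X'(2) Y'(2)] by simp
  have basis: "D \<union> E \<subseteq> direct_sum X Y"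
  proof
    fix b assume "b \<in> D \<union> E"
    then show "b \<in> direct_sum X Y"
      using mem[of b "\<lambda>_. 0"] mem[of "\<lambda>_. 0" b] X'(2) Y'(2) D(2) E(2) by auto
  qed
  show ?thesis
    unfolding fin_dim_subspace_def
  proof (intro conjI ballI allI impI)
    show "direct_sum X Y \<subseteq> L2 M" using L by blast
    show "(\<lambda>_. 0) \<in> direct_sum X Y" by (rule zero)
    show "(\<lambda>x. f x + g x) \<in> direct_sum X Y" if "f \<in> direct_sum X Y" "g \<in> direct_sum X Y" for f g
      using lin[OF that, of 1 1] by simp
    show "(\<lambda>x. c * f x) \<in> direct_sum X Y" if "f \<in> direct_sum X Y" for c f
      using lin[OF that that, of c 0] by simp
    show "g \<in> direct_sum X Y" if "f \<in> direct_sum X Y" "g \<in> borel_measurable M" "AE x in M. f x = g x" for f g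
      by (rule cl[OF that])
    show "\<exists>B. finite B \<and> B \<subseteq> direct_sum X Y \<and> (\<forall>f\<in>direct_sum X Y. \<exists>c. AE x in M. f x = (\<Sum>b\<in>B. c b * b x))"
      using D(1) E(1) basis span by (intro exI[of _ "D \<union> E"]) simp
  qed
qed

context lipschitz_phase_space
begin

definition reflect :: "vec3 \<times> vec3 \<Rightarrow> vec3 \<times> vec3" where
  "reflect = (\<lambda>(r, s). (r, - s))"

lemma orthogonal_uminus: "orthogonal_transformation (uminus :: vec3 \<Rightarrow> vec3)"
  by (simp add: orthogonal_transformation_neg orthogonal_transformation_id[unfolded id_def])

lemma measurable_reflect: "reflect \<in> measurable (phase_measure R) (phase_measure R)"
  unfolding phase_measure_def reflect_def case_prod_beta
  by (intro measurable_Pair measurable_fst measurable_compose[OF measurable_snd measurable_sphere_orthogonal[OF orthogonal_uminus]])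

text \<open>Reflection of the direction is an orthogonal map, and surface measure is invariant under those. Hence
  even and odd parts respect equality almost everywhere.\<close>

lemma distr_reflect: "distr (phase_measure R) (phase_measure R) reflect = phase_measure R"
proof -
  let ?L = "restrict_space lborel R"
  have eq: "distr sphere_measure sphere_measure uminus = sphere_measure"
    by (rule distr_sphere_orthogonal[OF orthogonal_uminus])
  have "sigma_finite_measure (distr sphere_measure sphere_measure uminus)"
    unfolding eq using finite_sphere_measure by (rule finite_measure.axioms(1))
  then have "distr ?L ?L (\<lambda>x. x) \<Otimes>\<^sub>M distr sphere_measure sphere_measure uminus =
      distr (?L \<Otimes>\<^sub>M sphere_measure) (?L \<Otimes>\<^sub>M sphere_measure) (\<lambda>(x, y). (x, - y))"
    by (intro pair_measure_distr measurable_sphere_orthogonal[OF orthogonal_uminus]) auto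
  then show ?thesis unfolding eq by (simp add: phase_measure_def reflect_def distr_id2)
qed

lemma AE_reflect: "AE x in phase_measure R. Q x \<Longrightarrow> AE x in phase_measure R. Q (reflect x)"
  by (rule AE_distrD[OF measurable_reflect]) (unfold distr_reflect)

lemma even_part_reflect: "even_part f x = (f x + f (reflect x)) / 2"
  and odd_part_reflect: "odd_part f x = (f x - f (reflect x)) / 2"
  by (simp_all add: even_part_def odd_part_def reflect_def case_prod_beta)

lemma parts_measurable:
  assumes f: "f \<in> borel_measurable (phase_measure R)"
  shows "even_part f \<in> borel_measurable (phase_measure R)" "odd_part f \<in> borel_measurable (phase_measure R)"
proof -
  have [measurable]: "(\<lambda>x. f (reflect x)) \<in> borel_measurable (phase_measure R)"
    by (rule measurable_compose[OF measurable_reflect f])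
  note [measurable] = f
  have "(\<lambda>x. (f x + f (reflect x)) / 2) \<in> borel_measurable (phase_measure R)"
    "(\<lambda>x. (f x - f (reflect x)) / 2) \<in> borel_measurable (phase_measure R)" by measurable
  then show "even_part f \<in> borel_measurable (phase_measure R)" "odd_part f \<in> borel_measurable (phase_measure R)"
    by (simp_all add: even_part_reflect[abs_def] odd_part_reflect[abs_def])
qed

lemma parts_AE_zero:
  assumes "AE x in phase_measure R. f x = 0"
  shows "AE x in phase_measure R. even_part f x = 0" "AE x in phase_measure R. odd_part f x = 0"
  using assms AE_reflect[OF assms] by (eventually_elim, simp add: even_part_reflect odd_part_reflect)+

lemma parts_lincomb:
  "even_part (\<lambda>x. a * f x + b * g x) = (\<lambda>x. a * even_part f x + b * even_part g x)"
  "odd_part (\<lambda>x. a * f x + b * g x) = (\<lambda>x. a * odd_part f x + b * odd_part g x)"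
  by (auto simp: even_part_reflect odd_part_reflect field_simps fun_eq_iff)

text \<open>The even part of \<open>w + v\<close> agrees almost everywhere with \<open>w\<close>, and the discrete spaces contain every
  representative of their elements.\<close>

lemma parts_direct_sum:
  assumes W: "fin_dim_subspace (phase_measure R) Wh" "Wh \<subseteq> even_in R (W_space R)"
    and V: "fin_dim_subspace (phase_measure R) Vh" "Vh \<subseteq> odd_in R (V_space R)"
    and f: "f \<in> direct_sum Wh Vh"
  shows "even_part f \<in> Wh" "odd_part f \<in> Vh"
proof -
  let ?P = "phase_measure R"
  obtain w v where wv: "w \<in> Wh" "v \<in> Vh" "f = (\<lambda>x. w x + v x)" using f unfolding direct_sum_def by blast
  have w: "AE x in ?P. w (reflect x) = w x" and v: "AE x in ?P. v (reflect x) = - v x"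
    using wv W(2) V(2) by (auto simp: even_in_def odd_in_def reflect_def case_prod_beta)
  have "f \<in> borel_measurable ?P"
    using L2_measurable[OF fin_dim_subspaceD(1)[OF W(1) wv(1)]] L2_measurable[OF fin_dim_subspaceD(1)[OF V(1) wv(2)]]
    unfolding wv(3) by (rule borel_measurable_add)
  note m = parts_measurable[OF this]
  have "AE x in ?P. w x = even_part f x" using w v by eventually_elim (simp add: even_part_reflect wv(3))
  then show "even_part f \<in> Wh" by (rule fin_dim_subspaceD(4)[OF W(1) wv(1) m(1)])
  have "AE x in ?P. v x = odd_part f x" using w v by eventually_elim (simp add: odd_part_reflect wv(3))
  then show "odd_part f \<in> Vh" by (rule fin_dim_subspaceD(4)[OF V(1) wv(2) m(2)])
qed

end

locale transport_discretization = lipschitz_phase_space R for R +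
  fixes k :: "vec3 \<Rightarrow> real \<Rightarrow> real" and \<sigma>t :: "vec3 \<Rightarrow> real" and kbar \<sigma>a_lo \<sigma>a_hi :: real and Wh Vh :: "field set"
  assumes k_meas: "(\<lambda>(r, \<mu>). k r \<mu>) \<in> borel_measurable (restrict_space lborel (R \<times> {-1..1}))"
    and \<sigma>t_meas: "\<sigma>t \<in> borel_measurable (restrict_space lborel R)"
    and k_bounds: "\<forall>r\<in>R. \<forall>s\<in>sphere (0 :: vec3) 1. \<forall>s'\<in>sphere 0 1. 0 \<le> k r (s \<bullet> s') \<and> k r (s \<bullet> s') \<le> kbar"
    and \<sigma>a_bounds: "\<forall>r\<in>R. \<sigma>a_lo \<le> sigma_a k \<sigma>t r \<and> sigma_a k \<sigma>t r \<le> \<sigma>a_hi"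
    and Wh: "fin_dim_subspace (phase_measure R) Wh" "Wh \<subseteq> even_in R (W_space R)"
    and Vh: "fin_dim_subspace (phase_measure R) Vh" "Vh \<subseteq> odd_in R (V_space R)"
begin

abbreviation "P \<equiv> phase_measure R"

abbreviation "X \<equiv> direct_sum Wh Vh"

lemma kernel_measurable:
  "(\<lambda>x. k (fst (fst x)) (snd (fst x) \<bullet> snd x)) \<in> borel_measurable ((restrict_space lborel R \<Otimes>\<^sub>M sphere_measure) \<Otimes>\<^sub>M sphere_measure)"
    (is "_ \<in> borel_measurable ?M")
proof -
  have id_R: "(\<lambda>r. r) \<in> borel_measurable (restrict_space lborel R)"
    by (intro measurable_restrict_space1) simp
  have id_S: "(\<lambda>s. s) \<in> borel_measurable sphere_measure"
    unfolding measurable_cong_sets[OF sets_surface_measure refl] by (intro measurable_restrict_space1) simp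
  have 1: "(\<lambda>x. fst (fst x)) \<in> borel_measurable ?M"
    by (rule measurable_compose[OF measurable_compose[OF measurable_fst measurable_fst] id_R])
  have 2: "(\<lambda>x. snd (fst x)) \<in> borel_measurable ?M"
    by (rule measurable_compose[OF measurable_compose[OF measurable_fst measurable_snd] id_S])
  have 3: "(\<lambda>x. snd x) \<in> borel_measurable ?M"
    by (rule measurable_compose[OF measurable_snd id_S])
  have "(\<lambda>x. (fst (fst x), snd (fst x) \<bullet> snd x)) \<in> measurable ?M (borel \<Otimes>\<^sub>M borel)"
    by (intro measurable_Pair 1 borel_measurable_inner 2 3)
  then have "(\<lambda>x. (fst (fst x), snd (fst x) \<bullet> snd x)) \<in> measurable ?M lborel"
    unfolding borel_prod by simp
  moreover have "(\<lambda>x. (fst (fst x), snd (fst x) \<bullet> snd x)) \<in> space ?M \<rightarrow> R \<times> {-1..1}"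
  proof
    fix x assume x: "x \<in> space ?M"
    then have "norm (snd (fst x)) = 1" "norm (snd x) = 1" by (auto simp: space_pair_measure)
    then have "\<bar>snd (fst x) \<bullet> snd x\<bar> \<le> 1" using Cauchy_Schwarz_ineq2[of "snd (fst x)" "snd x"] by simp
    then show "(fst (fst x), snd (fst x) \<bullet> snd x) \<in> R \<times> {-1..1}"
      using x by (auto simp: space_pair_measure space_restrict_space abs_le_iff)
  qed
  ultimately have "(\<lambda>x. (fst (fst x), snd (fst x) \<bullet> snd x)) \<in> measurable ?M (restrict_space lborel (R \<times> {-1..1}))"
    by (intro measurable_restrict_space2)
  from measurable_compose[OF this k_meas] show ?thesis by simp
qed

sublocale K: scattering_kernel "restrict_space lborel R" sphere_measure "\<lambda>r s s'. k r (s \<bullet> s')" kbar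
proof -
  interpret S: finite_measure sphere_measure by (rule finite_sphere_measure)
  interpret D: finite_measure "restrict_space lborel R"
    using emeasure_bounded_finite[OF bounded_domain] open_domain
    by (intro finite_measureI) (simp add: space_restrict_space emeasure_restrict_space)
  show "scattering_kernel (restrict_space lborel R) sphere_measure (\<lambda>r s s'. k r (s \<bullet> s')) kbar"
    by unfold_locales (use k_bounds in \<open>auto simp: space_restrict_space kernel_measurable\<close>)
qed

lemma coll_eq: "coll k \<sigma>t f = (\<lambda>x. \<sigma>t (fst x) * f x - K.scatter f x)"
  by (auto simp: coll_def K.scatter_def)

text \<open>A rotation takes \<open>s\<close> to the first coordinate vector, at which \<^const>\<open>sigma_s\<close> is evaluated.\<close>

lemma scattering_row:
  assumes r: "r \<in> R" and s: "s \<in> sphere 0 1"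
  shows "(LINT s'|sphere_measure. k r (s \<bullet> s')) = sigma_s k r"
proof -
  have e: "axis 1 1 \<in> sphere (0::vec3) 1" by (simp add: norm_axis_1)
  obtain f :: "vec3 \<Rightarrow> vec3" where f: "orthogonal_transformation f" "f s = axis 1 1"
    using orthogonal_transformation_exists_1[of s "axis 1 1"] s by (auto simp: norm_axis_1)
  have "(\<lambda>s'. k r (axis 1 1 \<bullet> s')) \<in> borel_measurable sphere_measure"
    using K.measurable_kernel_section[of r "axis 1 1"] r e by (simp add: space_restrict_space)
  then have "(LINT s'|distr sphere_measure sphere_measure f. k r (axis 1 1 \<bullet> s')) = (LINT s'|sphere_measure. k r (axis 1 1 \<bullet> f s'))"
    by (intro integral_distr measurable_sphere_orthogonal[OF f(1)])
  moreover have "axis 1 1 \<bullet> f s' = s \<bullet> s'" for s'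
    using f by (simp add: orthogonal_transformation_def flip: f(2))
  ultimately show ?thesis by (simp add: distr_sphere_orthogonal[OF f(1)] sigma_s_def inner_commute)
qed

text \<open>The bounds on the absorption and on the kernel bound \<open>\<sigma>t = \<sigma>a + \<sigma>s\<close> at every point of \<open>R\<close>.\<close>

lemma sigma_t_mult_L2:
  assumes f: "f \<in> L2 P" shows "(\<lambda>x. \<sigma>t (fst x) * f x) \<in> L2 P"
proof (rule L2_mult_bounded[OF f])
  show "(\<lambda>x. \<sigma>t (fst x)) \<in> borel_measurable P"
    unfolding phase_measure_def by (rule measurable_compose[OF measurable_fst \<sigma>t_meas])
  fix x assume "x \<in> space P"
  then have r: "fst x \<in> R" by (auto simp: space_phase_measure)
  have e: "axis 1 1 \<in> sphere (0::vec3) 1" by (simp add: norm_axis_1)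
  have int: "integrable sphere_measure (\<lambda>s'. k (fst x) (axis 1 1 \<bullet> s'))"
    using K.measurable_kernel_section[of "fst x" "axis 1 1"] r e k_bounds
    by (intro K.N.integrable_const_bound[of _ kbar]) (auto simp: space_restrict_space intro!: AE_I2)
  have bnd: "0 \<le> k (fst x) (axis 1 1 \<bullet> s') \<and> k (fst x) (axis 1 1 \<bullet> s') \<le> kbar" if "s' \<in> space sphere_measure" for s'
    using k_bounds r e that by simp
  have "0 \<le> sigma_s k (fst x)"
    unfolding scattering_row[OF r e, symmetric] using bnd by (intro integral_nonneg_AE AE_I2) blast
  moreover have "sigma_s k (fst x) \<le> (LINT s'|sphere_measure. kbar)"
    unfolding scattering_row[OF r e, symmetric] using bnd int by (intro integral_mono) auto
  ultimately show "\<bar>\<sigma>t (fst x)\<bar> \<le> \<bar>\<sigma>a_lo\<bar> + \<bar>\<sigma>a_hi\<bar> + (LINT s'|sphere_measure. kbar)"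
    using \<sigma>a_bounds r unfolding sigma_a_def by force
qed

lemma L2_coll:
  assumes "f \<in> L2 P" shows "coll k \<sigma>t f \<in> L2 P"
  using L2_lincomb[OF sigma_t_mult_L2[OF assms] K.L2_scatter[folded phase_measure_def, OF assms], of 1 "-1"]
  by (simp add: coll_eq)

lemma coll_lincomb:
  assumes f: "f \<in> L2 P" and g: "g \<in> L2 P"
  shows "AE x in P. coll k \<sigma>t (\<lambda>x. a * f x + b * g x) x = a * coll k \<sigma>t f x + b * coll k \<sigma>t g x"
  using K.scatter_lincomb[of f g a b] assms unfolding phase_measure_def coll_eq
  by (auto elim!: eventually_mono simp: algebra_simps)

lemma coll_AE_zero: "AE x in P. f x = 0 \<Longrightarrow> AE x in P. coll k \<sigma>t f x = 0"
  using K.scatter_AE_zero[of f] unfolding phase_measure_def coll_eq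
  by (auto elim!: eventually_elim2)

lemma coll_coercive:
  assumes f: "f \<in> L2 P" shows "\<sigma>a_lo * ip P f f \<le> ip P (coll k \<sigma>t f) f"
  unfolding coll_eq phase_measure_def
proof (rule K.collision_coercive)
  show "k r (s \<bullet> s') = k r (s' \<bullet> s)" for r and s s' :: vec3 by (simp add: inner_commute)
  show "(LINT s'|sphere_measure. k r (s \<bullet> s')) = sigma_s k r"
    if "r \<in> space (restrict_space lborel R)" "s \<in> space sphere_measure" for r s
    using scattering_row that by (simp add: space_restrict_space)
  show "\<sigma>a_lo \<le> \<sigma>t r - sigma_s k r" if "r \<in> space (restrict_space lborel R)" for r
    using \<sigma>a_bounds that by (simp add: space_restrict_space sigma_a_def)
qed (use f sigma_t_mult_L2[OF f] in \<open>simp_all add: phase_measure_def\<close>)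

lemma fin_dim_X: "fin_dim_subspace P X"
  by (rule fin_dim_subspace_direct_sum[OF Wh(1) Vh(1)])

lemma X_parts:
  assumes "f \<in> X"
  shows "even_part f \<in> W_space R" "odd_part f \<in> L2 P" "f \<in> L2 P"
  using parts_direct_sum[OF Wh Vh assms] Wh(2) fin_dim_subspaceD(1)[OF Vh(1)] fin_dim_subspaceD(1)[OF fin_dim_X assms]
  by (auto simp: even_in_def)

text \<open>Half of the weight \<open>\<bar>s \<cdot> n\<bar>\<close> goes to each factor of the boundary term, so that both are square integrable.\<close>

definition trace_part :: "field \<Rightarrow> field" where
  "trace_part f = (\<lambda>x. sqrt \<bar>sn R x\<bar> * bdry_trace R (even_part f) x)"

definition stream_part :: "field \<Rightarrow> field" where
  "stream_part f = stream R (even_part f)"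

lemma L2_parts:
  assumes "f \<in> X"
  shows "trace_part f \<in> L2 (bdry_measure R)" "stream_part f \<in> L2 P" "odd_part f \<in> L2 P" "coll k \<sigma>t f \<in> L2 P" "f \<in> L2 P"
  using W_space_imp[OF X_parts(1)[OF assms]] X_parts[OF assms] L2_coll[OF X_parts(3)[OF assms]]
  by (auto simp: trace_part_def stream_part_def has_trace_def)

text \<open>All four terms are inner products of maps that are linear up to null sets, from which bilinearity follows.\<close>

lemma Bform_eq:
  "Bform R k \<sigma>t f \<psi> = ip (bdry_measure R) (trace_part f) (trace_part \<psi>) + ip P (coll k \<sigma>t f) \<psi>
     - ip P (odd_part f) (stream_part \<psi>) + ip P (stream_part f) (odd_part \<psi>)"
proof -
  have sq: "\<bar>y\<bar> * t * t' = (sqrt \<bar>y\<bar> * t) * (sqrt \<bar>y\<bar> * t')" for y t t' :: real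
  proof -
    have "(sqrt \<bar>y\<bar> * t) * (sqrt \<bar>y\<bar> * t') = (sqrt \<bar>y\<bar> * sqrt \<bar>y\<bar>) * t * t'" by (simp only: mult_ac)
    then show ?thesis by simp
  qed
  have "(LINT x|bdry_measure R. \<bar>sn R x\<bar> * bdry_trace R (even_part f) x * bdry_trace R (even_part \<psi>) x)
      = ip (bdry_measure R) (trace_part f) (trace_part \<psi>)"
    unfolding ip_def trace_part_def by (rule Bochner_Integration.integral_cong[OF refl sq])
  then show ?thesis by (simp add: Bform_def stream_part_def)
qed

lemma parts_lincomb_AE:
  assumes f: "f \<in> X" and g: "g \<in> X"
  shows "AE x in bdry_measure R. trace_part (\<lambda>x. a * f x + b * g x) x = a * trace_part f x + b * trace_part g x"
    "AE x in P. stream_part (\<lambda>x. a * f x + b * g x) x = a * stream_part f x + b * stream_part g x"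
proof -
  note h = X_parts(1)[OF fin_dim_subspaceD(3)[OF fin_dim_X f g], unfolded parts_lincomb(1)]
  show "AE x in bdry_measure R. trace_part (\<lambda>x. a * f x + b * g x) x = a * trace_part f x + b * trace_part g x"
    using bdry_trace_lincomb[OF X_parts(1)[OF f] X_parts(1)[OF g] h] by (simp add: trace_part_def parts_lincomb(1))
  show "AE x in P. stream_part (\<lambda>x. a * f x + b * g x) x = a * stream_part f x + b * stream_part g x"
    using stream_lincomb[OF X_parts(1)[OF f] X_parts(1)[OF g] h] by (simp add: stream_part_def parts_lincomb(1))
qed

lemma ip_lincomb_AE:
  assumes "f \<in> L2 M" "g \<in> L2 M" "h \<in> L2 M" "h' \<in> L2 M" "AE x in M. h' x = a * f x + b * g x"
  shows "ip M h' h = a * ip M f h + b * ip M g h" "ip M h h' = a * ip M h f + b * ip M h g"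
proof -
  have "ip M h' h = ip M (\<lambda>x. a * f x + b * g x) h"
    by (intro ip_cong_AE assms L2_measurable L2_lincomb)
  then show "ip M h' h = a * ip M f h + b * ip M g h" by (simp add: ip_lincomb_left[OF assms(1-3)])
  then show "ip M h h' = a * ip M h f + b * ip M h g" by (simp add: ip_commute[of M h])
qed

lemma Bform_left_linear:
  assumes f: "f \<in> X" and g: "g \<in> X" and \<psi>: "\<psi> \<in> X"
  shows "Bform R k \<sigma>t (\<lambda>x. a * f x + b * g x) \<psi> = a * Bform R k \<sigma>t f \<psi> + b * Bform R k \<sigma>t g \<psi>"
proof -
  note h = fin_dim_subspaceD(3)[OF fin_dim_X f g, of a b]
  note F = L2_parts[OF f] and G = L2_parts[OF g] and H = L2_parts[OF h] and \<Psi> = L2_parts[OF \<psi>]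
  show ?thesis
    unfolding Bform_eq ip_lincomb_AE(1)[OF F(1) G(1) \<Psi>(1) H(1) parts_lincomb_AE(1)[OF f g]]
      ip_lincomb_AE(1)[OF F(4) G(4) \<Psi>(5) H(4) coll_lincomb[OF F(5) G(5)]]
      ip_lincomb_AE(1)[OF F(2) G(2) \<Psi>(3) H(2) parts_lincomb_AE(2)[OF f g]]
      parts_lincomb(2) ip_lincomb_left[OF F(3) G(3) \<Psi>(2)]
    by (simp add: algebra_simps)
qed

lemma Bform_right_linear:
  assumes f: "f \<in> X" and g: "g \<in> X" and \<psi>: "\<psi> \<in> X"
  shows "Bform R k \<sigma>t \<psi> (\<lambda>x. a * f x + b * g x) = a * Bform R k \<sigma>t \<psi> f + b * Bform R k \<sigma>t \<psi> g"
proof -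
  note h = fin_dim_subspaceD(3)[OF fin_dim_X f g, of a b]
  note F = L2_parts[OF f] and G = L2_parts[OF g] and H = L2_parts[OF h] and \<Psi> = L2_parts[OF \<psi>]
  show ?thesis
    unfolding Bform_eq ip_lincomb_AE(2)[OF F(1) G(1) \<Psi>(1) H(1) parts_lincomb_AE(1)[OF f g]]
      ip_lincomb_AE(2)[OF F(2) G(2) \<Psi>(3) H(2) parts_lincomb_AE(2)[OF f g]]
      ip_lincomb_AE(2)[OF F(5) G(5) \<Psi>(4) H(5) always_eventually[OF allI[OF refl]]]
      ip_lincomb_AE(2)[OF F(3) G(3) \<Psi>(2) H(3) always_eventually[OF allI[OF fun_cong[OF parts_lincomb(2)]]]]
    by (simp add: algebra_simps)
qed

text \<open>Zero is a weak derivative and a trace of a function that vanishes almost everywhere, so by uniqueness the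
  chosen ones are zero almost everywhere (for the trace after weighting).\<close>

lemma Bform_left_null:
  assumes f: "f \<in> X" and \<psi>: "\<psi> \<in> X" and zero: "AE x in P. f x = 0"
  shows "Bform R k \<sigma>t f \<psi> = 0"
proof -
  note E = W_space_imp[OF X_parts(1)[OF f]]
  have null: "ip M h h' = 0" if "AE x in M. h x = 0" for M :: "(vec3 \<times> vec3) measure" and h h'
    unfolding ip_def by (rule integral_eq_zero_AE) (use that in \<open>eventually_elim, simp\<close>)
  have e: "ip P (even_part f) h = 0" for h by (rule null[OF parts_AE_zero(1)[OF zero]])
  have "has_stream R (even_part f) (\<lambda>_. 0)"
    by (simp add: has_stream_def e) (simp add: ip_def L2_def)
  then have st: "AE x in P. stream_part f x = 0"
    unfolding stream_part_def by (rule has_stream_unique[OF E(2)])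
  have "has_trace R (even_part f) (\<lambda>_. 0)"
    by (simp add: has_trace_def e null[OF st, unfolded stream_part_def]) (simp add: L2_def)
  then have "AE x in bdry_measure R. trace_part f x = 0"
    using has_trace_unique[OF E(3)] by (simp add: trace_part_def)
  then show ?thesis
    unfolding Bform_eq using st coll_AE_zero[OF zero] parts_AE_zero(2)[OF zero] by (simp add: null)
qed

text \<open>With equal arguments the two streaming terms cancel and the boundary term is a square.\<close>

lemma Bform_coercive:
  assumes "f \<in> X" shows "\<sigma>a_lo * ip P f f \<le> Bform R k \<sigma>t f f"
  using coll_coercive[OF L2_parts(5)[OF assms]] ip_self_nonneg[of "bdry_measure R" "trace_part f"]
  by (simp add: Bform_eq ip_commute[of P "odd_part f"])

end

theorem lemma6p4:
  fixes R :: "vec3 set" and T kbar \<sigma>a_lo \<sigma>a_hi t :: real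
    and k :: "vec3 \<Rightarrow> real \<Rightarrow> real" and \<sigma>t :: "vec3 \<Rightarrow> real"
    and Wh Vh :: "field set"
    and qhat \<phi>0 \<phi>hat :: field
    and \<phi>h :: "real \<Rightarrow> field"
  assumes "bounded R" and "lipschitz_domain R" and "T > 0"
    and "(\<lambda>(r, \<mu>). k r \<mu>) \<in> Linf (restrict_space lborel (R \<times> {-1..1}))"
    and "\<sigma>t \<in> Linf (restrict_space lborel R)"
    and A1: "\<forall>r\<in>R. \<forall>s\<in>sphere (0 :: vec3) 1. \<forall>s'\<in>sphere 0 1.
            0 \<le> k r (s \<bullet> s') \<and> k r (s \<bullet> s') \<le> kbar"
    and A2: "0 < \<sigma>a_lo" "\<forall>r\<in>R. \<sigma>a_lo \<le> sigma_a k \<sigma>t r \<and> sigma_a k \<sigma>t r \<le> \<sigma>a_hi"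
    and A3: "fin_dim_subspace (phase_measure R) Wh" "Wh \<subseteq> even_in R (W_space R)"
            "fin_dim_subspace (phase_measure R) Vh" "Vh \<subseteq> odd_in R (V_space R)"
    and A4: "\<forall>w\<in>Wh. stream R w \<in> Vh"
    and "qhat \<in> L2 (phase_measure R)"
    and "\<phi>0 \<in> direct_sum (even_in R (W_space R)) (odd_in R (W_space R))"
    and "solves_SPh R k \<sigma>t Wh Vh qhat \<phi>hat"
    and "solves_SD R k \<sigma>t T Wh Vh (\<lambda>_. qhat) \<phi>0 \<phi>h"
    and "0 \<le> t" and "t \<le> T"
  shows "(L2norm (phase_measure R) (\<lambda>x. \<phi>h t x - \<phi>hat x))\<^sup>2
           \<le> exp (- \<sigma>a_lo * t) * (L2norm (phase_measure R) (\<lambda>x. \<phi>h 0 x - \<phi>hat x))\<^sup>2"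
proof -
  interpret transport_discretization R k \<sigma>t kbar \<sigma>a_lo \<sigma>a_hi Wh Vh
    by unfold_locales (use assms in \<open>simp_all add: Linf_def\<close>)
  interpret coercive_form "phase_measure R" "direct_sum Wh Vh" "Bform R k \<sigma>t" \<sigma>a_lo
    by unfold_locales
      (rule fin_dim_X Bform_left_linear Bform_right_linear Bform_left_null Bform_coercive; assumption)+
  from \<open>solves_SD R k \<sigma>t T Wh Vh (\<lambda>_. qhat) \<phi>0 \<phi>h\<close> obtain \<phi>'
    where u: "H1_time (phase_measure R) T (direct_sum Wh Vh) \<phi>h \<phi>'"
      and evol: "\<And>\<psi>. \<psi> \<in> direct_sum Wh Vh \<Longrightarrow> AE t in time_measure T.
        ip (phase_measure R) (\<phi>' t) \<psi> + Bform R k \<sigma>t (\<phi>h t) \<psi> = ip (phase_measure R) qhat \<psi>"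
    unfolding solves_SD_def by blast
  have stat: "\<phi>hat \<in> direct_sum Wh Vh"
    "\<And>\<psi>. \<psi> \<in> direct_sum Wh Vh \<Longrightarrow> Bform R k \<sigma>t \<phi>hat \<psi> = ip (phase_measure R) qhat \<psi>"
    using \<open>solves_SPh R k \<sigma>t Wh Vh qhat \<phi>hat\<close> by (simp_all add: solves_SPh_def)
  have "(L2norm (phase_measure R) (\<lambda>x. \<phi>h t x - \<phi>hat x))\<^sup>2
      \<le> exp (- 2 * \<sigma>a_lo * t) * (L2norm (phase_measure R) (\<lambda>x. \<phi>h 0 x - \<phi>hat x))\<^sup>2"
    by (rule exponential_decay[OF \<open>T > 0\<close> u stat(1) evol stat(2) \<open>0 \<le> t\<close> \<open>t \<le> T\<close>])
  also have "\<dots> \<le> exp (- \<sigma>a_lo * t) * (L2norm (phase_measure R) (\<lambda>x. \<phi>h 0 x - \<phi>hat x))\<^sup>2"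
    using \<open>0 < \<sigma>a_lo\<close> \<open>0 \<le> t\<close> by (intro mult_right_mono) auto
  finally show ?thesis .
qed

end
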